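(* Let $\Omega:=\,]0,+\infty[\times\mathbb{R}^2$. Then there is a vector field $b:\,]0,1[\times\Omega\to\mathbb{R}^3$ such that i) $b\in L^\infty(]0,1[\times\Omega;\mathbb{R}^3)$; ii) $\mathrm{div}\, b\equiv 0$; iii) for every open and bounded set $\Omega_*$ such that its closure satisfies $\bar\Omega_*\subseteq\Omega$, we have $b\in L^1([0,1[;BV(\Omega_*;\mathbb{R}^3))$; iv) $\mathrm{Tr}\, b\equiv 1$ on $]0,1[\times\partial\Omega$; v) the initial-boundary value problem $$\begin{cases}\partial_t u+\mathrm{div}(bu)=0&\text{in }]0,1[\times\Omega\\ u=0&\text{at }t=0\end{cases}$$ admits infinitely many different (distributional) solutions $u\in L^\infty(]0,1[\times\Omega)$; and such that, moreover, the initial-boundary value problem in v) admits infinitely many solutions that satisfy $\mathrm{Tr}(bu)\equiv0$ on $]0,1[\times\partial\Omega$.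
   Context: Here $\mathrm{div}$ and $\nabla$ denote the (distributional) divergence and the gradient with respect to the space variable $x\in\Omega$ only; $\mathcal{H}^2$ is two-dimensional Hausdorff measure, and $L^\infty(]0,1[\times\partial\Omega)$ is taken with respect to $\mathcal{L}^1\otimes\mathcal{H}^2$. Normal trace of $b$ (with respect to the outward normal), for $b$ bounded with $\mathrm{div}\,b\equiv0$: $\mathrm{Tr}\, b\in L^\infty(]0,1[\times\partial\Omega)$ is the unique function such that for all $\varphi\in C^\infty_c([0,1[\times\mathbb{R}^3)$ $$\int_0^1\!\!\int_{\partial\Omega}\mathrm{Tr}\,b\;\varphi\,d\mathcal{H}^{2}dt-\int_\Omega\varphi(0,x)\,dx=\int_0^1\!\!\int_\Omega(\partial_t\varphi+b\cdot\nabla\varphi)\,dxdt .$$ Traces of $bu$: if $u\in L^\infty(]0,1[\times\Omega)$ satisfies $$\int_0^1\!\!\int_\Omega u(\partial_t\eta+b\cdot\nabla\eta)\,dxdt=0\quad\forall\,\eta\in C^\infty_c(]0,1[\times\Omega),\qquad( * )$$ then there are uniquely determined functions $\mathrm{Tr}(bu)\in L^\infty(]0,1[\times\partial\Omega)$ and $u_0\in L^\infty(\Omega)$ such that for all $\varphi\in C^\infty_c([0,1[\times\mathbb{R}^3)$ $$\int_0^1\!\!\int_{\partial\Omega}\mathrm{Tr}(bu)\,\varphi\,d\mathcal{H}^{2}dt-\int_\Omega\varphi(0,\cdot)u_0\,dx=\int_0^1\!\!\int_\Omega u(\partial_t\varphi+b\cdot\nabla\varphi)\,dxdt .$$ Boundary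 data are prescribed only on $\Gamma^-:=\{\mathrm{Tr}\,b<0\}\subseteq\,]0,1[\times\partial\Omega$. When $\mathrm{Tr}\,b\equiv1$, $\Gamma^-$ is empty (up to negligible sets), so no boundary condition is imposed: a distributional solution of the problem in v) is a $u\in L^\infty(]0,1[\times\Omega)$ satisfying $( * )$ and $u_0\equiv0$. *)

theory Defs
  imports "HOL-Analysis.Analysis"
begin

section \<open>Hausdorff measure\<close>

text \<open>Normalised as usual by the volume of the unit ball. Empty sets in a cover cost nothing
  (this only matters for \<open>k = 0\<close>, where \<open>0 ^ 0 = 1\<close>), and boundedness is required because
  \<^const>\<open>diameter\<close> is unspecified on unbounded sets.\<close>

definition hausdorff_pre :: "nat \<Rightarrow> real \<Rightarrow> 'a::metric_space set \<Rightarrow> ennreal" where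
  "hausdorff_pre k \<delta> A =
     (INF C \<in> {C :: nat \<Rightarrow> 'a set. A \<subseteq> (\<Union>j. C j) \<and> (\<forall>j. bounded (C j) \<and> diameter (C j) \<le> \<delta>)}.
        \<Sum>j. (if C j = {} then 0
             else ennreal (unit_ball_vol (real k) * (diameter (C j) / 2) ^ k)))"

definition hausdorff_outer :: "nat \<Rightarrow> 'a::metric_space set \<Rightarrow> ennreal" where
  "hausdorff_outer k A = (SUP \<delta>\<in>{0<..}. hausdorff_pre k \<delta> A)"

definition hausdorff_measure :: "nat \<Rightarrow> 'a::metric_space measure" where
  "hausdorff_measure k = measure_of UNIV (sets borel) (hausdorff_outer k)"

section \<open>Test functions\<close>

primrec C_k :: "nat \<Rightarrow> ('a::euclidean_space \<Rightarrow> 'b::real_normed_vector) \<Rightarrow> bool" where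
  "C_k 0 f \<longleftrightarrow> continuous_on UNIV f"
| "C_k (Suc k) f \<longleftrightarrow>
     (\<forall>x. f differentiable (at x)) \<and>
     (\<forall>e\<in>Basis. C_k k (\<lambda>x. frechet_derivative f (at x) e))"

definition compact_support_in :: "'a::euclidean_space set \<Rightarrow> ('a \<Rightarrow> 'b::real_normed_vector) \<Rightarrow> bool" where
  "compact_support_in U f \<longleftrightarrow> compact (closure {x. f x \<noteq> 0}) \<and> closure {x. f x \<noteq> 0} \<subseteq> U"

text \<open>For open \<open>U\<close>, elements of \<open>C\<^sub>c\<^sup>\<infinity>(U)\<close> are identified with their extensions by zero.\<close>

definition test_functions :: "'a::euclidean_space set \<Rightarrow> ('a \<Rightarrow> real) set" where
  "test_functions U = {f. (\<forall>k. C_k k f) \<and> compact_support_in U f}"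

text \<open>\<open>C\<^sub>c\<^sup>\<infinity>([0,1[ \<times> \<real>\<^sup>n)\<close>, smooth up to and not necessarily vanishing at \<open>t = 0\<close>, consists of
  the restrictions to \<open>t \<ge> 0\<close> of the elements of \<open>C\<^sub>c\<^sup>\<infinity>(]-\<infinity>,1[ \<times> \<real>\<^sup>n)\<close>. Only the values
  for \<open>t \<ge> 0\<close> are used below, so the latter space serves as representatives.\<close>

definition initial_test_functions :: "(real \<times> 'a::euclidean_space \<Rightarrow> real) set" where
  "initial_test_functions = test_functions ({..<1} \<times> UNIV)"

definition dt :: "(real \<times> 'a::euclidean_space \<Rightarrow> real) \<Rightarrow> real \<times> 'a \<Rightarrow> real" where
  "dt \<phi> z = frechet_derivative \<phi> (at z) (1, 0)"

definition grad_x :: "(real \<times> 'a::euclidean_space \<Rightarrow> real) \<Rightarrow> real \<times> 'a \<Rightarrow> 'a" where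
  "grad_x \<phi> z = (\<Sum>e\<in>Basis. frechet_derivative \<phi> (at z) (0, e) *\<^sub>R e)"

section \<open>Function spaces\<close>

text \<open>Elements of \<open>L\<^sup>\<infinity>\<close> are represented by functions; equality is almost everywhere.\<close>

definition Linfty :: "'a measure \<Rightarrow> ('a \<Rightarrow> 'b::real_normed_vector) \<Rightarrow> bool" where
  "Linfty M f \<longleftrightarrow> f \<in> borel_measurable M \<and> (\<exists>C. AE z in M. norm (f z) \<le> C)"

definition infinitely_many_ae :: "'a measure \<Rightarrow> (('a \<Rightarrow> 'b) \<Rightarrow> bool) \<Rightarrow> bool" where
  "infinitely_many_ae M P \<longleftrightarrow>
     (\<exists>S. infinite S \<and> (\<forall>u\<in>S. P u) \<and> pairwise (\<lambda>u v. \<not> (AE z in M. u z = v z)) S)"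

definition row_div :: "(real^'n \<Rightarrow> real^'n^'m) \<Rightarrow> real^'n \<Rightarrow> real^'m" where
  "row_div \<Phi> x = (\<chi> i. \<Sum>j\<in>UNIV. frechet_derivative \<Phi> (at x) (axis j 1) $ i $ j)"

text \<open>The total variation \<open>|Df|(U)\<close>, as a supremum over \<open>C\<^sub>c\<^sup>1\<close> fields bounded by 1 in the
  Frobenius norm. The field \<open>0\<close> competes, so truncating negative integrals is harmless.\<close>

definition variation :: "(real^'n) set \<Rightarrow> (real^'n \<Rightarrow> real^'m) \<Rightarrow> ennreal" where
  "variation U f =
     (SUP \<Phi> \<in> {\<Phi> :: real^'n \<Rightarrow> real^'n^'m.
                C_k 1 \<Phi> \<and> compact_support_in U \<Phi> \<and> (\<forall>x. norm (\<Phi> x) \<le> 1)}.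
        ennreal (LINT x|lebesgue_on U. f x \<bullet> row_div \<Phi> x))"

definition BV :: "(real^'n) set \<Rightarrow> (real^'n \<Rightarrow> real^'m) \<Rightarrow> bool" where
  "BV U f \<longleftrightarrow> integrable (lebesgue_on U) f \<and> variation U f < \<infinity>"

definition BV_norm :: "(real^'n) set \<Rightarrow> (real^'n \<Rightarrow> real^'m) \<Rightarrow> ennreal" where
  "BV_norm U f = (\<integral>\<^sup>+ x. ennreal (norm (f x)) \<partial>lebesgue_on U) + variation U f"

text \<open>\<open>BV\<close> is not separable; as is customary for transport equations, \<open>L\<^sup>1(I; BV(U))\<close> is
  understood in the weak sense (integrability of the norm), not as a Bochner space.\<close>

definition L1_BV :: "real set \<Rightarrow> (real^'n) set \<Rightarrow> (real \<Rightarrow> real^'n \<Rightarrow> real^'m) \<Rightarrow> bool" where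
  "L1_BV I U f \<longleftrightarrow>
     (AE t in lebesgue_on I. BV U (f t)) \<and>
     (\<lambda>t. BV_norm U (f t)) \<in> borel_measurable (lebesgue_on I) \<and>
     (\<integral>\<^sup>+ t. BV_norm U (f t) \<partial>lebesgue_on I) < \<infinity>"

section \<open>The continuity equation on \<open>]0,1[ \<times> \<Omega>\<close>, \<open>\<Omega> \<subseteq> \<real>\<^sup>3\<close>\<close>

definition half_space :: "(real^3) set" where
  "half_space = {x. 0 < x $ 1}"

definition cylinder :: "(real^3) set \<Rightarrow> (real \<times> (real^3)) set" where
  "cylinder \<Omega> = {0<..<1} \<times> \<Omega>"

definition lateral_measure :: "(real^3) set \<Rightarrow> (real \<times> (real^3)) measure" where
  "lateral_measure \<Omega> =
     lebesgue_on {0<..<1} \<Otimes>\<^sub>M restrict_space (hausdorff_measure 2) (frontier \<Omega>)"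

definition divergence_free :: "(real^3) set \<Rightarrow> (real \<times> (real^3) \<Rightarrow> real^3) \<Rightarrow> bool" where
  "divergence_free \<Omega> b \<longleftrightarrow>
     (\<forall>\<eta> \<in> test_functions (cylinder \<Omega>).
        (LINT z|lebesgue_on (cylinder \<Omega>). b z \<bullet> grad_x \<eta> z) = 0)"

text \<open>The traces are determined by the identities below up to null sets.\<close>

definition has_normal_trace ::
    "(real^3) set \<Rightarrow> (real \<times> (real^3) \<Rightarrow> real^3) \<Rightarrow> (real \<times> (real^3) \<Rightarrow> real) \<Rightarrow> bool" where
  "has_normal_trace \<Omega> b g \<longleftrightarrow>
     Linfty (lateral_measure \<Omega>) g \<and>
     (\<forall>\<phi> \<in> initial_test_functions.
        (LINT z|lateral_measure \<Omega>. g z * \<phi> z) - (LINT x|lebesgue_on \<Omega>. \<phi> (0, x)) =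
        (LINT z|lebesgue_on (cylinder \<Omega>). dt \<phi> z + b z \<bullet> grad_x \<phi> z))"

definition has_flux_traces ::
    "(real^3) set \<Rightarrow> (real \<times> (real^3) \<Rightarrow> real^3) \<Rightarrow> (real \<times> (real^3) \<Rightarrow> real) \<Rightarrow>
     (real \<times> (real^3) \<Rightarrow> real) \<Rightarrow> (real^3 \<Rightarrow> real) \<Rightarrow> bool" where
  "has_flux_traces \<Omega> b u g u0 \<longleftrightarrow>
     Linfty (lateral_measure \<Omega>) g \<and> Linfty (lebesgue_on \<Omega>) u0 \<and>
     (\<forall>\<phi> \<in> initial_test_functions.
        (LINT z|lateral_measure \<Omega>. g z * \<phi> z) - (LINT x|lebesgue_on \<Omega>. \<phi> (0, x) * u0 x) =
        (LINT z|lebesgue_on (cylinder \<Omega>). u z * (dt \<phi> z + b z \<bullet> grad_x \<phi> z)))"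

definition continuity_eq ::
    "(real^3) set \<Rightarrow> (real \<times> (real^3) \<Rightarrow> real^3) \<Rightarrow> (real \<times> (real^3) \<Rightarrow> real) \<Rightarrow> bool" where
  "continuity_eq \<Omega> b u \<longleftrightarrow>
     (\<forall>\<eta> \<in> test_functions (cylinder \<Omega>).
        (LINT z|lebesgue_on (cylinder \<Omega>). u z * (dt \<eta> z + b z \<bullet> grad_x \<eta> z)) = 0)"

text \<open>Bounded distributional solution with zero initial datum and \<open>Tr(bu) = g\<close>. No boundary
  condition is included: this is the problem for a field whose normal trace is positive.\<close>

definition zero_initial_solution_with_trace ::
    "(real^3) set \<Rightarrow> (real \<times> (real^3) \<Rightarrow> real^3) \<Rightarrow> (real \<times> (real^3) \<Rightarrow> real) \<Rightarrow>
     (real \<times> (real^3) \<Rightarrow> real) \<Rightarrow> bool" where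
  "zero_initial_solution_with_trace \<Omega> b g u \<longleftrightarrow>
     Linfty (lebesgue_on (cylinder \<Omega>)) u \<and> continuity_eq \<Omega> b u \<and>
     has_flux_traces \<Omega> b u g (\<lambda>_. 0)"

definition zero_initial_solution ::
    "(real^3) set \<Rightarrow> (real \<times> (real^3) \<Rightarrow> real^3) \<Rightarrow> (real \<times> (real^3) \<Rightarrow> real) \<Rightarrow> bool" where
  "zero_initial_solution \<Omega> b u \<longleftrightarrow> (\<exists>g. zero_initial_solution_with_trace \<Omega> b g u)"

end

theory Submission
  imports Defs
begin

text \<open>
  The field is stationary. Write \<open>s = x\<^sub>1\<close> and let \<open>p(s, \<cdot>)\<close> be a phase, linear in
  \<open>(x\<^sub>2, x\<^sub>3)\<close> modulo 1 at \<open>s = 2\<^sup>-\<^sup>k\<close>, which is transported by a velocity \<open>(1, v)\<close>. In the layer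
  \<open>2\<^sup>-\<^sup>k\<^sup>-\<^sup>1 \<le> s < 2\<^sup>-\<^sup>k\<close> the lateral velocity \<open>v\<close> is a sawtooth shear along one of the two axes, the axes
  alternating with \<open>k\<close>. A frequency \<open>2\<^sup>k\<close> thus becomes \<open>2\<^sup>k\<^sup>+\<^sup>2\<close> at bounded speed, since adding
  \<open>3 \<sqdot> 2\<^sup>k\<close> to it modulo 1 needs only displacements of size \<open>2\<^sup>-\<^sup>k\<close>. As \<open>s\<close> tends to 0, profiles
  of \<open>p\<close> converge weakly to their means.

  Put \<open>b = h(p) (1, v)\<close> with \<open>h(p) = A cos (2\<pi>p) - c\<close> and \<open>A > c\<close>. It is divergence free, of bounded variation
  away from the wall, and its outward flux density through the wall is \<open>c\<close>, minus the mean of \<open>h\<close>, although \<open>b\<close>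
  points inwards where \<open>h(p) > 0\<close>. Mass enters through this part: \<open>u = sin (2\<pi>p) (h(p) t - s)\<^sub>+\<^sup>2\<close> solves the
  equation with zero initial datum, and its flux through the wall is the mean of the odd function
  \<open>h(p) sin (2\<pi>p) (h(p) t)\<^sub>+\<^sup>2\<close> of \<open>p\<close>, hence vanishes.

  Here \<open>c\<close> is the density of \<open>\<H>\<^sup>2\<close> with respect to Lebesgue measure on the wall, which makes the normal
  trace 1. That \<open>c = 1\<close> would require the isodiametric inequality, but any finite \<open>c \<ge> 0\<close> will do.
\<close>

section \<open>Integration by parts along one direction\<close>

text \<open>A shear is divergence free because its speed ignores the coordinate it moves, and it
  changes the phase only at the rate of the frequency along that coordinate. Raising the frequency
  on one axis thus uses a frequency already present on the other, which is why two lateral axes take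
  turns. Inside a layer the phase jumps where the sawtooth jumps, but the jump planes contain the
  directions in which the flow moves, so no derivative along the flow meets them. On the wall side
  of the layer the jumps have become integers, which periodic profiles do not see. At the interfaces
  between layers the velocity jumps and the phase has a kink. Right derivatives exist there too, so
  identities between derivatives hold at every point, without exceptional sets. The phase is
  constant on trajectories, hence so are their speed h(p) away from the wall and the quantity h(p) t
  - s; where this is positive, mass that entered after time 0 has arrived. The sine makes
  contributions of the phases p and -p, which have the same h, cancel in the flux.\<close>

definition rderiv :: "'a::real_vector \<Rightarrow> ('a \<Rightarrow> real) \<Rightarrow> 'a \<Rightarrow> real \<Rightarrow> bool" where
  "rderiv e W z d \<longleftrightarrow> ((\<lambda>h. W (z + h *\<^sub>R e)) has_real_derivative d) (at_right 0)"

lemma integrable_indicator_cball: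
  "integrable lborel (\<lambda>x::'a::euclidean_space. K * indicator (cball 0 R) x :: real)"
  using emeasure_bounded_finite[of "cball (0::'a) R"] by (simp add: integrable_real_mult_indicator)

lemma integrable_bounded_support:
  fixes f :: "'a::euclidean_space \<Rightarrow> real"
  assumes "f \<in> borel_measurable borel" "\<And>x. \<bar>f x\<bar> \<le> M" "\<And>x. R < norm x \<Longrightarrow> f x = 0"
  shows "integrable lborel f"
proof (rule Bochner_Integration.integrable_bound)
  show "integrable lborel (\<lambda>x. M * indicator (cball (0::'a) R) x :: real)"
    by (rule integrable_indicator_cball)
  show "f \<in> borel_measurable lborel" using assms(1) by simp
  show "AE x in lborel. norm (f x) \<le> norm (M * indicator (cball 0 R) x)"
  proof (rule AE_I2)
    fix x show "norm (f x) \<le> norm (M * indicator (cball 0 R) x)"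
      using assms(2)[of x] assms(3)[of x] by (cases "norm x \<le> R") auto
  qed
qed

lemma bounded_support_convergence:
  fixes q :: "nat \<Rightarrow> 'a::euclidean_space \<Rightarrow> real"
  assumes [measurable]: "\<And>n. q n \<in> borel_measurable borel" and lim: "\<And>x. (\<lambda>n. q n x) \<longlonglongrightarrow> Q x"
    and dom: "\<And>n x. \<bar>q n x\<bar> \<le> K * indicator (cball 0 R) x"
  shows "integrable lborel Q" "(\<lambda>n. integral\<^sup>L lborel (q n)) \<longlonglongrightarrow> integral\<^sup>L lborel Q"
proof -
  have [measurable]: "Q \<in> borel_measurable borel"
    by (rule borel_measurable_LIMSEQ_real[OF lim]) measurable
  show "integrable lborel Q"
    by (rule integrable_dominated_convergence[OF _ _ integrable_indicator_cball, of Q q K R]) (use lim dom in auto)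
  show "(\<lambda>n. integral\<^sup>L lborel (q n)) \<longlonglongrightarrow> integral\<^sup>L lborel Q"
    by (rule integral_dominated_convergence[OF _ _ integrable_indicator_cball, of Q q K R]) (use lim dom in auto)
qed

lemma rderiv_LIMSEQ:
  assumes "rderiv e W x d"
  shows "(\<lambda>n. (W (x + inverse (real (Suc n)) *\<^sub>R e) - W x) / inverse (real (Suc n))) \<longlonglongrightarrow> d"
proof -
  have "((\<lambda>k. (W (x + k *\<^sub>R e) - W x) / k) \<longlongrightarrow> d) (at_right 0)"
    using assms unfolding rderiv_def has_field_derivative_iff by simp
  moreover have "filterlim (\<lambda>n. inverse (real (Suc n))) (at_right 0) sequentially"
    using LIMSEQ_inverse_real_of_nat by (auto simp: filterlim_at)
  ultimately show ?thesis by (rule filterlim_compose)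
qed

lemma integral_translate:
  fixes f :: "'a::euclidean_space \<Rightarrow> real"
  assumes "f \<in> borel_measurable borel"
  shows "(LINT x|lborel. f (x + a)) = (LINT x|lborel. f x)"
proof -
  have "(LINT x|lborel. f x) = (LINT x|distr lborel borel ((+) a). f x)"
    by (simp add: lborel_distr_plus)
  also have "\<dots> = (LINT x|lborel. f (a + x))"
    using assms by (intro integral_distr) auto
  finally show ?thesis by (simp add: add.commute)
qed

lemma integrable_translate:
  fixes f :: "'a::euclidean_space \<Rightarrow> real"
  assumes "integrable lborel f"
  shows "integrable lborel (\<lambda>x. f (x + a))"
proof -
  have "integrable (distr lborel borel ((+) a)) f"
    using assms by (simp add: lborel_distr_plus)
  then have "integrable lborel (\<lambda>x. f (a + x))"
    by (subst (asm) integrable_distr_eq) (use borel_measurable_integrable[OF assms] in auto)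
  then show ?thesis by (simp add: add.commute)
qed

text \<open>Translation invariance makes the integrals of all difference quotients vanish, so that
  integration by parts needs neither Fubini nor smoothness in the other directions.\<close>

lemma integral_rderiv:
  fixes W :: "'a::euclidean_space \<Rightarrow> real"
  assumes W: "W \<in> borel_measurable borel" and bd: "\<And>x. \<bar>W x\<bar> \<le> M"
    and supp: "\<And>x. R < norm x \<Longrightarrow> W x = 0"
    and lip: "\<And>x h. 0 \<le> h \<Longrightarrow> h \<le> 1 \<Longrightarrow> \<bar>W (x + h *\<^sub>R e) - W x\<bar> \<le> L * h"
    and d: "\<And>x. rderiv e W x (W' x)" and e: "norm e \<le> 1"
  shows "integrable lborel W'" "(LINT x|lborel. W' x) = 0"
proof -
  define h :: "nat \<Rightarrow> real" where "h n = inverse (real (Suc n))" for n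
  have h: "0 < h n" "h n \<le> 1" for n unfolding h_def by (auto simp: divide_simps)
  define q where "q n x = (W (x + h n *\<^sub>R e) - W x) / h n" for n x
  have iW: "integrable lborel W" by (rule integrable_bounded_support[OF W bd supp])
  have m[measurable]: "q n \<in> borel_measurable borel" for n
    unfolding q_def using W by measurable
  have i: "integral\<^sup>L lborel (q n) = 0" for n
    unfolding q_def using iW integrable_translate[OF iW] integral_translate[OF W] by simp
  have lim: "(\<lambda>n. q n x) \<longlonglongrightarrow> W' x" for x
    unfolding q_def h_def by (rule rderiv_LIMSEQ[OF d])
  have dom: "\<bar>q n x\<bar> \<le> L * indicator (cball 0 (R + 1)) x" for n x
  proof (cases "norm x \<le> R + 1")
    case True
    have "\<bar>W (x + h n *\<^sub>R e) - W x\<bar> \<le> L * h n" using h[of n] by (intro lip) auto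
    then show ?thesis using True h[of n] by (simp add: q_def abs_divide pos_divide_le_eq)
  next
    case False
    have "norm (h n *\<^sub>R e) \<le> 1" using h[of n] e by (simp add: mult_le_one)
    then have "R < norm (x + h n *\<^sub>R e)" using False norm_diff_ineq[of x "h n *\<^sub>R e"] by linarith
    then show ?thesis using False supp by (simp add: q_def)
  qed
  show "integrable lborel W'" by (rule bounded_support_convergence(1)[OF m lim dom])
  show "(LINT x|lborel. W' x) = 0"
    using bounded_support_convergence(2)[OF m lim dom] i by (simp add: LIMSEQ_const_iff)
qed

lemma rderiv_mult:
  assumes "rderiv e f z a" "rderiv e g z b"
  shows "rderiv e (\<lambda>z. f z * g z) z (a * g z + f z * b)"
  using DERIV_mult[OF assms[unfolded rderiv_def]] by (simp add: rderiv_def algebra_simps)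

lemma rderiv_const_along:
  assumes "\<And>h. 0 < h \<Longrightarrow> f (z + h *\<^sub>R e) = f z"
  shows "rderiv e f z 0"
proof -
  have "eventually (\<lambda>h. (f (z + h *\<^sub>R e) - f z) / h = 0) (at_right 0)"
    using assms by (auto simp: eventually_at_filter)
  then show ?thesis
    unfolding rderiv_def has_field_derivative_iff
    by (auto intro: tendsto_eventually)
qed

lemma lip_mult:
  fixes f g :: "'a::real_vector \<Rightarrow> real"
  assumes "\<And>x. \<bar>f x\<bar> \<le> M" "\<And>x. \<bar>g x\<bar> \<le> N"
    and "\<And>x h. 0 \<le> h \<Longrightarrow> h \<le> 1 \<Longrightarrow> \<bar>f (x + h *\<^sub>R e) - f x\<bar> \<le> K * h"
    and "\<And>x h. 0 \<le> h \<Longrightarrow> h \<le> 1 \<Longrightarrow> \<bar>g (x + h *\<^sub>R e) - g x\<bar> \<le> L * h"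
    and h: "0 \<le> h" "h \<le> 1"
  shows "\<bar>f (x + h *\<^sub>R e) * g (x + h *\<^sub>R e) - f x * g x\<bar> \<le> (M * L + N * K) * h"
proof -
  let ?y = "x + h *\<^sub>R e"
  have "f ?y * g ?y - f x * g x = f ?y * (g ?y - g x) + g x * (f ?y - f x)"
    by (simp add: algebra_simps)
  also have "\<bar>\<dots>\<bar> \<le> \<bar>f ?y\<bar> * \<bar>g ?y - g x\<bar> + \<bar>g x\<bar> * \<bar>f ?y - f x\<bar>"
    unfolding abs_mult[symmetric] by (rule abs_triangle_ineq)
  also have "\<dots> \<le> M * (L * h) + N * (K * h)"
    using assms(1)[of ?y] assms(1)[of x] assms(2)[of x] assms(3,4)[OF h]
    by (intro add_mono mult_mono) (auto intro: order_trans[OF abs_ge_zero])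
  finally show ?thesis by (simp add: algebra_simps)
qed

section \<open>Test functions of class C^1 with compact support\<close>

locale C1_compact =
  fixes \<phi> :: "'a::euclidean_space \<Rightarrow> real"
  assumes C1: "C_k 1 \<phi>" and supp: "compact (closure {x. \<phi> x \<noteq> 0})"
begin

abbreviation D :: "'a \<Rightarrow> 'a \<Rightarrow> real" where "D e x \<equiv> frechet_derivative \<phi> (at x) e"

lemma has_derivative: "(\<phi> has_derivative frechet_derivative \<phi> (at x)) (at x)"
  using C1 by (simp add: frechet_derivative_works)

lemma cont: "continuous_on UNIV \<phi>"
  using C1 by (simp add: differentiable_imp_continuous_on differentiable_on_def differentiable_at_withinI)

lemma contD: "e \<in> Basis \<Longrightarrow> continuous_on UNIV (D e)"
  using C1 by simp

lemma meas[measurable]: "\<phi> \<in> borel_measurable borel"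
  using cont by (rule borel_measurable_continuous_onI)

lemma measD: "e \<in> Basis \<Longrightarrow> D e \<in> borel_measurable borel"
  using contD by (rule borel_measurable_continuous_onI)

lemma linD: "linear (\<lambda>e. D e x)"
  using has_derivative[of x] has_derivative_linear by blast

lemma D_outside: "x \<notin> closure {x. \<phi> x \<noteq> 0} \<Longrightarrow> D e x = 0"
proof -
  assume x: "x \<notin> closure {x. \<phi> x \<noteq> 0}"
  have "((\<lambda>_. 0) has_derivative (\<lambda>_. 0)) (at x)" by simp
  then have "(\<phi> has_derivative (\<lambda>_. 0)) (at x)"
  proof (rule has_derivative_transform_within_open)
    show "open (- closure {x. \<phi> x \<noteq> 0})" by auto
    show "x \<in> - closure {x. \<phi> x \<noteq> 0}" using x by auto
    show "0 = \<phi> y" if "y \<in> - closure {x. \<phi> x \<noteq> 0}" for y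
      using that closure_subset[of "{x. \<phi> x \<noteq> 0}"] by auto
  qed
  then show ?thesis by (metis frechet_derivative_at)
qed

lemma vanish: obtains R where "\<And>x. R < norm x \<Longrightarrow> \<phi> x = 0" "\<And>x e. R < norm x \<Longrightarrow> D e x = 0" "0 < R"
proof -
  obtain R where R: "0 < R" "\<And>x. x \<in> closure {x. \<phi> x \<noteq> 0} \<Longrightarrow> norm x \<le> R"
    using compact_imp_bounded[OF supp] by (auto simp: bounded_pos)
  show thesis
  proof
    show "\<phi> x = 0" if "R < norm x" for x
      using that R(2)[of x] closure_subset[of "{x. \<phi> x \<noteq> 0}"] by force
    show "D e x = 0" if "R < norm x" for x e
      using that R(2)[of x] by (intro D_outside) auto
  qed (use R in auto)
qed

lemma bounds: obtains M where "\<And>x. \<bar>\<phi> x\<bar> \<le> M" "\<And>e x. e \<in> Basis \<Longrightarrow> \<bar>D e x\<bar> \<le> M" "0 < M"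
proof -
  let ?K = "closure {x. \<phi> x \<noteq> 0}"
  have "bounded (\<phi> ` ?K)"
    by (intro compact_imp_bounded compact_continuous_image supp continuous_on_subset[OF cont]) auto
  then obtain M0 where M0: "0 < M0" "\<And>x. x \<in> ?K \<Longrightarrow> \<bar>\<phi> x\<bar> \<le> M0" by (auto simp: bounded_pos)
  have "\<exists>m. \<forall>x. \<bar>D e x\<bar> \<le> m" if "e \<in> Basis" for e
  proof -
    have "bounded (D e ` ?K)"
      by (intro compact_imp_bounded compact_continuous_image supp continuous_on_subset[OF contD[OF that]]) auto
    then obtain m where m: "0 < m" "\<And>x. x \<in> ?K \<Longrightarrow> \<bar>D e x\<bar> \<le> m" by (auto simp: bounded_pos)
    then have "\<bar>D e x\<bar> \<le> m" for x using D_outside[of x e] by (cases "x \<in> ?K") auto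
    then show ?thesis by blast
  qed
  then obtain m where m: "\<And>e x. e \<in> Basis \<Longrightarrow> \<bar>D e x\<bar> \<le> m e" by metis
  have m0: "0 \<le> m e" if "e \<in> Basis" for e using m[OF that, of 0] by linarith
  have "m e \<le> sum m Basis" if "e \<in> Basis" for e by (rule member_le_sum) (use that m0 in auto)
  note ms = this
  show thesis
  proof
    show "0 < M0 + sum m Basis" using M0 m0 by (simp add: add_pos_nonneg sum_nonneg)
    have s: "0 \<le> sum m Basis" using m0 by (simp add: sum_nonneg)
    show "\<bar>\<phi> x\<bar> \<le> M0 + sum m Basis" for x
    proof (cases "x \<in> ?K")
      case True then show ?thesis using M0(2)[of x] s by linarith
    next
      case False then have "\<phi> x = 0" using closure_subset[of "{x. \<phi> x \<noteq> 0}"] by auto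
      then show ?thesis using M0 s by auto
    qed
    show "\<bar>D e x\<bar> \<le> M0 + sum m Basis" if "e \<in> Basis" for e x
      using m[OF that, of x] ms[OF that] M0 by linarith
  qed
qed

lemma has_real_derivative_line:
  "((\<lambda>h. \<phi> (x + h *\<^sub>R e)) has_real_derivative D e (x + h *\<^sub>R e)) (at h within S)"
proof -
  have "((\<lambda>h. x + h *\<^sub>R e) has_derivative (\<lambda>k. k *\<^sub>R e)) (at h within S)"
    by (auto intro!: derivative_eq_intros)
  from has_derivative_compose[OF this has_derivative]
  have "((\<lambda>h. \<phi> (x + h *\<^sub>R e)) has_derivative (\<lambda>k. D (k *\<^sub>R e) (x + h *\<^sub>R e))) (at h within S)" .
  then show ?thesis
    unfolding has_field_derivative_def linear_scale[OF linD] by (simp add: mult_commute_abs)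
qed

lemma rderiv: "rderiv e \<phi> x (D e x)"
  unfolding rderiv_def using has_real_derivative_line[of x e 0] by simp

lemma lipschitz_along:
  assumes "\<And>x. \<bar>D e x\<bar> \<le> M" "0 \<le> h"
  shows "\<bar>\<phi> (x + h *\<^sub>R e) - \<phi> x\<bar> \<le> M * h"
  using field_differentiable_bound[of UNIV "\<lambda>h. \<phi> (x + h *\<^sub>R e)" "\<lambda>h. D e (x + h *\<^sub>R e)" M h 0]
    has_real_derivative_line assms by auto

lemma
  assumes w: "w \<in> borel_measurable borel" "\<And>x. \<bar>w x\<bar> \<le> M"
  shows integrable_mult: "integrable lborel (\<lambda>x. w x * \<phi> x)"
    and integrable_mult_D: "e \<in> Basis \<Longrightarrow> integrable lborel (\<lambda>x. w x * D e x)"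
proof -
  obtain R where R: "\<And>x. R < norm x \<Longrightarrow> \<phi> x = 0" "\<And>x e. R < norm x \<Longrightarrow> D e x = 0" using vanish by metis
  obtain N where N: "\<And>x. \<bar>\<phi> x\<bar> \<le> N" "\<And>e x. e \<in> Basis \<Longrightarrow> \<bar>D e x\<bar> \<le> N" using bounds by metis
  have *: "integrable lborel (\<lambda>x. w x * f x)"
    if f: "f \<in> borel_measurable borel" "\<And>x. \<bar>f x\<bar> \<le> N" "\<And>x. R < norm x \<Longrightarrow> f x = 0" for f
  proof (rule integrable_bounded_support)
    show "\<bar>w x * f x\<bar> \<le> M * N" for x
      using w(2)[of x] f(2)[of x] by (simp add: abs_mult mult_mono')
    show "(\<lambda>x. w x * f x) \<in> borel_measurable borel" using w(1) f(1) by (rule borel_measurable_times)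
    show "w x * f x = 0" if "R < norm x" for x using f(3)[OF that] by simp
  qed
  show "integrable lborel (\<lambda>x. w x * \<phi> x)" by (rule *[OF meas N(1) R(1)])
  show "integrable lborel (\<lambda>x. w x * D e x)" if "e \<in> Basis" by (rule *[OF measD[OF that] N(2)[OF that] R(2)])
qed

text \<open>The product of \<open>w\<close> and \<phi> has bounded support, so
  \<open>integral_rderiv\<close> applies to it. Regularity of \<open>w\<close> is asked in the
  direction \<open>e\<close> alone, which leaves it free to jump across planes parallel to
  \<open>e\<close>.\<close>

lemma integration_by_parts:
  assumes w: "w \<in> borel_measurable borel" "\<And>x. \<bar>w x\<bar> \<le> M"
    and lip: "\<And>x h. 0 \<le> h \<Longrightarrow> h \<le> 1 \<Longrightarrow> \<bar>w (x + h *\<^sub>R e) - w x\<bar> \<le> L * h"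
    and d: "\<And>x. rderiv e w x (w' x)" and e: "e \<in> Basis"
  shows "integrable lborel (\<lambda>x. w' x * \<phi> x)"
    and "(LINT x|lborel. w' x * \<phi> x) = - (LINT x|lborel. w x * D e x)"
proof -
  obtain R where R: "\<And>x. R < norm x \<Longrightarrow> \<phi> x = 0" using vanish by metis
  obtain N where N: "\<And>x. \<bar>\<phi> x\<bar> \<le> N" "\<And>x. \<bar>D e x\<bar> \<le> N" using bounds e by metis
  note [measurable] = w(1)
  have b: "\<bar>w x * \<phi> x\<bar> \<le> M * N" for x
    using w(2)[of x] N(1)[of x] by (simp add: abs_mult mult_mono')
  have i: "integrable lborel (\<lambda>x. w' x * \<phi> x + w x * D e x)" "(LINT x|lborel. w' x * \<phi> x + w x * D e x) = 0"
    using integral_rderiv[where W = "\<lambda>x. w x * \<phi> x" and M = "M * N" and R = R and e = e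
        and L = "M * N + N * L" and W' = "\<lambda>x. w' x * \<phi> x + w x * D e x"]
      rderiv_mult[OF d rderiv] R lip_mult[of w M \<phi> N e L N, OF w(2) N(1) lip lipschitz_along[OF N(2)]]
      b e by auto
  have j: "integrable lborel (\<lambda>x. w x * D e x)" by (rule integrable_mult_D[OF w e])
  show k: "integrable lborel (\<lambda>x. w' x * \<phi> x)"
    using Bochner_Integration.integrable_diff[OF i(1) j] by simp
  show "(LINT x|lborel. w' x * \<phi> x) = - (LINT x|lborel. w x * D e x)"
    using i(2) j k by simp
qed

end

section \<open>The phase and the shear velocity\<close>

text \<open>The share of the k-th sawtooth that has been added to the phase at depth s: 0 down to s
  = 2^-k, then growing linearly towards the wall, and 1 from s = 2^-(k+1) on.\<close>

definition ramp :: "nat \<Rightarrow> real \<Rightarrow> real" where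
  "ramp k s = max 0 (min 1 (2 * (1 - 2 ^ k * s)))"

text \<open>Closed at the lower end, so that \<open>- (2 ^ Suc k * layer k s)\<close> is the right
  derivative of \<open>ramp k\<close> at every s, the end points included.\<close>

definition layer :: "nat \<Rightarrow> real \<Rightarrow> real" where
  "layer k s = of_bool (1 / 2 ^ Suc k \<le> s \<and> s < 1 / 2 ^ k)"

text \<open>In layer k the velocity is parallel to the axis \<open>along k\<close> and its size
  depends on the coordinate \<open>across k\<close>. On entering the layer the phase has frequency
  2^(k+1) on the first axis and 2^k on the second.\<close>

definition along :: "nat \<Rightarrow> 3" where "along k = (if even k then 2 else 3)"
definition across :: "nat \<Rightarrow> 3" where "across k = (if even k then 3 else 2)"

text \<open>The factor takes the frequency on the axis \<open>across k\<close> from 2^k to 2^(k+2),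
  twice the frequency 2^(k+1) on the other axis. This is the initial configuration again, one layer
  further and with the axes exchanged.\<close>

definition saw :: "nat \<Rightarrow> real^3 \<Rightarrow> real" where
  "saw k x = frac (3 * 2 ^ k * x $ across k)"

definition phase_upto :: "nat \<Rightarrow> real^3 \<Rightarrow> real" where
  "phase_upto n x = 2 * x $ 2 + x $ 3 + (\<Sum>k<n. ramp k (x $ 1) * saw k x)"

definition vel_upto :: "nat \<Rightarrow> real^3 \<Rightarrow> real^3" where
  "vel_upto n x = (\<Sum>k<n. (layer k (x $ 1) * saw k x) *\<^sub>R axis (along k) 1)"

text \<open>Chosen so that ramps and layers of index \<open>level s\<close> or more vanish at depth
  s > 0, by n \<le> 2^n. For s \<le> 0 it is 0, a value that the cutoff to the domain hides.\<close>

definition level :: "real \<Rightarrow> nat" where "level s = nat \<lceil>1 / s\<rceil>"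

definition phase :: "real^3 \<Rightarrow> real" where "phase x = phase_upto (level (x $ 1)) x"
definition vel :: "real^3 \<Rightarrow> real^3" where "vel x = vel_upto (level (x $ 1)) x"

section \<open>Ramps, layers and the reduction to finitely many of them\<close>

lemma axis_neq: "along k \<noteq> 1" "across k \<noteq> 1" "along k \<noteq> across k"
  by (auto simp: along_def across_def)

lemma ramp_bounds: "0 \<le> ramp k s" "ramp k s \<le> 1"
  by (auto simp: ramp_def)

lemma ramp_lipschitz: "\<bar>ramp k s - ramp k s'\<bar> \<le> 2 ^ Suc k * \<bar>s - s'\<bar>"
proof -
  have "\<bar>max 0 (min 1 a) - max 0 (min 1 b)\<bar> \<le> \<bar>a - b\<bar>" for a b :: real
    by (auto simp: max_def min_def)
  then have "\<bar>ramp k s - ramp k s'\<bar> \<le> \<bar>2 * (1 - 2 ^ k * s) - 2 * (1 - 2 ^ k * s')\<bar>"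
    unfolding ramp_def .
  also have "2 * (1 - 2 ^ k * s) - 2 * (1 - 2 ^ k * s') = 2 ^ Suc k * (s' - s)"
    by (simp add: algebra_simps)
  finally show ?thesis by (simp add: abs_mult abs_minus_commute)
qed

lemma ramp_eq_0: "1 \<le> 2 ^ k * s \<Longrightarrow> ramp k s = 0"
  by (simp add: ramp_def)

lemma ramp_eq_1: "2 ^ Suc k * s \<le> 1 \<Longrightarrow> ramp k s = 1"
  by (simp add: ramp_def)

lemma layer_eq: "layer k s = of_bool (1 \<le> 2 ^ Suc k * s \<and> 2 ^ k * s < 1)"
  by (simp add: layer_def divide_simps mult.commute)

lemma layer_cases: "layer k s = 0 \<or> layer k s = 1"
  by (simp add: layer_def)

lemma ramp_affine: "\<forall>\<^sub>F h in at_right 0. ramp k (s + h) = ramp k s - h * (2 ^ Suc k * layer k s)"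
proof -
  consider "2 ^ k * s \<ge> 1" | "2 ^ k * s < 1" "1 \<le> 2 ^ Suc k * s" | "2 ^ Suc k * s < 1"
    by linarith
  then show ?thesis
  proof cases
    case 1
    have "ramp k (s + h) = ramp k s - h * (2 ^ Suc k * layer k s)" if "0 < h" for h
    proof -
      have "0 \<le> 2 ^ k * h" using that by simp
      then have "1 \<le> 2 ^ k * (s + h)" using 1 by (simp only: distrib_left)
      then show ?thesis using 1 by (simp add: ramp_eq_0 layer_eq)
    qed
    then show ?thesis by (auto simp: eventually_at_filter)
  next
    case 2
    have "ramp k (s + h) = ramp k s - h * (2 ^ Suc k * layer k s)" if "0 < h" "h < 1 / 2 ^ k - s" for h
    proof -
      have "2 ^ k * h < 1 - 2 ^ k * s" using that(2) by (simp add: field_simps)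
      moreover have "0 < 2 ^ k * h" using that by simp
      ultimately show ?thesis using 2 by (simp add: ramp_def layer_eq algebra_simps)
    qed
    moreover have "0 < 1 / 2 ^ k - s" using 2 by (simp add: field_simps)
    ultimately show ?thesis unfolding eventually_at_right_field by (metis add_0 diff_gt_0_iff_gt)
  next
    case 3
    have "ramp k (s + h) = ramp k s - h * (2 ^ Suc k * layer k s)" if "0 < h" "h < 1 / 2 ^ Suc k - s" for h
    proof -
      have "2 ^ Suc k * (s + h) < 1" using that(2) by (simp add: field_simps)
      then show ?thesis using 3 by (simp add: ramp_eq_1 layer_eq)
    qed
    moreover have "0 < 1 / 2 ^ Suc k - s" using 3 by (simp add: field_simps)
    ultimately show ?thesis unfolding eventually_at_right_field by (metis add_0 diff_gt_0_iff_gt)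
  qed
qed

lemma scaling_nonneg: "1 \<le> 2 ^ m * s \<Longrightarrow> 0 \<le> (s::real)"
  using mult_nonneg_nonpos[of "2 ^ m" s] by force

lemma sum_layer: "(\<Sum>k<n. layer k s) = of_bool (1 \<le> 2 ^ n * s \<and> s < 1)"
proof (induction n)
  case (Suc n)
  define a where "a = 2 ^ n * s"
  have "s \<le> a" if "0 \<le> s"
    using mult_right_mono[OF one_le_power[of 2 n] that] by (simp add: a_def)
  moreover have "0 \<le> s" if "0 \<le> a"
    by (rule mult_left_le_imp_le[of "2 ^ n"]) (use that in \<open>auto simp: a_def\<close>)
  moreover have "layer n s = of_bool (1 \<le> 2 * a \<and> a < 1)"
    by (simp add: layer_eq a_def mult.assoc)
  moreover have "2 ^ Suc n * s = 2 * a" by (simp add: a_def)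
  ultimately show ?case using Suc.IH unfolding sum.lessThan_Suc a_def[symmetric] of_bool_def
    by auto
qed auto

text \<open>The layers are disjoint, so at most one term is nonzero and the bound does not grow with
  \<open>n\<close>. This gives both the bounded velocity and the dominating functions for the limits
  in \<open>n\<close>.\<close>

lemma abs_sum_layer_le:
  assumes "\<And>k. \<bar>a k\<bar> \<le> M"
  shows "\<bar>\<Sum>k<n. layer k s * a k\<bar> \<le> M"
proof -
  have M: "0 \<le> M" using assms[of 0] by linarith
  have "\<bar>\<Sum>k<n. layer k s * a k\<bar> \<le> (\<Sum>k<n. layer k s * M)"
  proof (rule order_trans[OF sum_abs], rule sum_mono)
    fix k show "\<bar>layer k s * a k\<bar> \<le> layer k s * M"
      using assms[of k] layer_cases[of k s] by auto
  qed
  also have "\<dots> = of_bool (1 \<le> 2 ^ n * s \<and> s < 1) * M"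
    by (simp add: sum_distrib_right[symmetric] sum_layer)
  also have "\<dots> \<le> M" using M by auto
  finally show ?thesis .
qed

lemma saw_bounds: "0 \<le> saw k x" "saw k x \<le> 1" "\<bar>saw k x\<bar> \<le> 1"
  using frac_lt_1[of "3 * 2 ^ k * x $ across k"] by (auto simp: saw_def)

lemma sum_cutoff:
  fixes f :: "nat \<Rightarrow> 'b::comm_monoid_add"
  assumes "\<And>k. n \<le> k \<Longrightarrow> f k = 0" "\<And>k. m \<le> k \<Longrightarrow> f k = 0"
  shows "(\<Sum>k<n. f k) = (\<Sum>k<m. f k)"
proof -
  have "(\<Sum>k<n. f k) = (\<Sum>k<max n m. f k)" "(\<Sum>k<m. f k) = (\<Sum>k<max n m. f k)"
    by (rule sum.mono_neutral_left; use assms in auto)+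
  then show ?thesis by simp
qed

lemma level_scaling: assumes "0 < s" "level s \<le> k" shows "1 \<le> 2 ^ k * s"
proof -
  have "1 / s \<le> real k" using assms(2) unfolding level_def by linarith
  also have "real k \<le> 2 ^ k" by (simp add: of_nat_less_two_power less_imp_le)
  finally show ?thesis using assms(1) by (simp add: divide_simps)
qed

lemma scaling_mono: "1 \<le> 2 ^ n * s \<Longrightarrow> n \<le> k \<Longrightarrow> 0 < s \<Longrightarrow> 1 \<le> 2 ^ k * (s::real)"
  using mult_right_mono[of "2 ^ n" "2 ^ k" s] power_increasing[of n k "2::real"] by linarith

text \<open>Replaces the number of terms, which varies from point to point, by one that is fixed on
  the whole region s \<ge> 2^-n.\<close>

lemma phase_eq:
  assumes "0 < x $ 1" "1 \<le> 2 ^ n * x $ 1"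
  shows "phase x = phase_upto n x" "vel x = vel_upto n x"
proof -
  have 1: "ramp k (x $ 1) = 0" "layer k (x $ 1) = 0" if "level (x $ 1) \<le> k" for k
    using level_scaling[OF assms(1) that] by (auto simp: ramp_eq_0 layer_eq)
  have 2: "ramp k (x $ 1) = 0" "layer k (x $ 1) = 0" if "n \<le> k" for k
    using scaling_mono[OF assms(2) that assms(1)] by (auto simp: ramp_eq_0 layer_eq)
  show "phase x = phase_upto n x" unfolding phase_def phase_upto_def
    by (simp, rule sum_cutoff) (use 1 2 in auto)
  show "vel x = vel_upto n x" unfolding vel_def vel_upto_def
    by (rule sum_cutoff) (use 1 2 in auto)
qed

lemma borel_measurable_vec_nth_3[measurable]: "(\<lambda>x::real^3. x $ i) \<in> borel_measurable borel"
  by (intro borel_measurable_continuous_onI continuous_intros)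

lemma measurable_frac[measurable]: "(frac :: real \<Rightarrow> real) \<in> borel_measurable borel"
  unfolding frac_def by measurable

lemma measurable_ramp[measurable]: "ramp k \<in> borel_measurable borel"
  unfolding ramp_def by measurable

lemma measurable_layer[measurable]: "layer k \<in> borel_measurable borel"
  unfolding layer_def by measurable

lemma measurable_saw[measurable]: "saw k \<in> borel_measurable borel"
  unfolding saw_def by measurable

lemma measurable_phase_upto[measurable]: "phase_upto n \<in> borel_measurable borel"
  unfolding phase_upto_def by measurable

lemma measurable_vel_upto[measurable]: "vel_upto n \<in> borel_measurable borel"
  unfolding vel_upto_def by measurable

lemma measurable_level[measurable]: "level \<in> measurable borel (count_space UNIV)"
  unfolding level_def by measurable

lemma measurable_phase[measurable]: "phase \<in> borel_measurable borel"
  unfolding phase_def by (rule measurable_compose_countable[where f = phase_upto]) measurable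

lemma measurable_vel[measurable]: "vel \<in> borel_measurable borel"
  unfolding vel_def by (rule measurable_compose_countable[where f = vel_upto]) measurable

section \<open>The phase under translations\<close>

lemma saw_shift_1: "saw k (x + h *\<^sub>R axis 1 1) = saw k x"
  using axis_neq(2)[of k] by (simp add: saw_def axis_def)

lemma saw_shift_along: "saw k (x + h *\<^sub>R axis (along k) 1) = saw k x"
  using axis_neq(3)[of k] by (simp add: saw_def axis_def)

lemma layer_shift_along: "layer k ((x + h *\<^sub>R axis (along l) 1) $ 1) = layer k (x $ 1)"
  using axis_neq(1)[of l] by (simp add: axis_def)

lemma phase_upto_shift_1:
  "\<forall>\<^sub>F h in at_right 0. phase_upto n (x + h *\<^sub>R axis 1 1) =
     phase_upto n x + (- (\<Sum>k<n. 2 ^ Suc k * (layer k (x $ 1) * saw k x))) * h"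
proof -
  have "\<forall>\<^sub>F h in at_right 0. \<forall>k\<in>{..<n}. ramp k (x $ 1 + h) = ramp k (x $ 1) - h * (2 ^ Suc k * layer k (x $ 1))"
    by (intro eventually_ball_finite ballI ramp_affine) auto
  then show ?thesis
  proof eventually_elim
    case (elim h)
    have "(\<Sum>k<n. ramp k (x $ 1 + h) * saw k x) =
      (\<Sum>k<n. ramp k (x $ 1) * saw k x - 2 ^ Suc k * (layer k (x $ 1) * saw k x) * h)"
      by (rule sum.cong[OF refl]) (use elim in \<open>simp add: left_diff_distrib right_diff_distrib ac_simps\<close>)
    then show ?case
      by (simp add: phase_upto_def saw_shift_1 sum_subtractf sum_distrib_right) (simp add: axis_def)
  qed
qed

lemma phase_upto_lipschitz_1:
  "\<bar>phase_upto n (x + h *\<^sub>R axis 1 1) - phase_upto n x\<bar> \<le> (\<Sum>k<n. 2 ^ Suc k) * \<bar>h\<bar>"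
proof -
  have "phase_upto n (x + h *\<^sub>R axis 1 1) - phase_upto n x =
    (\<Sum>k<n. (ramp k (x $ 1 + h) - ramp k (x $ 1)) * saw k x)"
    by (simp add: phase_upto_def saw_shift_1 sum_subtractf left_diff_distrib) (simp add: axis_def)
  also have "\<bar>\<dots>\<bar> \<le> (\<Sum>k<n. 2 ^ Suc k * \<bar>h\<bar>)"
  proof (rule order_trans[OF sum_abs], rule sum_mono)
    fix k
    show "\<bar>(ramp k (x $ 1 + h) - ramp k (x $ 1)) * saw k x\<bar> \<le> 2 ^ Suc k * \<bar>h\<bar>"
      using mult_mono[OF ramp_lipschitz[of k "x $ 1 + h" "x $ 1"] saw_bounds(3)[of k x]]
      by (simp add: abs_mult del: power_Suc)
  qed
  finally show ?thesis by (simp add: sum_distrib_right)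
qed

text \<open>Up to an integer, \<open>saw k\<close> adds 3 times 2^k to the frequency across. The
  pair (2^(k+1), 2^k) of frequencies along and across thus becomes (2^(k+1), 2^(k+2)), which is the
  pair for k + 1 read in the opposite order, and the axes are exchanged as well.\<close>

lemma sum_saw:
  "\<exists>m::int. 2 * x $ 2 + x $ 3 + (\<Sum>l<k. saw l x) = 2 ^ Suc k * x $ along k + 2 ^ k * x $ across k + of_int m"
proof (induction k)
  case 0
  show ?case by (rule exI[of _ 0]) (simp add: along_def across_def)
next
  case (Suc k)
  then obtain m :: int where m: "2 * x $ 2 + x $ 3 + (\<Sum>l<k. saw l x) =
    2 ^ Suc k * x $ along k + 2 ^ k * x $ across k + of_int m" by blast
  have ax: "along (Suc k) = across k" "across (Suc k) = along k" by (auto simp: along_def across_def)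
  show ?case
    by (rule exI[of _ "m - \<lfloor>3 * 2 ^ k * x $ across k\<rfloor>"])
      (use m in \<open>simp add: ax saw_def frac_def algebra_simps\<close>)
qed

text \<open>In layer k all earlier ramps have reached 1, so \<open>sum_saw\<close> evaluates their
  sum, and all later ones are still 0.\<close>

lemma phase_upto_in_layer:
  assumes "layer k (x $ 1) \<noteq> 0" "k < n"
  shows "\<exists>m::int. phase_upto n x = 2 ^ Suc k * x $ along k + 2 ^ k * x $ across k + ramp k (x $ 1) * saw k x + of_int m"
proof -
  let ?s = "x $ 1"
  have s: "1 \<le> 2 ^ Suc k * ?s" "2 ^ k * ?s < 1" "0 < ?s"
    using assms(1) scaling_nonneg[of "Suc k" ?s] by (auto simp: layer_eq less_le)
  have "(\<Sum>l<n. ramp l ?s * saw l x) = (\<Sum>l<Suc k. ramp l ?s * saw l x)"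
  proof (rule sum.mono_neutral_right)
    show "\<forall>l\<in>{..<n} - {..<Suc k}. ramp l ?s * saw l x = 0"
      using scaling_mono[OF s(1) _ s(3)] by (auto simp: ramp_eq_0)
  qed (use assms in auto)
  also have "\<dots> = (\<Sum>l<k. saw l x) + ramp k ?s * saw k x"
  proof -
    have "ramp l ?s = 1" if "l < k" for l
    proof (rule ramp_eq_1)
      have "2 ^ Suc l * ?s \<le> 2 ^ k * ?s" using that s(3) by (intro mult_right_mono power_increasing) auto
      then show "2 ^ Suc l * ?s \<le> 1" using s(2) by linarith
    qed
    then show ?thesis by simp
  qed
  finally have e: "(\<Sum>l<n. ramp l ?s * saw l x) = (\<Sum>l<k. saw l x) + ramp k ?s * saw k x" .
  obtain m :: int where "2 * x $ 2 + x $ 3 + (\<Sum>l<k. saw l x) = 2 ^ Suc k * x $ along k + 2 ^ k * x $ across k + of_int m"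
    using sum_saw by blast
  then show ?thesis using e by (intro exI[of _ m]) (simp add: phase_upto_def)
qed

text \<open>The sawtooth of this layer does not see the coordinate that is shifted, so the phase
  grows at the constant rate 2^(k+1). By \<open>phase_upto_shift_1\<close> a step away from the wall
  lowers it at the rate 2^(k+1) times \<open>saw k\<close>. With lateral speed \<open>saw k\<close>
  the two effects cancel: the phase is transported by (1, vel).\<close>

lemma phase_upto_shift_along:
  assumes "layer k (x $ 1) \<noteq> 0" "k < n"
  shows "\<exists>m::int. phase_upto n (x + h *\<^sub>R axis (along k) 1) = phase_upto n x + 2 ^ Suc k * h + of_int m"
proof -
  let ?y = "x + h *\<^sub>R axis (along k) 1"
  have "layer k (?y $ 1) \<noteq> 0" using assms by (simp only: layer_shift_along not_False_eq_True)
  from phase_upto_in_layer[OF this assms(2)] obtain m :: int where m: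
    "phase_upto n ?y = 2 ^ Suc k * ?y $ along k + 2 ^ k * ?y $ across k + ramp k (?y $ 1) * saw k ?y + of_int m" by blast
  from phase_upto_in_layer[OF assms] obtain m' :: int where m':
    "phase_upto n x = 2 ^ Suc k * x $ along k + 2 ^ k * x $ across k + ramp k (x $ 1) * saw k x + of_int m'" by blast
  have y: "?y $ along k = x $ along k + h" "?y $ across k = x $ across k" "?y $ 1 = x $ 1"
    using axis_neq[of k] by (auto simp: axis_def)
  show ?thesis using m m' unfolding y saw_shift_along
    by (intro exI[of _ "m - m'"]) (simp add: distrib_left)
qed

section \<open>Transported profiles\<close>

lemma rderiv_eventually:
  assumes "\<forall>\<^sub>F h in at_right 0. W (z + h *\<^sub>R e) = q h" "W z = q 0"
    "(q has_real_derivative d) (at_right 0)"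
  shows "rderiv e W z d"
proof -
  have "((\<lambda>h. (q h - q 0) / h) \<longlongrightarrow> d) (at_right 0)"
    using assms(3) by (simp add: has_field_derivative_iff)
  moreover have "\<forall>\<^sub>F h in at_right 0. (q h - q 0) / h = (W (z + h *\<^sub>R e) - W z) / h"
    using assms(1) by eventually_elim (simp add: assms(2))
  ultimately show ?thesis unfolding rderiv_def has_field_derivative_iff
    by (simp add: tendsto_cong)
qed

section \<open>Space-time notation and cutoffs\<close>

type_synonym spacetime = "real \<times> (real^3)"

definition in_time :: "spacetime \<Rightarrow> real" where
  "in_time z = of_bool (0 < fst z \<and> fst z < 1)"

definition in_cyl :: "spacetime \<Rightarrow> real" where
  "in_cyl z = of_bool (0 < fst z \<and> fst z < 1 \<and> 0 < snd z $ 1)"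

lemma measurable_in_time[measurable]: "in_time \<in> borel_measurable borel"
  unfolding in_time_def borel_prod[symmetric] by measurable

lemma measurable_in_cyl[measurable]: "in_cyl \<in> borel_measurable borel"
  unfolding in_cyl_def borel_prod[symmetric] by measurable

definition dir :: "3 \<Rightarrow> spacetime" where "dir i = (0, axis i 1)"

lemma dir_Basis: "dir i \<in> Basis"
  by (simp add: dir_def Basis_prod_def axis_in_Basis_iff)

lemma snd_shift: "snd (z + h *\<^sub>R dir i) = snd z + h *\<^sub>R axis i 1" "fst (z + h *\<^sub>R dir i) = fst z"
  "in_time (z + h *\<^sub>R dir i) = in_time z"
  by (simp_all add: in_time_def dir_def)

lemma dir_simps [simp]: "fst (dir i) = 0" "snd (dir i) = axis i 1"
  by (simp_all add: dir_def)

declare snd_shift(3) [simp]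

lemma axis_nth_simps [simp]: "axis 1 1 $ (1::3) = (1::real)" "axis (along k) 1 $ (1::3) = (0::real)"
  using axis_neq(1)[of k] by (simp_all add: axis_def)

lemma nth1_shift: "(x + h *\<^sub>R axis 1 1) $ (1::3) = x $ 1 + (h::real)"
  "(x + h *\<^sub>R axis (along k) 1) $ (1::3) = x $ 1"
  by simp_all

lemma layer_nonzero: "layer k s \<noteq> 0 \<Longrightarrow> 0 < s"
  using scaling_nonneg[of "Suc k" s] by (auto simp: layer_eq less_le)

lemma layer_less_1: assumes "layer k s \<noteq> 0" shows "s < 1"
proof -
  have "1 * s \<le> 2 ^ k * s"
    using layer_nonzero[OF assms] by (intro mult_right_mono one_le_power) auto
  moreover have "2 ^ k * s < 1" using assms by (simp add: layer_eq)
  ultimately show ?thesis by linarith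
qed

lemma ramp_neq_1: "ramp n s \<noteq> 1 \<Longrightarrow> 0 < s \<and> 1 \<le> 2 ^ Suc n * s"
  using ramp_eq_1[of n s] scaling_nonneg[of "Suc n" s] by (force simp: less_le)

lemma eventually_scaling:
  assumes "0 < (s::real)" shows "\<forall>\<^sub>F n in sequentially. 1 < 2 ^ n * s"
proof -
  obtain N where "1 / s < 2 ^ N" using real_arch_pow[of 2 "1 / s"] by auto
  then have "1 < 2 ^ n * s" if "N \<le> n" for n
    using mult_right_mono[of "2 ^ N" "2 ^ n" s] power_increasing[of N n "2::real"] that assms
      pos_divide_less_eq[OF assms, of 1 "2 ^ N"] by linarith
  then show ?thesis unfolding eventually_sequentially by blast
qed

text \<open>Here \<open>gs\<close> and \<open>gp\<close> are the derivatives of \<open>g\<close> in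
  depth and in phase, and \<open>G\<close> is an antiderivative in the phase. Periodicity of
  \<open>G\<close> encodes that \<open>g\<close> has mean 0 over a period. A step in x_1 also
  changes the phase, at a rate a, so \<open>deriv_s\<close> is a derivative in the direction (1, a).
  Its right hand side is linear in a, which is what lets the normal and the lateral contributions
  cancel.\<close>

locale profile =
  fixes g gs gp G :: "real \<Rightarrow> real \<Rightarrow> real \<Rightarrow> real" and M L :: real
  assumes measurable_profile:
      "(\<lambda>(t, s, p). g t s p) \<in> borel_measurable borel"
      "(\<lambda>(t, s, p). gs t s p) \<in> borel_measurable borel"
      "(\<lambda>(t, s, p). G t s p) \<in> borel_measurable borel"
    and periodic: "g t s (p + of_int m) = g t s p" "G t s (p + of_int m) = G t s p"
    and bounded: "0 < t \<Longrightarrow> t < 1 \<Longrightarrow> 0 < s \<Longrightarrow> \<bar>g t s p\<bar> \<le> M"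
      "0 < t \<Longrightarrow> t < 1 \<Longrightarrow> 0 < s \<Longrightarrow> \<bar>gs t s p\<bar> \<le> M"
      "0 < t \<Longrightarrow> t < 1 \<Longrightarrow> 0 < s \<Longrightarrow> s < 1 \<Longrightarrow> \<bar>G t s p\<bar> \<le> M"
    and lipschitz: "0 < t \<Longrightarrow> t < 1 \<Longrightarrow> 0 < s \<Longrightarrow> 0 < s' \<Longrightarrow> \<bar>g t s p - g t s' p'\<bar> \<le> L * (\<bar>s - s'\<bar> + \<bar>p - p'\<bar>)"
      "0 < t \<Longrightarrow> t < 1 \<Longrightarrow> 0 < s \<Longrightarrow> s < 1 \<Longrightarrow> \<bar>G t s p - G t s p'\<bar> \<le> L * \<bar>p - p'\<bar>"
    and deriv_s: "0 < t \<Longrightarrow> t < 1 \<Longrightarrow> 0 < s \<Longrightarrow>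
        ((\<lambda>h. g t (s + h) (p + a * h)) has_real_derivative gs t s p + a * gp t s p) (at_right 0)"
    and deriv_p: "0 < t \<Longrightarrow> t < 1 \<Longrightarrow> 0 < s \<Longrightarrow>
        ((\<lambda>h. g t s (p + a * h)) has_real_derivative a * gp t s p) (at_right 0)"
      "0 < t \<Longrightarrow> t < 1 \<Longrightarrow> 0 < s \<Longrightarrow>
        ((\<lambda>h. G t s (p + a * h)) has_real_derivative a * g t s p) (at_right 0)"
begin

lemma M0: "0 \<le> M" using bounded(1)[of "1/2" 1 0] by linarith
lemma L0: "0 \<le> L" using lipschitz(1)[of "1/2" 1 1 0 1] by auto

definition at_phase :: "(real \<Rightarrow> real \<Rightarrow> real \<Rightarrow> real) \<Rightarrow> nat \<Rightarrow> spacetime \<Rightarrow> real" where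
  "at_phase f n z = f (fst z) (snd z $ 1) (phase_upto n (snd z))"

lemma measurable_at_phase[measurable]:
  "at_phase g n \<in> borel_measurable borel" "at_phase gs n \<in> borel_measurable borel"
  "at_phase G n \<in> borel_measurable borel"
proof -
  have c: "(\<lambda>z::spacetime. (fst z, snd z $ 1, phase_upto n (snd z))) \<in> borel \<rightarrow>\<^sub>M borel"
    unfolding borel_prod[symmetric] by measurable
  show "at_phase g n \<in> borel_measurable borel" "at_phase gs n \<in> borel_measurable borel"
    "at_phase G n \<in> borel_measurable borel"
    using measurable_profile[THEN measurable_compose[OF c]]
    by (simp_all add: at_phase_def[abs_def])
qed

text \<open>The profile cut off towards the wall. The factor \<open>1 - ramp n\<close> drops to 0
  inside layer n, so the phase has to be exact in that layer too; this accounts for the index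
  \<open>Suc n\<close>.\<close>

definition bulk :: "nat \<Rightarrow> spacetime \<Rightarrow> real" where
  "bulk n z = in_time z * ((1 - ramp n (snd z $ 1)) * at_phase g (Suc n) z)"

definition bulk_vel :: "nat \<Rightarrow> nat \<Rightarrow> spacetime \<Rightarrow> real" where
  "bulk_vel n k z = in_time z * (1 - ramp n (snd z $ 1)) * (layer k (snd z $ 1) * saw k (snd z)) * at_phase g (Suc n) z"

text \<open>The derivative of the cutoff in \<open>bulk n\<close> leaves behind
  \<open>2 ^ Suc n * layer n\<close> times the profile. Up to \<open>in_time\<close>, this is the
  derivative of \<open>antider n\<close> in the direction \<open>along n\<close>.\<close>

definition antider :: "nat \<Rightarrow> spacetime \<Rightarrow> real" where
  "antider n z = in_time z * layer n (snd z $ 1) * at_phase G (Suc n) z"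

lemma measurable_bulk[measurable]: "bulk n \<in> borel_measurable borel" "bulk_vel n k \<in> borel_measurable borel" "antider n \<in> borel_measurable borel"
  unfolding bulk_def bulk_vel_def antider_def borel_prod[symmetric]
  by (intro borel_measurable_times borel_measurable_diff measurable_in_time[unfolded borel_prod[symmetric]]
      measurable_at_phase[unfolded borel_prod[symmetric]]; measurable)+

lemma cutoff_bound:
  assumes "\<And>t s p. 0 < t \<Longrightarrow> t < 1 \<Longrightarrow> 0 < s \<Longrightarrow> \<bar>f t s p\<bar> \<le> M"
  shows "\<bar>in_time z * ((1 - ramp n (snd z $ 1)) * at_phase f (Suc n) z)\<bar> \<le> M"
proof (cases "0 < fst z \<and> fst z < 1 \<and> ramp n (snd z $ 1) \<noteq> 1")
  case True
  then have "\<bar>at_phase f (Suc n) z\<bar> \<le> M" unfolding at_phase_def using ramp_neq_1 by (intro assms) auto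
  moreover have "\<bar>1 - ramp n (snd z $ 1)\<bar> \<le> 1" using ramp_bounds[of n "snd z $ 1"] by auto
  ultimately have "\<bar>1 - ramp n (snd z $ 1)\<bar> * \<bar>at_phase f (Suc n) z\<bar> \<le> 1 * M" by (intro mult_mono) auto
  then show ?thesis using True by (simp add: in_time_def abs_mult)
qed (auto simp: in_time_def M0)

lemma bulk_bound: "\<bar>bulk n z\<bar> \<le> M"
  unfolding bulk_def by (rule cutoff_bound[OF bounded(1)])

lemma bulk_vel_bound: "\<bar>bulk_vel n k z\<bar> \<le> M"
proof -
  have "bulk_vel n k z = (layer k (snd z $ 1) * saw k (snd z)) * bulk n z"
    by (simp add: bulk_vel_def bulk_def)
  moreover have "\<bar>layer k (snd z $ 1) * saw k (snd z)\<bar> \<le> 1"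
    using saw_bounds[of k "snd z"] layer_cases[of k "snd z $ 1"] by auto
  then have "\<bar>layer k (snd z $ 1) * saw k (snd z)\<bar> * \<bar>bulk n z\<bar> \<le> 1 * M"
    by (intro mult_mono bulk_bound) auto
  ultimately show ?thesis by (simp add: abs_mult)
qed

lemma antider_bound: "\<bar>antider n z\<bar> \<le> M"
proof (cases "0 < fst z \<and> fst z < 1 \<and> layer n (snd z $ 1) \<noteq> 0")
  case True
  then have s: "0 < snd z $ 1" "snd z $ 1 < 1" using layer_nonzero layer_less_1 by auto
  then have "\<bar>at_phase G (Suc n) z\<bar> \<le> M" unfolding at_phase_def using True by (intro bounded) auto
  then show ?thesis using True layer_cases[of n "snd z $ 1"] by (simp add: antider_def in_time_def)
qed (auto simp: antider_def in_time_def M0)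

lemma bulk_rderiv:
  "rderiv (dir 1) (bulk n) z (in_time z * (2 ^ Suc n * layer n (snd z $ 1) * at_phase g (Suc n) z +
      (1 - ramp n (snd z $ 1)) * (at_phase gs (Suc n) z -
        (\<Sum>k<Suc n. 2 ^ Suc k * (layer k (snd z $ 1) * saw k (snd z))) * at_phase gp (Suc n) z)))"
    (is "rderiv _ _ _ ?d")
proof -
  let ?s = "snd z $ 1"
  consider "in_time z = 0" | "2 ^ Suc n * ?s < 1" | "0 < fst z" "fst z < 1" "1 \<le> 2 ^ Suc n * ?s"
    by (force simp: in_time_def)
  then show ?thesis
  proof cases
    case 1
    then show ?thesis
      by (intro rderiv_eventually[where q = "\<lambda>_. 0"]) (auto simp: bulk_def snd_shift)
  next
    case 2
    then have "layer n ?s = 0" "ramp n ?s = 1" by (auto simp: layer_eq ramp_eq_1)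
    then have "\<forall>\<^sub>F h in at_right 0. ramp n (?s + h) = 1" using ramp_affine[of n ?s] by simp
    then have "\<forall>\<^sub>F h in at_right 0. bulk n (z + h *\<^sub>R dir 1) = 0"
      by eventually_elim (simp add: bulk_def snd_shift nth1_shift)
    then show ?thesis
      using \<open>layer n ?s = 0\<close> \<open>ramp n ?s = 1\<close>
      by (intro rderiv_eventually[where q = "\<lambda>_. 0"]) (auto simp: bulk_def)
  next
    case 3
    then have s: "0 < ?s" using scaling_nonneg[of "Suc n" ?s] by (auto simp: less_le)
    define S where "S = (\<Sum>k<Suc n. 2 ^ Suc k * (layer k ?s * saw k (snd z)))"
    define q where "q h = (1 - (ramp n ?s - h * (2 ^ Suc n * layer n ?s))) * g (fst z) (?s + h) (phase_upto (Suc n) (snd z) + - S * h)" for h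
    show ?thesis
    proof (rule rderiv_eventually[where q = q])
      show "\<forall>\<^sub>F h in at_right 0. bulk n (z + h *\<^sub>R dir 1) = q h"
        using ramp_affine[of n ?s] phase_upto_shift_1[of "Suc n" "snd z"]
        by eventually_elim
          (use 3 in \<open>simp only: bulk_def snd_shift nth1_shift at_phase_def q_def S_def, simp add: in_time_def del: power_Suc sum.lessThan_Suc\<close>)
      show "bulk n z = q 0" using 3 by (simp add: bulk_def q_def at_phase_def in_time_def)
      have "((\<lambda>h. 1 - (ramp n ?s - h * (2 ^ Suc n * layer n ?s))) has_real_derivative 2 ^ Suc n * layer n ?s) (at_right 0)"
        by (auto intro!: derivative_eq_intros)
      then have "(q has_real_derivative 2 ^ Suc n * layer n ?s * g (fst z) (?s + 0) (phase_upto (Suc n) (snd z) + - S * 0)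
          + (gs (fst z) ?s (phase_upto (Suc n) (snd z)) + - S * gp (fst z) ?s (phase_upto (Suc n) (snd z)))
            * (1 - (ramp n ?s - 0 * (2 ^ Suc n * layer n ?s)))) (at_right 0)"
        unfolding q_def[abs_def] by (rule DERIV_mult[OF _ deriv_s[OF 3(1,2) s]])
      then show "(q has_real_derivative ?d) (at_right 0)"
        unfolding S_def[symmetric]
        by (rule DERIV_cong) (use 3 in \<open>simp add: in_time_def at_phase_def algebra_simps\<close>)
    qed
  qed
qed

text \<open>The factor \<open>a\<close> is constant in the direction of the shift and confines
  attention to layer k, where the phase grows at rate 2^(k+1) up to an integer that periodicity
  removes. Both the lateral flux and the antiderivative have this form.\<close>

lemma slide:
  assumes "k < n" and a: "\<And>z h. a (z + h *\<^sub>R dir (along k)) = a z" "\<And>z. \<bar>a z\<bar> \<le> 1"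
      "\<And>z. a z \<noteq> 0 \<Longrightarrow> 0 < fst z \<and> fst z < 1 \<and> layer k (snd z $ 1) \<noteq> 0"
    and per: "\<And>t s p m. f t s (p + of_int m) = f t s p"
    and flip: "\<And>t s p p'. 0 < t \<Longrightarrow> t < 1 \<Longrightarrow> 0 < s \<Longrightarrow> s < 1 \<Longrightarrow> \<bar>f t s p - f t s p'\<bar> \<le> L * \<bar>p - p'\<bar>"
    and fder: "\<And>t s p a. 0 < t \<Longrightarrow> t < 1 \<Longrightarrow> 0 < s \<Longrightarrow>
        ((\<lambda>h. f t s (p + a * h)) has_real_derivative a * fp t s p) (at_right 0)"
  shows "rderiv (dir (along k)) (\<lambda>z. a z * at_phase f n z) z (a z * (2 ^ Suc k * at_phase fp n z))"
    and "0 \<le> h \<Longrightarrow> \<bar>a (z + h *\<^sub>R dir (along k)) * at_phase f n (z + h *\<^sub>R dir (along k)) - a z * at_phase f n z\<bar> \<le> L * 2 ^ Suc k * h"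
proof -
  let ?q = "\<lambda>h. a z * f (fst z) (snd z $ 1) (phase_upto n (snd z) + 2 ^ Suc k * h)"
  have q: "a (z + h *\<^sub>R dir (along k)) * at_phase f n (z + h *\<^sub>R dir (along k)) = ?q h" for h
  proof (cases "a z = 0")
    case False
    then obtain m :: int where "phase_upto n (snd z + h *\<^sub>R axis (along k) 1) = phase_upto n (snd z) + 2 ^ Suc k * h + of_int m"
      using phase_upto_shift_along[OF _ assms(1)] a(3) by blast
    then show ?thesis unfolding at_phase_def snd_shift nth1_shift a(1) by (simp only: per)
  qed (simp add: a(1))
  have q0: "a z * at_phase f n z = ?q 0" by (simp add: at_phase_def)
  show "rderiv (dir (along k)) (\<lambda>z. a z * at_phase f n z) z (a z * (2 ^ Suc k * at_phase fp n z))"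
  proof (rule rderiv_eventually[where q = ?q])
    show "\<forall>\<^sub>F h in at_right 0. a (z + h *\<^sub>R dir (along k)) * at_phase f n (z + h *\<^sub>R dir (along k)) = ?q h"
      by (intro always_eventually allI q)
    show "a z * at_phase f n z = ?q 0" by (rule q0)
    show "(?q has_real_derivative a z * (2 ^ Suc k * at_phase fp n z)) (at_right 0)"
    proof (cases "a z = 0")
      case False
      then show ?thesis using a(3)[of z] layer_nonzero[of k "snd z $ 1"] unfolding at_phase_def
        by (intro DERIV_cmult fder) auto
    qed simp
  qed
  assume h: "0 \<le> h"
  show "\<bar>a (z + h *\<^sub>R dir (along k)) * at_phase f n (z + h *\<^sub>R dir (along k)) - a z * at_phase f n z\<bar> \<le> L * 2 ^ Suc k * h"
    unfolding q q0
  proof (cases "a z = 0")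
    case False
    then have z: "0 < fst z" "fst z < 1" "0 < snd z $ 1" "snd z $ 1 < 1"
      using a(3)[of z] layer_nonzero layer_less_1 by auto
    let ?p = "phase_upto n (snd z)"
    have "\<bar>?q h - ?q 0\<bar> \<le> 1 * (L * \<bar>(?p + 2 ^ Suc k * h) - (?p + 2 ^ Suc k * 0)\<bar>)"
      unfolding right_diff_distrib[symmetric] abs_mult by (intro mult_mono a(2) flip z) auto
    also have "\<dots> = L * 2 ^ Suc k * h" using h by (simp add: abs_mult)
    finally show "\<bar>?q h - ?q 0\<bar> \<le> L * 2 ^ Suc k * h" .
  qed (use h L0 in simp)
qed

lemma bulk_vel_slide:
  assumes "k < Suc n"
  shows "rderiv (dir (along k)) (bulk_vel n k) z (in_time z * (1 - ramp n (snd z $ 1)) *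
      (layer k (snd z $ 1) * saw k (snd z)) * (2 ^ Suc k * at_phase gp (Suc n) z))"
    and "0 \<le> h \<Longrightarrow> \<bar>bulk_vel n k (z + h *\<^sub>R dir (along k)) - bulk_vel n k z\<bar> \<le> L * 2 ^ Suc k * h"
proof -
  let ?a = "\<lambda>z. in_time z * (1 - ramp n (snd z $ 1)) * (layer k (snd z $ 1) * saw k (snd z))"
  have a: "?a (z + h *\<^sub>R dir (along k)) = ?a z" for z h by (simp add: saw_shift_along)
  have "\<bar>?a z\<bar> \<le> 1 * 1 * (1 * 1)" for z
    unfolding abs_mult using ramp_bounds[of n "snd z $ 1"] saw_bounds[of k "snd z"] layer_cases[of k "snd z $ 1"]
    by (intro mult_mono) (auto simp: in_time_def)
  then have a1: "\<bar>?a z\<bar> \<le> 1" for z by simp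
  have lp: "\<bar>g t s p - g t s p'\<bar> \<le> L * \<bar>p - p'\<bar>" if "0 < t" "t < 1" "0 < s" "s < 1" for t s p p'
    using lipschitz(1)[of t s s p p'] that by simp
  have eq: "bulk_vel n k = (\<lambda>z. ?a z * at_phase g (Suc n) z)" by (simp add: fun_eq_iff bulk_vel_def)
  note slide = slide[OF assms, where a = ?a, OF a a1 _ periodic(1) lp deriv_p(1)]
  show "rderiv (dir (along k)) (bulk_vel n k) z (?a z * (2 ^ Suc k * at_phase gp (Suc n) z))"
    unfolding eq by (rule slide(1)) (auto simp: in_time_def)
  show "0 \<le> h \<Longrightarrow> \<bar>bulk_vel n k (z + h *\<^sub>R dir (along k)) - bulk_vel n k z\<bar> \<le> L * 2 ^ Suc k * h"
    unfolding eq by (rule slide(2)) (auto simp: in_time_def)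
qed

lemma antider_slide:
  "rderiv (dir (along n)) (antider n) z (in_time z * layer n (snd z $ 1) * (2 ^ Suc n * at_phase g (Suc n) z))"
  "0 \<le> h \<Longrightarrow> \<bar>antider n (z + h *\<^sub>R dir (along n)) - antider n z\<bar> \<le> L * 2 ^ Suc n * h"
proof -
  let ?a = "\<lambda>z. in_time z * layer n (snd z $ 1)"
  have a: "?a (z + h *\<^sub>R dir (along n)) = ?a z" for z h by simp
  have a1: "\<bar>?a z\<bar> \<le> 1" for z using layer_cases[of n "snd z $ 1"] by (auto simp: in_time_def)
  have eq: "antider n = (\<lambda>z. ?a z * at_phase G (Suc n) z)" by (simp add: fun_eq_iff antider_def)
  note slide = slide[OF lessI, where a = ?a, OF a a1 _ periodic(2) lipschitz(2) deriv_p(2)]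
  show "rderiv (dir (along n)) (antider n) z (?a z * (2 ^ Suc n * at_phase g (Suc n) z))"
    unfolding eq by (rule slide(1)) (auto simp: in_time_def)
  show "0 \<le> h \<Longrightarrow> \<bar>antider n (z + h *\<^sub>R dir (along n)) - antider n z\<bar> \<le> L * 2 ^ Suc n * h"
    unfolding eq by (rule slide(2)) (auto simp: in_time_def)
qed

text \<open>The constant grows with \<open>n\<close>, but it only serves an integration by parts at
  fixed \<open>n\<close>; the passage to the limit rests on bounds of the functions
  themselves.\<close>

lemma bulk_lip:
  assumes "0 \<le> h"
  shows "\<bar>bulk n (z + h *\<^sub>R dir 1) - bulk n z\<bar> \<le> (L * (1 + (\<Sum>k<Suc n. 2 ^ Suc k)) + M * 2 ^ Suc n) * h"
proof -
  let ?s = "snd z $ 1" and ?z = "z + h *\<^sub>R dir 1" and ?C = "\<Sum>k<Suc n. 2 ^ Suc k :: real"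
  have C: "0 \<le> ?C" by (intro sum_nonneg) auto
  have sgh: "\<bar>ramp n ?s - ramp n (?s + h)\<bar> \<le> 2 ^ Suc n * h"
    using ramp_lipschitz[of n ?s "?s + h"] assms by simp
  have z: "snd ?z $ 1 = ?s + h" "fst ?z = fst z" "in_time ?z = in_time z"
    by (simp_all add: snd_shift nth1_shift)
  have gz: "\<bar>at_phase g (Suc n) ?z\<bar> \<le> M" if "0 < fst z" "fst z < 1" "0 < ?s + h"
    unfolding at_phase_def z using that by (intro bounded)
  consider "in_time z = 0" | "in_time z = 1" "ramp n ?s = 1" "0 < fst z" "fst z < 1"
    | "in_time z = 1" "ramp n ?s \<noteq> 1" "0 < fst z" "fst z < 1"
    by (force simp: in_time_def)
  then show ?thesis
  proof cases
    case 1
    then show ?thesis using assms C L0 M0 by (simp only: bulk_def z) simp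
  next
    case 2
    \<comment> \<open>The starting point may lie beyond the wall, where the profile is not
      controlled. As the cutoff vanishes there, its own increment times a bound of the profile at
      the end point suffices.\<close>
    have "\<bar>bulk n ?z\<bar> \<le> M * 2 ^ Suc n * h"
    proof (cases "ramp n (?s + h) = 1")
      case True then show ?thesis unfolding bulk_def z using M0 assms by simp
    next
      case False
      then have g: "\<bar>at_phase g (Suc n) ?z\<bar> \<le> M" using ramp_neq_1 2 by (intro gz) auto
      have \<sigma>: "\<bar>1 - ramp n (?s + h)\<bar> \<le> 2 ^ Suc n * h" using sgh 2 by simp
      have "\<bar>1 - ramp n (?s + h)\<bar> * \<bar>at_phase g (Suc n) ?z\<bar> \<le> 2 ^ Suc n * h * M"
        by (rule mult_mono[OF \<sigma> g mult_nonneg_nonneg[OF _ assms]]) auto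
      moreover have "\<bar>bulk n ?z\<bar> = \<bar>1 - ramp n (?s + h)\<bar> * \<bar>at_phase g (Suc n) ?z\<bar>"
        unfolding bulk_def z 2(1) abs_mult by simp
      ultimately show ?thesis by (simp only: ac_simps)
    qed
    moreover have "bulk n z = 0" by (simp add: bulk_def 2)
    moreover have "0 \<le> L * (1 + ?C) * h" using L0 C assms by simp
    moreover have "(L * (1 + ?C) + M * 2 ^ Suc n) * h = L * (1 + ?C) * h + M * 2 ^ Suc n * h"
      by (rule distrib_right)
    ultimately show ?thesis by linarith
  next
    case 3
    then have s: "0 < ?s" using ramp_neq_1 by auto
    let ?g = "at_phase g (Suc n)"
    have "\<bar>?g ?z - ?g z\<bar> \<le> L * (\<bar>(?s + h) - ?s\<bar> + \<bar>phase_upto (Suc n) (snd ?z) - phase_upto (Suc n) (snd z)\<bar>)"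
      unfolding at_phase_def z using 3 s assms by (intro lipschitz) auto
    also have "\<dots> \<le> L * (h + ?C * h)"
      using phase_upto_lipschitz_1[of "Suc n" "snd z" h] assms L0
      by (intro mult_left_mono add_mono) (auto simp: snd_shift)
    finally have 1: "\<bar>?g ?z - ?g z\<bar> \<le> L * (1 + ?C) * h" by (simp only: distrib_left distrib_right mult.assoc mult_1)
    have 2: "\<bar>?g z\<bar> \<le> M" unfolding at_phase_def using 3 s by (intro bounded)
    have "bulk n ?z - bulk n z = (1 - ramp n (?s + h)) * (?g ?z - ?g z) + ?g z * (ramp n ?s - ramp n (?s + h))"
      unfolding bulk_def z 3(1) by (simp add: algebra_simps)
    also have "\<bar>\<dots>\<bar> \<le> \<bar>1 - ramp n (?s + h)\<bar> * \<bar>?g ?z - ?g z\<bar> + \<bar>?g z\<bar> * \<bar>ramp n ?s - ramp n (?s + h)\<bar>"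
      unfolding abs_mult[symmetric] by (rule abs_triangle_ineq)
    also have "\<dots> \<le> 1 * (L * (1 + ?C) * h) + M * (2 ^ Suc n * h)"
      using ramp_bounds[of n "?s + h"] M0 by (intro add_mono mult_mono 1 2 sgh) auto
    finally show ?thesis by (simp only: distrib_right[of "L * (1 + ?C)" "M * 2 ^ Suc n" h] mult.assoc mult_1)
  qed
qed

text \<open>The boundary term at \<open>x\<^sub>1 = 0\<close> is the limit of the averages over the \<open>n\<close>-th layer. These vanish
  because there the profile oscillates at frequency \<open>2 ^ Suc n\<close> and has a bounded antiderivative.\<close>

theorem transport:
  fixes \<phi> :: "spacetime \<Rightarrow> real"
  assumes "C1_compact \<phi>"
  shows "has_bochner_integral lborel (\<lambda>z. in_cyl z * (gs (fst z) (snd z $ 1) (phase (snd z)) * \<phi> z +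
      g (fst z) (snd z $ 1) (phase (snd z)) * frechet_derivative \<phi> (at z) (0, axis 1 1 + vel (snd z)))) 0"
    (is "has_bochner_integral _ ?T 0")
proof -
  interpret C1_compact \<phi> by fact
  define T where "T = ?T"
  define cutoff where "cutoff n z = in_time z * ((1 - ramp n (snd z $ 1)) * at_phase gs (Suc n) z)" for n z
  define Tn where "Tn n z = cutoff n z * \<phi> z + (bulk n z * D (dir 1) z + (\<Sum>k<Suc n. bulk_vel n k z * D (dir (along k)) z))" for n z
  obtain R where R: "\<And>x. R < norm x \<Longrightarrow> \<phi> x = 0" "\<And>x e. R < norm x \<Longrightarrow> D e x = 0" using vanish by metis
  obtain N where N: "\<And>x. \<bar>\<phi> x\<bar> \<le> N" "\<And>e x. e \<in> Basis \<Longrightarrow> \<bar>D e x\<bar> \<le> N" "0 < N" using bounds by metis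
  have mcut[measurable]: "cutoff n \<in> borel_measurable borel" for n
    unfolding cutoff_def borel_prod[symmetric]
    by (intro borel_measurable_times borel_measurable_diff measurable_in_time[unfolded borel_prod[symmetric]]
      measurable_at_phase[unfolded borel_prod[symmetric]]; measurable)
  note [measurable] = measD[OF dir_Basis]
  have mT[measurable]: "Tn n \<in> borel_measurable borel" for n
    unfolding Tn_def by measurable
  have bcut: "\<bar>cutoff n z\<bar> \<le> M" for n z
    unfolding cutoff_def by (rule cutoff_bound[OF bounded(2)])
  have int_Tn: "(LINT z|lborel. Tn n z) = (LINT z|lborel. antider n z * D (dir (along n)) z)" for n
  proof -
    let ?l = "\<lambda>k z. layer k (snd z $ 1)" and ?\<sigma> = "\<lambda>z. 1 - ramp n (snd z $ 1)"
    define A where "A z = in_time z * (2 ^ Suc n * ?l n z * at_phase g (Suc n) z + ?\<sigma> z * (at_phase gs (Suc n) z -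
        (\<Sum>k<Suc n. 2 ^ Suc k * (?l k z * saw k (snd z))) * at_phase gp (Suc n) z))" for z
    define B where "B k z = in_time z * ?\<sigma> z * (?l k z * saw k (snd z)) * (2 ^ Suc k * at_phase gp (Suc n) z)" for k z
    define C where "C z = in_time z * ?l n z * (2 ^ Suc n * at_phase g (Suc n) z)" for z
    have A: "integrable lborel (\<lambda>z. A z * \<phi> z)" "(LINT z|lborel. A z * \<phi> z) = - (LINT z|lborel. bulk n z * D (dir 1) z)"
      unfolding A_def
      by (rule integration_by_parts[OF measurable_bulk(1) bulk_bound bulk_lip bulk_rderiv dir_Basis], assumption)+
    have B: "integrable lborel (\<lambda>z. B k z * \<phi> z)" "(LINT z|lborel. B k z * \<phi> z) = - (LINT z|lborel. bulk_vel n k z * D (dir (along k)) z)"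
      if "k \<in> {..<Suc n}" for k
      unfolding B_def using that
      by (intro integration_by_parts[OF measurable_bulk(2) bulk_vel_bound bulk_vel_slide(2) bulk_vel_slide(1) dir_Basis]; simp)+
    have C: "integrable lborel (\<lambda>z. C z * \<phi> z)" "(LINT z|lborel. C z * \<phi> z) = - (LINT z|lborel. antider n z * D (dir (along n)) z)"
      unfolding C_def
      by (rule integration_by_parts[OF measurable_bulk(3) antider_bound antider_slide(2) antider_slide(1) dir_Basis], assumption)+
    note iS = Bochner_Integration.integrable_sum[OF B(1)]
    note iAS = Bochner_Integration.integrable_add[OF A(1) iS]
    \<comment> \<open>The terms with \<open>gp\<close> cancel because the phase is constant along
      (1, vel). There remain the depth derivative of the profile and, in \<open>C\<close>, the
      derivative of the cutoff.\<close>
    have "A z + (\<Sum>k<Suc n. B k z) = C z + cutoff n z" for z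
    proof -
      have "(\<Sum>k<Suc n. B k z) = in_time z * (?\<sigma> z * ((\<Sum>k<Suc n. 2 ^ Suc k * (?l k z * saw k (snd z))) * at_phase gp (Suc n) z))"
        unfolding B_def sum_distrib_left sum_distrib_right by (intro sum.cong refl) (simp only: ac_simps)
      moreover have "i * (P * l * g' + s * (a - S * p)) + i * (s * (S * p)) = i * l * (P * g') + i * (s * a)"
        for i P l g' s a S p :: real by (simp add: algebra_simps)
      ultimately show ?thesis unfolding A_def C_def cutoff_def by (simp only:)
    qed
    then have "cutoff n z * \<phi> z = A z * \<phi> z + (\<Sum>k<Suc n. B k z * \<phi> z) - C z * \<phi> z" for z
      unfolding sum_distrib_right[symmetric] distrib_right[symmetric] left_diff_distrib[symmetric]
      by (simp only: add_diff_cancel_left')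
    then have "(LINT z|lborel. cutoff n z * \<phi> z) =
      (LINT z|lborel. A z * \<phi> z + (\<Sum>k<Suc n. B k z * \<phi> z) - C z * \<phi> z)" by (simp only:)
    also have "\<dots> = (LINT z|lborel. A z * \<phi> z) + (\<Sum>k<Suc n. LINT z|lborel. B k z * \<phi> z) - (LINT z|lborel. C z * \<phi> z)"
      by (simp only: Bochner_Integration.integral_diff[OF iAS C(1)] Bochner_Integration.integral_add[OF A(1) iS]
          Bochner_Integration.integral_sum[OF B(1)])
    also have "\<dots> = - (LINT z|lborel. bulk n z * D (dir 1) z) -
        (\<Sum>k<Suc n. LINT z|lborel. bulk_vel n k z * D (dir (along k)) z) + (LINT z|lborel. antider n z * D (dir (along n)) z)"
    proof -
      have "(\<Sum>k<Suc n. LINT z|lborel. B k z * \<phi> z) = - (\<Sum>k<Suc n. LINT z|lborel. bulk_vel n k z * D (dir (along k)) z)"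
        unfolding sum_negf[symmetric] by (intro sum.cong refl B(2))
      then show ?thesis unfolding A(2) C(2) by (simp only:)
    qed
    finally have 1: "(LINT z|lborel. cutoff n z * \<phi> z) = \<dots>" .
    have i: "integrable lborel (\<lambda>z. cutoff n z * \<phi> z)" "integrable lborel (\<lambda>z. bulk n z * D (dir 1) z)"
      "integrable lborel (\<lambda>z. bulk_vel n k z * D (dir (along k)) z)" for k
      by (intro integrable_mult[OF mcut bcut] integrable_mult_D[OF measurable_bulk(1) bulk_bound dir_Basis]
        integrable_mult_D[OF measurable_bulk(2) bulk_vel_bound dir_Basis])+
    have "(LINT z|lborel. Tn n z) = (LINT z|lborel. cutoff n z * \<phi> z) + ((LINT z|lborel. bulk n z * D (dir 1) z) +
        (\<Sum>k<Suc n. LINT z|lborel. bulk_vel n k z * D (dir (along k)) z))"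
      unfolding Tn_def
      by (simp only: Bochner_Integration.integral_add[OF i(1) Bochner_Integration.integrable_add[OF i(2) Bochner_Integration.integrable_sum[OF i(3)]]]
          Bochner_Integration.integral_add[OF i(2) Bochner_Integration.integrable_sum[OF i(3)]]
          Bochner_Integration.integral_sum[OF i(3)])
    then show ?thesis using 1 by linarith
  qed
  \<comment> \<open>Collected in this form, the sum over the layers is bounded independently of
    \<open>n\<close> by \<open>abs_sum_layer_le\<close>.\<close>
  have Tn_eq: "Tn n z = cutoff n z * \<phi> z + bulk n z * (D (dir 1) z + (\<Sum>k<Suc n. layer k (snd z $ 1) * (saw k (snd z) * D (dir (along k)) z)))" for n z
    unfolding Tn_def bulk_vel_def bulk_def distrib_left sum_distrib_left
    by (intro arg_cong2[where f = "(+)"] refl sum.cong) (simp_all only: ac_simps)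
  have dom: "\<bar>Tn n z\<bar> \<le> 3 * (M * N) * indicator (cball 0 R) z" for n z
  proof (cases "norm z \<le> R")
    case True
    have "\<bar>saw k (snd z) * D (dir (along k)) z\<bar> \<le> 1 * N" for k
      unfolding abs_mult by (intro mult_mono saw_bounds N(2) dir_Basis) auto
    then have "\<bar>\<Sum>k<Suc n. layer k (snd z $ 1) * (saw k (snd z) * D (dir (along k)) z)\<bar> \<le> N"
      by (intro abs_sum_layer_le) auto
    then have "\<bar>D (dir 1) z + (\<Sum>k<Suc n. layer k (snd z $ 1) * (saw k (snd z) * D (dir (along k)) z))\<bar> \<le> 2 * N"
      using N(2)[OF dir_Basis[of 1], of z] by linarith
    then have "\<bar>bulk n z\<bar> * \<bar>D (dir 1) z + (\<Sum>k<Suc n. layer k (snd z $ 1) * (saw k (snd z) * D (dir (along k)) z))\<bar> \<le> M * (2 * N)"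
      by (intro mult_mono bulk_bound) (use M0 in auto)
    moreover have "\<bar>cutoff n z\<bar> * \<bar>\<phi> z\<bar> \<le> M * N" by (intro mult_mono bcut N) (use M0 in auto)
    ultimately have "\<bar>Tn n z\<bar> \<le> M * N + M * (2 * N)"
      unfolding Tn_eq abs_mult[symmetric] by (intro order_trans[OF abs_triangle_ineq] add_mono)
    then show ?thesis using True by simp
  next
    case False
    then show ?thesis unfolding Tn_eq using R by simp
  qed
  have lim: "(\<lambda>n. Tn n z) \<longlonglongrightarrow> T z" for z
  proof (cases "0 < snd z $ 1")
    case False
    then have "ramp n (snd z $ 1) = 1" for n using ramp_neq_1[of n] by blast
    then have "Tn n z = 0" for n by (simp add: Tn_eq cutoff_def bulk_def)
    moreover have "T z = 0" using False by (simp add: T_def in_cyl_def)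
    ultimately show ?thesis by simp
  next
    case True
    \<comment> \<open>At a fixed depth the sequence is eventually constant: the cutoff has reached 1
      and all layers that matter are included.\<close>
    have "\<forall>\<^sub>F n in sequentially. Tn n z = T z" using eventually_scaling[OF True]
    proof eventually_elim
      case (elim n)
      then have s: "1 \<le> 2 ^ n * snd z $ 1" "1 \<le> 2 ^ Suc n * snd z $ 1" using True by auto
      have ph: "phase (snd z) = phase_upto (Suc n) (snd z)" "vel (snd z) = vel_upto (Suc n) (snd z)"
        using phase_eq[OF True s(2)] by auto
      have "(0, axis 1 1 + vel (snd z)) = dir 1 + (\<Sum>k<Suc n. (layer k (snd z $ 1) * saw k (snd z)) *\<^sub>R dir (along k))"
        unfolding ph vel_upto_def prod_eq_iff by (simp add: fst_sum snd_sum del: sum.lessThan_Suc)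
      then have "D (0, axis 1 1 + vel (snd z)) z = D (dir 1) z + (\<Sum>k<Suc n. layer k (snd z $ 1) * (saw k (snd z) * D (dir (along k)) z))"
        by (simp add: linear_add[OF linD] linear_sum[OF linD] linear_scale[OF linD] mult.assoc del: sum.lessThan_Suc)
      then show ?case using True
        by (simp add: Tn_eq T_def cutoff_def bulk_def at_phase_def ph ramp_eq_0[OF s(1)] in_cyl_def in_time_def distrib_left del: sum.lessThan_Suc)
    qed
    then show ?thesis by (rule tendsto_eventually)
  qed
  have "(\<lambda>n. LINT z|lborel. antider n z * D (dir (along n)) z) \<longlonglongrightarrow> (LINT z::spacetime|lborel. (0::real))"
  proof (rule bounded_support_convergence(2))
    fix n and z :: "spacetime"
    show "(\<lambda>n. antider n z * D (dir (along n)) z) \<longlonglongrightarrow> 0"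
    proof (cases "0 < snd z $ 1")
      case True
      have "\<forall>\<^sub>F n in sequentially. antider n z * D (dir (along n)) z = 0" using eventually_scaling[OF True]
        by eventually_elim (auto simp: antider_def layer_eq)
      then show ?thesis by (rule tendsto_eventually)
    next
      case False
      then have "layer n (snd z $ 1) = 0" for n using layer_nonzero by blast
      then show ?thesis by (simp add: antider_def)
    qed
    have "\<bar>antider n z\<bar> * \<bar>D (dir (along n)) z\<bar> \<le> M * N" by (intro mult_mono antider_bound N dir_Basis) (use M0 in auto)
    then show "\<bar>antider n z * D (dir (along n)) z\<bar> \<le> M * N * indicator (cball 0 R) z"
      using R(2)[of z] by (cases "norm z \<le> R") (auto simp: abs_mult)
  qed measurable
  with bounded_support_convergence(2)[OF mT lim dom] have "integral\<^sup>L lborel T = 0"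
    unfolding int_Tn by (simp add: LIMSEQ_unique)
  then have "has_bochner_integral lborel T 0"
    using bounded_support_convergence(1)[OF mT lim dom] by (simp add: has_bochner_integral_iff)
  then show ?thesis unfolding T_def .
qed

end

text \<open>The lateral velocity is a shear in each layer, hence divergence free.\<close>

theorem vel_divergence_free:
  fixes \<phi> :: "spacetime \<Rightarrow> real"
  assumes "C1_compact \<phi>"
  shows "has_bochner_integral lborel (\<lambda>z. in_cyl z * frechet_derivative \<phi> (at z) (0, vel (snd z))) 0"
proof -
  interpret C1_compact \<phi> by fact
  define w where "w k z = in_time z * (layer k (snd z $ 1) * saw k (snd z))" for k z
  define Tn where "Tn n z = (\<Sum>k<n. w k z * D (dir (along k)) z)" for n z
  define T where "T = (\<lambda>z. in_cyl z * D (0, vel (snd z)) z)"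
  obtain R where R: "\<And>x. R < norm x \<Longrightarrow> \<phi> x = 0" "\<And>x e. R < norm x \<Longrightarrow> D e x = 0" using vanish by metis
  obtain N where N: "\<And>x. \<bar>\<phi> x\<bar> \<le> N" "\<And>e x. e \<in> Basis \<Longrightarrow> \<bar>D e x\<bar> \<le> N" "0 < N" using bounds by metis
  note [measurable] = measD[OF dir_Basis]
  have mw[measurable]: "w k \<in> borel_measurable borel" for k
    unfolding w_def borel_prod[symmetric]
    by (intro borel_measurable_times measurable_in_time[unfolded borel_prod[symmetric]]; measurable)
  have bw: "\<bar>w k z\<bar> \<le> 1" for k z
    using saw_bounds[of k "snd z"] layer_cases[of k "snd z $ 1"] by (auto simp: w_def in_time_def)
  have w_shift: "w k (z + h *\<^sub>R dir (along k)) = w k z" for k z h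
    by (simp add: w_def saw_shift_along)
  have i: "integrable lborel (\<lambda>z. w k z * D (dir (along k)) z)" for k
    by (intro integrable_mult_D[OF mw bw dir_Basis])
  have "(LINT z|lborel. w k z * D (dir (along k)) z) = 0" for k
    using integration_by_parts(2)[OF mw bw _ _ dir_Basis, of k "along k" 0 "\<lambda>_. 0"]
    by (simp add: w_shift rderiv_const_along)
  then have int_Tn: "integral\<^sup>L lborel (Tn n) = 0" for n
    unfolding Tn_def using i by simp
  have mT[measurable]: "Tn n \<in> borel_measurable borel" for n unfolding Tn_def by measurable
  have dom: "\<bar>Tn n z\<bar> \<le> N * indicator (cball 0 R) z" for n z
  proof (cases "norm z \<le> R")
    case True
    have "\<bar>saw k (snd z) * D (dir (along k)) z\<bar> \<le> 1 * N" for k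
      unfolding abs_mult by (intro mult_mono saw_bounds N(2) dir_Basis) auto
    then have "\<bar>\<Sum>k<n. layer k (snd z $ 1) * (saw k (snd z) * D (dir (along k)) z)\<bar> \<le> N"
      by (intro abs_sum_layer_le) auto
    moreover have "Tn n z = in_time z * (\<Sum>k<n. layer k (snd z $ 1) * (saw k (snd z) * D (dir (along k)) z))"
      by (simp add: Tn_def w_def sum_distrib_left mult.assoc)
    ultimately show ?thesis using True N(3) by (simp add: in_time_def)
  qed (simp add: Tn_def R)
  have lim: "(\<lambda>n. Tn n z) \<longlonglongrightarrow> T z" for z
  proof (cases "0 < snd z $ 1")
    case False
    then have "layer n (snd z $ 1) = 0" for n using layer_nonzero by blast
    then have "Tn n z = 0" for n by (simp add: Tn_def w_def)
    moreover have "T z = 0" using False by (simp add: T_def in_cyl_def)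
    ultimately show ?thesis by simp
  next
    case True
    have "\<forall>\<^sub>F n in sequentially. Tn n z = T z" using eventually_scaling[OF True]
    proof eventually_elim
      case (elim n)
      have ph: "vel (snd z) = vel_upto n (snd z)"
        using phase_eq[OF True, of n] elim by auto
      have "(0, vel (snd z)) = (\<Sum>k<n. (layer k (snd z $ 1) * saw k (snd z)) *\<^sub>R dir (along k))"
        unfolding ph vel_upto_def prod_eq_iff by (simp add: fst_sum snd_sum)
      then have "D (0, vel (snd z)) z = (\<Sum>k<n. layer k (snd z $ 1) * (saw k (snd z) * D (dir (along k)) z))"
        by (simp add: linear_sum[OF linD] linear_scale[OF linD] mult.assoc)
      then show ?case using True
        by (simp add: Tn_def T_def w_def in_cyl_def in_time_def sum_distrib_left mult.assoc)
    qed
    then show ?thesis by (rule tendsto_eventually)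
  qed
  have "integral\<^sup>L lborel T = 0"
    using bounded_support_convergence(2)[OF mT lim dom] unfolding int_Tn by (simp add: LIMSEQ_const_iff)
  then have "has_bochner_integral lborel T 0"
    using bounded_support_convergence(1)[OF mT lim dom] by (simp add: has_bochner_integral_iff)
  then show ?thesis unfolding T_def .
qed

section \<open>Bounded variation\<close>

lemma cball_borel [measurable]: "cball a r \<in> sets borel"
  by simp

text \<open>The modulus of continuity in L^1 on a ball. The sign of the shift is the one that arises
  when a difference quotient is moved from the test function to \<open>f\<close>.\<close>

definition oscillation :: "real \<Rightarrow> ('a::euclidean_space \<Rightarrow> real) \<Rightarrow> 'a \<Rightarrow> real \<Rightarrow> ennreal" where
  "oscillation R f e h = (\<integral>\<^sup>+x. ennreal \<bar>f (x - h *\<^sub>R e) - f x\<bar> * indicator (cball 0 R) x \<partial>lborel)"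

text \<open>Functions of bounded variation recognised by their difference quotients in L^1, so that
  no derivative measure has to be computed. Boundedness is included to make the class stable under
  products, and the radius R + 1 contains the shifted points of the R-ball.\<close>

definition L1_lip_with :: "real \<Rightarrow> real \<Rightarrow> real \<Rightarrow> ('a::euclidean_space \<Rightarrow> real) \<Rightarrow> bool" where
  "L1_lip_with R M C f \<longleftrightarrow> f \<in> borel_measurable borel \<and> 0 \<le> M \<and> (\<forall>x. norm x \<le> R + 1 \<longrightarrow> \<bar>f x\<bar> \<le> M) \<and> 0 \<le> C \<and>
     (\<forall>e\<in>Basis. \<forall>h. 0 < h \<longrightarrow> h \<le> 1 \<longrightarrow> oscillation R f e h \<le> ennreal (C * h))"

definition L1_lip :: "real \<Rightarrow> ('a::euclidean_space \<Rightarrow> real) \<Rightarrow> bool" where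
  "L1_lip R f \<longleftrightarrow> (\<exists>M C. L1_lip_with R M C f)"

lemma L1_lip_withD:
  assumes "L1_lip_with R M C f"
  shows "f \<in> borel_measurable borel" "0 \<le> M" "\<And>x. norm x \<le> R + 1 \<Longrightarrow> \<bar>f x\<bar> \<le> M" "0 \<le> C"
    "\<And>e h. e \<in> Basis \<Longrightarrow> 0 < h \<Longrightarrow> h \<le> 1 \<Longrightarrow> oscillation R f e h \<le> ennreal (C * h)"
  using assms unfolding L1_lip_with_def by blast+

lemma L1_lipI:
  assumes "f \<in> borel_measurable borel" "\<And>x. norm x \<le> R + 1 \<Longrightarrow> \<bar>f x\<bar> \<le> M" "0 \<le> C"
    "\<And>e h. e \<in> Basis \<Longrightarrow> 0 < h \<Longrightarrow> h \<le> 1 \<Longrightarrow> oscillation R f e h \<le> ennreal (C * h)"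
  shows "L1_lip R f"
  unfolding L1_lip_def L1_lip_with_def
  by (rule exI[of _ "max 0 M"], rule exI[of _ C]) (use assms in \<open>auto simp: le_max_iff_disj\<close>)

lemma norm_diff_Basis: "e \<in> Basis \<Longrightarrow> 0 < h \<Longrightarrow> h \<le> 1 \<Longrightarrow> norm x \<le> R \<Longrightarrow> norm (x - h *\<^sub>R e) \<le> R + 1"
  using norm_triangle_ineq4[of x "h *\<^sub>R e"] by simp

text \<open>Increments of sums, products and Lipschitz images are all dominated by such a
  combination, so this is the common core of the closure properties below.\<close>

lemma oscillation_le_sum:
  assumes [measurable]: "f \<in> borel_measurable borel" "g \<in> borel_measurable borel"
    and "0 \<le> a" "0 \<le> b"
    and "\<And>x. norm x \<le> R \<Longrightarrow> \<bar>F (x - h *\<^sub>R e) - F x\<bar> \<le> a * \<bar>f (x - h *\<^sub>R e) - f x\<bar> + b * \<bar>g (x - h *\<^sub>R e) - g x\<bar>"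
    and "oscillation R f e h \<le> ennreal (C * h)" "oscillation R g e h \<le> ennreal (D * h)" "0 \<le> C" "0 \<le> D" "0 < h"
  shows "oscillation R F e h \<le> ennreal ((a * C + b * D) * h)"
proof -
  have "oscillation R F e h \<le>
      (\<integral>\<^sup>+x. ennreal a * (ennreal \<bar>f (x - h *\<^sub>R e) - f x\<bar> * indicator (cball 0 R) x) + ennreal b * (ennreal \<bar>g (x - h *\<^sub>R e) - g x\<bar> * indicator (cball 0 R) x) \<partial>lborel)"
    unfolding oscillation_def
  proof (rule nn_integral_mono)
    fix x :: 'a
    let ?y = "x - h *\<^sub>R e"
    show "ennreal \<bar>F ?y - F x\<bar> * indicator (cball 0 R) x \<le>
      ennreal a * (ennreal \<bar>f ?y - f x\<bar> * indicator (cball 0 R) x) + ennreal b * (ennreal \<bar>g ?y - g x\<bar> * indicator (cball 0 R) x)"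
    proof (cases "norm x \<le> R")
      case True
      show ?thesis using True assms(3,4) ennreal_leI[OF assms(5)[OF True]] by (simp add: ennreal_mult)
    qed simp
  qed
  also have "\<dots> = ennreal a * oscillation R f e h + ennreal b * oscillation R g e h"
    unfolding oscillation_def by (simp add: nn_integral_add nn_integral_cmult)
  also have "\<dots> \<le> ennreal a * ennreal (C * h) + ennreal b * ennreal (D * h)"
    by (intro add_mono mult_left_mono assms) auto
  also have "\<dots> = ennreal ((a * C + b * D) * h)"
    using assms by (simp add: distrib_right ennreal_mult mult.assoc)
  finally show ?thesis .
qed

lemma L1_lip_add:
  assumes "L1_lip R f" "L1_lip R g"
  shows "L1_lip R (\<lambda>x. f x + g x)"
proof -
  from assms(1) obtain M C where "L1_lip_with R M C f" unfolding L1_lip_def by blast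
  note f = L1_lip_withD[OF this]
  from assms(2) obtain N D where "L1_lip_with R N D g" unfolding L1_lip_def by blast
  note g = L1_lip_withD[OF this]
  note [measurable] = f(1) g(1)
  show ?thesis
  proof (rule L1_lipI[where M = "M + N" and C = "1 * C + 1 * D"])
    show "\<bar>f x + g x\<bar> \<le> M + N" if "norm x \<le> R + 1" for x using f(3)[OF that] g(3)[OF that] by linarith
    show "oscillation R (\<lambda>x. f x + g x) e h \<le> ennreal ((1 * C + 1 * D) * h)" if "e \<in> Basis" "0 < h" "h \<le> 1" for e h
      by (rule oscillation_le_sum[OF f(1) g(1) _ _ _ f(5)[OF that] g(5)[OF that] f(4) g(4) that(2)]) auto
  qed (use f g in auto)
qed

lemma L1_lip_mult:
  assumes "L1_lip R f" "L1_lip R g"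
  shows "L1_lip R (\<lambda>x. f x * g x)"
proof -
  from assms(1) obtain M C where "L1_lip_with R M C f" unfolding L1_lip_def by blast
  note f = L1_lip_withD[OF this]
  from assms(2) obtain N D where "L1_lip_with R N D g" unfolding L1_lip_def by blast
  note g = L1_lip_withD[OF this]
  note [measurable] = f(1) g(1)
  show ?thesis
  proof (rule L1_lipI[where M = "M * N" and C = "N * C + M * D"])
    show "\<bar>f x * g x\<bar> \<le> M * N" if "norm x \<le> R + 1" for x
      unfolding abs_mult using f(2) by (intro mult_mono f(3)[OF that] g(3)[OF that]) auto
    show "oscillation R (\<lambda>x. f x * g x) e h \<le> ennreal ((N * C + M * D) * h)" if "e \<in> Basis" "0 < h" "h \<le> 1" for e h
    proof (rule oscillation_le_sum[OF f(1) g(1) g(2) f(2) _ f(5)[OF that] g(5)[OF that] f(4) g(4) that(2)])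
      fix x :: 'a assume x: "norm x \<le> R"
      let ?y = "x - h *\<^sub>R e"
      have y: "norm ?y \<le> R + 1" "norm x \<le> R + 1" using norm_diff_Basis[OF that x] x by auto
      have "f ?y * g ?y - f x * g x = g ?y * (f ?y - f x) + f x * (g ?y - g x)" by (simp add: algebra_simps)
      also have "\<bar>\<dots>\<bar> \<le> \<bar>g ?y\<bar> * \<bar>f ?y - f x\<bar> + \<bar>f x\<bar> * \<bar>g ?y - g x\<bar>"
        unfolding abs_mult[symmetric] by (rule abs_triangle_ineq)
      also have "\<dots> \<le> N * \<bar>f ?y - f x\<bar> + M * \<bar>g ?y - g x\<bar>"
        by (intro add_mono mult_right_mono f(3) g(3) y) auto
      finally show "\<bar>f ?y * g ?y - f x * g x\<bar> \<le> N * \<bar>f ?y - f x\<bar> + M * \<bar>g ?y - g x\<bar>" .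
    qed
  qed (use f g in auto)
qed

lemma L1_lip_compose:
  assumes "L1_lip R f" and F: "\<And>p q. \<bar>F p - F q\<bar> \<le> L * \<bar>p - q\<bar>"
  shows "L1_lip R (\<lambda>x. F (f x))"
proof -
  from assms(1) obtain M C where "L1_lip_with R M C f" unfolding L1_lip_def by blast
  note f = L1_lip_withD[OF this]
  note [measurable] = f(1)
  have L: "0 \<le> L" using F[of 0 1] by simp
  have "L-lipschitz_on UNIV F" using F L by (auto intro!: lipschitz_onI simp: dist_real_def)
  then have [measurable]: "F \<in> borel_measurable borel"
    by (intro borel_measurable_continuous_onI lipschitz_on_continuous_on)
  show ?thesis
  proof (rule L1_lipI[where M = "\<bar>F 0\<bar> + L * M" and C = "L * C + 0 * C"])
    show "\<bar>F (f x)\<bar> \<le> \<bar>F 0\<bar> + L * M" if "norm x \<le> R + 1" for x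
      using F[of "f x" 0] mult_left_mono[OF f(3)[OF that] L] by simp
    show "oscillation R (\<lambda>x. F (f x)) e h \<le> ennreal ((L * C + 0 * C) * h)" if "e \<in> Basis" "0 < h" "h \<le> 1" for e h
      by (rule oscillation_le_sum[OF f(1) f(1) L _ _ f(5)[OF that] f(5)[OF that] f(4) f(4) that(2)]) (use F in auto)
  qed (use f L in auto)
qed

lemma L1_lip_of_lipschitz:
  fixes f :: "'a::euclidean_space \<Rightarrow> real"
  assumes f: "\<And>x y. \<bar>f x - f y\<bar> \<le> L * norm (x - y)"
  shows "L1_lip R f"
proof -
  obtain b :: 'a where b: "b \<in> Basis" using nonempty_Basis by blast
  have L: "0 \<le> L" using order_trans[OF abs_ge_zero f[of b 0]] b by simp
  have "L-lipschitz_on UNIV f" using f L by (auto intro!: lipschitz_onI simp: dist_real_def dist_norm)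
  then have [measurable]: "f \<in> borel_measurable borel"
    by (intro borel_measurable_continuous_onI lipschitz_on_continuous_on)
  have fin: "emeasure lborel (cball (0::'a) R) < \<infinity>" by (rule emeasure_bounded_finite) simp
  define v where "v = measure lborel (cball (0::'a) R)"
  have v: "emeasure lborel (cball (0::'a) R) = ennreal v" "0 \<le> v"
    using fin by (auto simp: v_def emeasure_eq_ennreal_measure)
  show ?thesis
  proof (rule L1_lipI[where M = "\<bar>f 0\<bar> + L * (R + 1)" and C = "L * v"])
    show "\<bar>f x\<bar> \<le> \<bar>f 0\<bar> + L * (R + 1)" if "norm x \<le> R + 1" for x
      using f[of x 0] mult_left_mono[OF that L] by simp
    fix e :: 'a and h :: real assume e: "e \<in> Basis" and h: "0 < h" "h \<le> 1"
    have d: "\<bar>f (x - h *\<^sub>R e) - f x\<bar> \<le> L * h" for x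
      using f[of "x - h *\<^sub>R e" x] h e by simp
    have "oscillation R f e h \<le> (\<integral>\<^sup>+x. ennreal (L * h) * indicator (cball (0::'a) R) x \<partial>lborel)"
      unfolding oscillation_def by (rule nn_integral_mono) (auto intro!: ennreal_leI d split: split_indicator)
    also have "\<dots> = ennreal (L * v * h)"
      using h L v by (simp add: nn_integral_cmult_indicator ennreal_mult[symmetric] ac_simps)
    finally show "oscillation R f e h \<le> ennreal (L * v * h)" .
  qed (use L v in auto)
qed

lemma L1_lip_const: "L1_lip R (\<lambda>_. c)"
  by (rule L1_lip_of_lipschitz[of _ 0]) simp

lemma L1_lip_cmult: "L1_lip R f \<Longrightarrow> L1_lip R (\<lambda>x. c * f x)"
  by (rule L1_lip_mult[OF L1_lip_const])

lemma L1_lip_diff: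
  assumes "L1_lip R f" "L1_lip R g" shows "L1_lip R (\<lambda>x. f x - g x)"
  using L1_lip_add[OF assms(1) L1_lip_cmult[OF assms(2), of "- 1"]] by simp

lemma L1_lip_sum:
  assumes "\<And>i. i \<in> I \<Longrightarrow> L1_lip R (f i)" shows "L1_lip R (\<lambda>x. \<Sum>i\<in>I. f i x)"
proof (cases "finite I")
  case True
  then show ?thesis using assms
    by (induction I rule: finite_induct) (auto intro: L1_lip_const L1_lip_add)
qed (simp add: L1_lip_const)

lemma L1_lip_cong:
  assumes "L1_lip R f" and g: "g \<in> borel_measurable borel"
    and eq: "\<And>x. norm x \<le> R + 1 \<Longrightarrow> g x = f x"
  shows "L1_lip R g"
proof -
  from assms(1) obtain M C where "L1_lip_with R M C f" unfolding L1_lip_def by blast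
  note f = L1_lip_withD[OF this]
  have "oscillation R g e h = oscillation R f e h" if "e \<in> Basis" "0 < h" "h \<le> 1" for e h
    unfolding oscillation_def
    using norm_diff_Basis[OF that] eq by (intro nn_integral_cong) (auto split: split_indicator)
  then show ?thesis using f eq by (intro L1_lipI[OF g, of R M C]) auto
qed

text \<open>A shift by h changes the indicator only in a slab of width at most h. Inside the ball of
  radius R this slab lies in a box with one side h and all others 2 R.\<close>

lemma L1_lip_half_space:
  fixes b :: "'a::euclidean_space"
  assumes b: "b \<in> Basis" and R: "0 \<le> R"
  shows "L1_lip R (\<lambda>x. of_bool (a \<le> x \<bullet> b))"
proof -
  have bound: "oscillation R (\<lambda>x. of_bool (a \<le> x \<bullet> b)) e h \<le> ennreal ((2 * R) ^ card (Basis - {b}) * h)" if e: "e \<in> Basis" and h: "0 < h \<and> h \<le> 1" for e h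
  proof -
  define l u :: 'a where "l = (\<Sum>i\<in>Basis. (if i = b then a else - R) *\<^sub>R i)"
    and "u = (\<Sum>i\<in>Basis. (if i = b then a + h else R) *\<^sub>R i)"
  have lu: "l \<bullet> i = (if i = b then a else - R)" "u \<bullet> i = (if i = b then a + h else R)" if "i \<in> Basis" for i
    using that by (simp_all add: l_def u_def inner_sum_left_Basis)
  have "oscillation R (\<lambda>x. of_bool (a \<le> x \<bullet> b)) e h \<le> (\<integral>\<^sup>+x. indicator (cbox l u) x \<partial>lborel)"
    unfolding oscillation_def
  proof (rule nn_integral_mono)
    fix x :: 'a
    show "ennreal \<bar>of_bool (a \<le> (x - h *\<^sub>R e) \<bullet> b) - of_bool (a \<le> x \<bullet> b)\<bar> * indicator (cball 0 R) x \<le> indicator (cbox l u) x"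
    proof (cases "norm x \<le> R \<and> (a \<le> (x - h *\<^sub>R e) \<bullet> b) \<noteq> (a \<le> x \<bullet> b)")
      case True
      have 1: "(x - h *\<^sub>R e) \<bullet> b = x \<bullet> b - (if e = b then h else 0)"
        using e b by (simp add: inner_diff_left inner_Basis)
      then have 2: "a \<le> x \<bullet> b" "x \<bullet> b \<le> a + h" using True h by (auto split: if_splits)
      have "\<bar>x \<bullet> i\<bar> \<le> R" if "i \<in> Basis" for i using Basis_le_norm[OF that, of x] True by linarith
      then have "x \<in> cbox l u" using 2 by (auto simp: mem_box lu abs_le_iff) (metis minus_le_iff)
      then show ?thesis by (auto split: split_indicator)
    qed (auto split: split_indicator)
  qed
  also have "\<dots> = emeasure lborel (cbox l u)" by simp
  also have "\<dots> = ennreal (\<Prod>i\<in>Basis. (u - l) \<bullet> i)"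
    using lu R h by (auto simp: emeasure_lborel_cbox_eq)
  also have "(\<Prod>i\<in>Basis. (u - l) \<bullet> i) = (\<Prod>i\<in>Basis. if i = b then h else 2 * R)"
    by (intro prod.cong) (auto simp: inner_diff_left lu)
  also have "\<dots> = h * (\<Prod>i\<in>Basis - {b}. if i = b then h else 2 * R)"
    using b by (subst prod.remove[of _ b]) auto
  also have "(\<Prod>i\<in>Basis - {b}. if i = b then h else 2 * R) = (2 * R) ^ card (Basis - {b})"
    by (subst prod.cong[OF refl, of _ _ "\<lambda>_. 2 * R"]) auto
  finally show ?thesis by (simp add: mult.commute)
  qed
  show ?thesis
    by (rule L1_lipI[where M = 1 and C = "(2 * R) ^ card (Basis - {b})"])
      (use bound R in auto)
qed

section \<open>The phase and the velocity have bounded difference quotients in L^1\<close>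

lemma L1_lip_nth: "L1_lip R (\<lambda>x::real^'n. x $ i)"
  by (rule L1_lip_of_lipschitz[of _ 1])
    (metis component_le_norm_cart mult_1 vector_minus_component)

lemma L1_lip_nth_ge:
  "0 \<le> R \<Longrightarrow> L1_lip R (\<lambda>x::real^'n. of_bool (a \<le> x $ i))"
  using L1_lip_half_space[of "axis i 1 :: real^'n" R a] by (simp add: inner_axis axis_in_Basis_iff)

text \<open>The integers from 1 - K to \<lfloor>z\<rfloor> number \<lfloor>z\<rfloor> + K. On a
  bounded set this writes the jumps of a sawtooth as finitely many half-space indicators.\<close>

lemma floor_as_sum:
  assumes "\<bar>z::real\<bar> < real K"
  shows "of_int \<lfloor>z\<rfloor> = (\<Sum>m\<in>{- int K + 1..int K}. of_bool (of_int m \<le> z)) - real K"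
proof -
  have "{- int K + 1..int K} \<inter> {m. of_int m \<le> z} = {- int K + 1..\<lfloor>z\<rfloor>}"
    using assms by (auto simp: le_floor_iff)
  moreover have "- int K \<le> \<lfloor>z\<rfloor>" using assms by (simp add: le_floor_iff)
  ultimately show ?thesis by (simp add: sum_of_bool_eq)
qed

lemma L1_lip_saw:
  assumes R: "0 \<le> R" shows "L1_lip R (saw k)"
proof -
  let ?a = "3 * 2 ^ k :: real"
  obtain K :: nat where K: "?a * (R + 1) < real K" using reals_Archimedean2 by blast
  define f where "f x = ?a * x $ across k - ((\<Sum>m\<in>{- int K + 1..int K}. of_bool (of_int m / ?a \<le> x $ across k)) - real K)" for x :: "real^3"
  have "L1_lip R f"
    unfolding f_def
    by (intro L1_lip_diff L1_lip_cmult L1_lip_nth L1_lip_sum L1_lip_nth_ge L1_lip_const R)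
  then show ?thesis
  proof (rule L1_lip_cong[OF _ measurable_saw])
    fix x :: "real^3" assume "norm x \<le> R + 1"
    then have "\<bar>x $ across k\<bar> \<le> R + 1" using component_le_norm_cart[of x "across k"] by linarith
    then have "?a * \<bar>x $ across k\<bar> \<le> ?a * (R + 1)" by (intro mult_left_mono) auto
    moreover have "\<bar>?a * x $ across k\<bar> = ?a * \<bar>x $ across k\<bar>" by (simp add: abs_mult)
    ultimately have "\<bar>?a * x $ across k\<bar> < real K" using K by linarith
    from floor_as_sum[OF this] show "saw k x = f x"
      by (simp add: saw_def frac_def f_def divide_le_eq mult.commute)
  qed
qed

lemma L1_lip_layer:
  assumes R: "0 \<le> R" shows "L1_lip R (\<lambda>x::real^3. layer k (x $ 1))"
proof -
  have "layer k s = of_bool (1 / 2 ^ Suc k \<le> s) - of_bool (1 / 2 ^ k \<le> s)" for s :: real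
  proof -
    have "1 / 2 ^ Suc k \<le> (1 / 2 ^ k :: real)" by (simp add: field_simps)
    then show ?thesis unfolding layer_def by auto
  qed
  then show ?thesis using R by (auto intro!: L1_lip_diff L1_lip_nth_ge)
qed

lemma L1_lip_ramp: "L1_lip R (\<lambda>x::real^3. ramp k (x $ 1))"
  by (rule L1_lip_compose[OF L1_lip_nth ramp_lipschitz])

lemma L1_lip_phase_upto: "0 \<le> R \<Longrightarrow> L1_lip R (phase_upto n)"
  unfolding phase_upto_def
  by (intro L1_lip_add L1_lip_sum L1_lip_mult L1_lip_ramp L1_lip_saw
      L1_lip_cmult L1_lip_nth)

lemma L1_lip_vel_upto: "0 \<le> R \<Longrightarrow> L1_lip R (\<lambda>x. vel_upto n x $ i)"
  unfolding vel_upto_def sum_component vector_scaleR_component real_scaleR_def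
  by (rule L1_lip_sum, rule L1_lip_mult[OF L1_lip_mult[OF L1_lip_layer L1_lip_saw] L1_lip_const])

section \<open>From difference quotients to the total variation\<close>

definition unit_test :: "real \<Rightarrow> ('a::euclidean_space \<Rightarrow> real) \<Rightarrow> bool" where
  "unit_test R \<phi> \<longleftrightarrow> C1_compact \<phi> \<and> (\<forall>x. \<bar>\<phi> x\<bar> \<le> 1) \<and> (\<forall>x. R < norm x \<longrightarrow> \<phi> x = 0)"

text \<open>The derivative of \<phi> is a limit of difference quotients. Translation invariance
  moves the shift onto \<open>F\<close>, and since \<phi> is bounded by 1 and lives in the R-ball,
  the oscillation of \<open>F\<close> bounds the result. The bound therefore depends on
  \<open>F\<close> alone.\<close>

lemma L1_lip_integral_D:
  assumes "L1_lip R F"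
  shows "\<exists>C\<ge>0. \<forall>\<phi> e. unit_test R \<phi> \<longrightarrow> e \<in> Basis \<longrightarrow>
     integrable lborel (\<lambda>x. F x * frechet_derivative \<phi> (at x) e) \<and>
     (LINT x|lborel. F x * frechet_derivative \<phi> (at x) e) \<le> C"
proof -
  from assms obtain M C where "L1_lip_with R M C F" unfolding L1_lip_def by blast
  note F = L1_lip_withD[OF this]
  note [measurable] = F(1)
  have "integrable lborel (\<lambda>x. F x * frechet_derivative \<phi> (at x) e) \<and>
     (LINT x|lborel. F x * frechet_derivative \<phi> (at x) e) \<le> C"
    if "unit_test R \<phi>" and e: "e \<in> Basis" for \<phi> e
  proof -
    have \<phi>: "C1_compact \<phi>" "\<And>x. \<bar>\<phi> x\<bar> \<le> 1" "\<And>x. R < norm x \<Longrightarrow> \<phi> x = 0"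
      using that(1) by (auto simp: unit_test_def)
    interpret C1_compact \<phi> by (rule \<phi>)
    obtain N where N: "\<And>x. \<bar>D e x\<bar> \<le> N" "0 < N" using bounds e by metis
    \<comment> \<open>\<open>F\<close> is known to be bounded only on the ball of radius R + 1.
      Truncation there does not affect the integrand, since the derivative of \<phi> vanishes
      outside, and it makes all products integrable.\<close>
    define G where "G x = F x * indicator (cball 0 (R + 1)) x" for x
    define M' where "M' = max 0 M"
    have M': "0 \<le> M'" and G: "\<bar>G x\<bar> \<le> M'" for x
      using F(3)[of x] by (auto simp: G_def M'_def split: split_indicator)
    have [measurable]: "G \<in> borel_measurable borel" unfolding G_def by measurable
    have D0: "D e x = 0" if "R + 1 < norm x" for x
    proof (rule D_outside)
      have "closure {x. \<phi> x \<noteq> 0} \<subseteq> cball 0 R"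
        using \<phi>(3) by (intro closure_minimal) (auto simp: not_less[symmetric])
      then show "x \<notin> closure {x. \<phi> x \<noteq> 0}" using that by auto
    qed
    have FG: "F x * D e x = G x * D e x" for x
      using D0[of x] by (auto simp: G_def split: split_indicator)
    define h :: "nat \<Rightarrow> real" where "h n = inverse (real (Suc n))" for n
    have h: "0 < h n" "h n \<le> 1" for n unfolding h_def by (auto simp: divide_simps)
    define q where "q n x = G x * ((\<phi> (x + h n *\<^sub>R e) - \<phi> x) / h n)" for n x
    have mq[measurable]: "q n \<in> borel_measurable borel" for n unfolding q_def by measurable
    have lim: "(\<lambda>n. q n x) \<longlonglongrightarrow> G x * D e x" for x
      unfolding q_def h_def by (intro tendsto_mult tendsto_const rderiv_LIMSEQ rderiv)
    have dom: "\<bar>q n x\<bar> \<le> M' * N * indicator (cball 0 (R + 1)) x" for n x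
    proof (cases "norm x \<le> R + 1")
      case True
      have "\<bar>\<phi> (x + h n *\<^sub>R e) - \<phi> x\<bar> \<le> N * h n" using lipschitz_along[OF N(1)] h[of n] by auto
      then have "\<bar>(\<phi> (x + h n *\<^sub>R e) - \<phi> x) / h n\<bar> \<le> N" using h[of n] by (simp add: abs_divide pos_divide_le_eq)
      then have "\<bar>G x\<bar> * \<bar>(\<phi> (x + h n *\<^sub>R e) - \<phi> x) / h n\<bar> \<le> M' * N" by (intro mult_mono G) (use M' in auto)
      then show ?thesis using True unfolding q_def by (simp add: abs_mult)
    qed (simp add: q_def G_def)
    have le: "integral\<^sup>L lborel (q n) \<le> C" for n
    proof -
      have i2: "integrable lborel (\<lambda>x. G x * \<phi> x)" by (rule integrable_mult[OF _ G]) measurable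
      have i3: "integrable lborel (\<lambda>x. G (x - h n *\<^sub>R e) * \<phi> x)" by (rule integrable_mult[OF _ G]) measurable
      have i1: "integrable lborel (\<lambda>x. G x * \<phi> (x + h n *\<^sub>R e))"
        using integrable_translate[OF i3, of "h n *\<^sub>R e"] by simp
      have t: "(LINT x|lborel. G x * \<phi> (x + h n *\<^sub>R e)) = (LINT x|lborel. G (x - h n *\<^sub>R e) * \<phi> x)"
        using integral_translate[of "\<lambda>x. G (x - h n *\<^sub>R e) * \<phi> x" "h n *\<^sub>R e"] by simp
      let ?d = "\<lambda>x. (G (x - h n *\<^sub>R e) - G x) * \<phi> x"
      have i4: "integrable lborel ?d" using i2 i3 by (simp add: left_diff_distrib)
      have "integral\<^sup>L lborel (q n) = (LINT x|lborel. (G x * \<phi> (x + h n *\<^sub>R e) - G x * \<phi> x) / h n)"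
        unfolding q_def by (simp add: right_diff_distrib)
      also have "\<dots> = (LINT x|lborel. ?d x) / h n"
        using i1 i2 i3 t by (simp add: left_diff_distrib)
      also have "(LINT x|lborel. ?d x) \<le> C * h n"
      proof -
        have "(\<integral>\<^sup>+x. ennreal \<bar>?d x\<bar> \<partial>lborel) \<le> (\<integral>\<^sup>+x. ennreal \<bar>F (x - h n *\<^sub>R e) - F x\<bar> * indicator (cball 0 R) x \<partial>lborel)"
        proof (rule nn_integral_mono)
          fix x
          show "ennreal \<bar>?d x\<bar> \<le> ennreal \<bar>F (x - h n *\<^sub>R e) - F x\<bar> * indicator (cball 0 R) x"
          proof (cases "norm x \<le> R")
            case True
            then have "norm (x - h n *\<^sub>R e) \<le> R + 1" using norm_diff_Basis[OF e h] by auto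
            then have "G (x - h n *\<^sub>R e) - G x = F (x - h n *\<^sub>R e) - F x" using True by (simp add: G_def)
            moreover have "\<bar>F (x - h n *\<^sub>R e) - F x\<bar> * \<bar>\<phi> x\<bar> \<le> \<bar>F (x - h n *\<^sub>R e) - F x\<bar> * 1"
              by (intro mult_left_mono \<phi>(2)) auto
            ultimately show ?thesis using True by (simp add: abs_mult ennreal_leI)
          qed (simp add: \<phi>(3))
        qed
        also have "\<dots> \<le> ennreal (C * h n)" using F(5)[OF e h] unfolding oscillation_def .
        finally have "ennreal (LINT x|lborel. \<bar>?d x\<bar>) \<le> ennreal (C * h n)"
          using i4 by (subst (asm) nn_integral_eq_integral) auto
        then have "(LINT x|lborel. \<bar>?d x\<bar>) \<le> C * h n" using F(4) h[of n] by simp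
        moreover have "(LINT x|lborel. ?d x) \<le> (LINT x|lborel. \<bar>?d x\<bar>)"
          using i4 by (intro integral_mono) auto
        ultimately show ?thesis by linarith
      qed
      finally show ?thesis using h[of n] by (simp add: pos_divide_le_eq)
    qed
    show ?thesis unfolding FG
      using bounded_support_convergence[OF mq lim dom] LIMSEQ_le_const2 le by blast
  qed
  then show ?thesis using F(4) by blast
qed

text \<open>The pairing is expanded into scalar entries, each of which is a unit test for one
  component of \<open>F\<close>. Having \<open>F\<close> beside \<open>f\<close> allows a comparison
  function with finitely many layers, controlled on a whole ball, while \<open>f\<close> is
  considered on U only.\<close>

lemma variation_finite:
  fixes f F :: "real^'n \<Rightarrow> real^'m"
  assumes U: "open U" "U \<subseteq> cball 0 R" and F: "\<And>i. L1_lip R (\<lambda>x. F x $ i)"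
    and eq: "\<And>x. x \<in> U \<Longrightarrow> f x = F x"
  shows "variation U f < \<infinity>"
proof -
  have "\<forall>i. \<exists>C. 0 \<le> C \<and> (\<forall>\<phi> e. unit_test R \<phi> \<longrightarrow> e \<in> Basis \<longrightarrow>
     integrable lborel (\<lambda>x. F x $ i * frechet_derivative \<phi> (at x) e) \<and>
     (LINT x|lborel. F x $ i * frechet_derivative \<phi> (at x) e) \<le> C)"
    using L1_lip_integral_D[OF F] by blast
  from choice[OF this] obtain C where C: "\<forall>i. 0 \<le> C i \<and> (\<forall>\<phi> e. unit_test R \<phi> \<longrightarrow> e \<in> Basis \<longrightarrow>
     integrable lborel (\<lambda>x. F x $ i * frechet_derivative \<phi> (at x) e) \<and>
     (LINT x|lborel. F x $ i * frechet_derivative \<phi> (at x) e) \<le> C i)" ..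
  have "variation U f \<le> ennreal (\<Sum>i\<in>UNIV. \<Sum>j\<in>(UNIV::'n set). C i)"
    unfolding variation_def
  proof (rule SUP_least)
    fix \<Phi> :: "real^'n \<Rightarrow> real^'n^'m"
    assume "\<Phi> \<in> {\<Phi>. C_k 1 \<Phi> \<and> compact_support_in U \<Phi> \<and> (\<forall>x. norm (\<Phi> x) \<le> 1)}"
    then have \<Phi>: "C_k 1 \<Phi>" "compact (closure {x. \<Phi> x \<noteq> 0})" "closure {x. \<Phi> x \<noteq> 0} \<subseteq> U" "\<And>x. norm (\<Phi> x) \<le> 1"
      by (auto simp: compact_support_in_def)
    have der: "(\<Phi> has_derivative frechet_derivative \<Phi> (at x)) (at x)" for x
      using \<Phi>(1) by (simp add: frechet_derivative_works)
    have der': "((\<lambda>x. \<Phi> x $ i $ j) has_derivative (\<lambda>v. frechet_derivative \<Phi> (at x) v $ i $ j)) (at x)" for i j x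
      by (intro bounded_linear.has_derivative[OF bounded_linear_vec_nth] der)
    have fd: "frechet_derivative (\<lambda>x. \<Phi> x $ i $ j) (at x) = (\<lambda>v. frechet_derivative \<Phi> (at x) v $ i $ j)" for i j x
      using frechet_derivative_at[OF der'] by simp
    have sub: "closure {x. \<Phi> x $ i $ j \<noteq> 0} \<subseteq> closure {x. \<Phi> x \<noteq> 0}" for i j
      by (intro closure_mono) auto
    have C1: "C1_compact (\<lambda>x. \<Phi> x $ i $ j)" for i j
    proof
      show "C_k 1 (\<lambda>x. \<Phi> x $ i $ j)"
        using \<Phi>(1) der' by (auto simp: fd differentiable_def intro!: continuous_intros)
      show "compact (closure {x. \<Phi> x $ i $ j \<noteq> 0})"
        using compact_Int_closed[OF \<Phi>(2), of "closure {x. \<Phi> x $ i $ j \<noteq> 0}"] sub[of i j] by (simp add: Int_absorb1)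
    qed
    have le1: "\<bar>\<Phi> x $ i $ j\<bar> \<le> 1" for x i j
      using component_le_norm_cart[of "\<Phi> x $ i" j] Finite_Cartesian_Product.norm_nth_le[of "\<Phi> x" i] \<Phi>(4)[of x] by linarith
    have van: "\<Phi> x $ i $ j = 0" if "R < norm x" for x i j
    proof -
      have "x \<notin> closure {x. \<Phi> x \<noteq> 0}" using that U(2) \<Phi>(3) by (auto simp: subset_iff)
      then have "\<Phi> x = 0" using closure_subset[of "{x. \<Phi> x \<noteq> 0}"] by blast
      then show ?thesis by simp
    qed
    have b: "axis j 1 \<in> (Basis :: (real^'n) set)" for j by (simp add: axis_in_Basis_iff)
    have "unit_test R (\<lambda>x. \<Phi> x $ i $ j)" for i j
      unfolding unit_test_def using C1 le1 van by blast
    note CC = C[rule_format, THEN conjunct2, rule_format, OF this b]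
    have outside: "frechet_derivative (\<lambda>x. \<Phi> x $ i $ j) (at x) e = 0" if "x \<notin> U" for x i j e
      using that sub[of i j] \<Phi>(3) by (intro C1_compact.D_outside[OF C1]) auto
    have "(LINT x|lebesgue_on U. f x \<bullet> row_div \<Phi> x) =
      (LINT x|lebesgue. indicator U x *\<^sub>R (f x \<bullet> row_div \<Phi> x))"
      using U(1) by (subst integral_restrict_space) auto
    also have "\<dots> = (LINT x|lebesgue. (\<Sum>i\<in>UNIV. \<Sum>j\<in>UNIV. F x $ i * frechet_derivative (\<lambda>x. \<Phi> x $ i $ j) (at x) (axis j 1)))"
    proof (rule Bochner_Integration.integral_cong[OF refl])
      fix x
      show "indicator U x *\<^sub>R (f x \<bullet> row_div \<Phi> x) = (\<Sum>i\<in>UNIV. \<Sum>j\<in>UNIV. F x $ i * frechet_derivative (\<lambda>x. \<Phi> x $ i $ j) (at x) (axis j 1))"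
      proof (cases "x \<in> U")
        case True
        then show ?thesis by (simp add: eq inner_vec_def row_div_def fd sum_distrib_left)
      qed (simp add: outside)
    qed
    also have "\<dots> = (LINT x|lborel. (\<Sum>i\<in>UNIV. \<Sum>j\<in>UNIV. F x $ i * frechet_derivative (\<lambda>x. \<Phi> x $ i $ j) (at x) (axis j 1)))"
      using CC by (intro integral_completion borel_measurable_sum borel_measurable_integrable) auto
    also have "\<dots> = (\<Sum>i\<in>UNIV. \<Sum>j\<in>UNIV. (LINT x|lborel. F x $ i * frechet_derivative (\<lambda>x. \<Phi> x $ i $ j) (at x) (axis j 1)))"
      using CC by (simp add: Bochner_Integration.integral_sum)
    also have "\<dots> \<le> (\<Sum>i\<in>UNIV. \<Sum>j\<in>(UNIV::'n set). C i)"
      using CC by (intro sum_mono) auto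
    finally show "ennreal (LINT x|lebesgue_on U. f x \<bullet> row_div \<Phi> x) \<le> ennreal (\<Sum>i\<in>UNIV. \<Sum>j\<in>(UNIV::'n set). C i)"
      by (rule ennreal_leI)
  qed
  also have "\<dots> < \<infinity>" by simp
  finally show ?thesis .
qed

section \<open>Hausdorff measure on the wall\<close>

lemma hausdorff_pre_translate_le:
  fixes A :: "'a::real_normed_vector set"
  shows "hausdorff_pre k \<delta> ((+) a ` A) \<le> hausdorff_pre k \<delta> A"
  unfolding hausdorff_pre_def
proof (rule INF_greatest)
  fix C :: "nat \<Rightarrow> 'a set"
  assume C: "C \<in> {C. A \<subseteq> (\<Union>j. C j) \<and> (\<forall>j. bounded (C j) \<and> diameter (C j) \<le> \<delta>)}"
  have d: "diameter ((+) a ` S) = diameter S" for S :: "'a set"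
  proof -
    have "(\<lambda>(x, y). dist x y) ` ((+) a ` S \<times> (+) a ` S) = (\<lambda>(x, y). dist x y) ` (S \<times> S)"
      by (force simp: image_iff)
    then show ?thesis unfolding diameter_def by simp
  qed
  have "(\<lambda>j. (+) a ` C j) \<in> {C. (+) a ` A \<subseteq> (\<Union>j. C j) \<and> (\<forall>j. bounded (C j) \<and> diameter (C j) \<le> \<delta>)}"
    using C by (simp only: mem_Collect_eq image_UN[symmetric] d bounded_translation image_mono simp_thms)
  then show "(INF C\<in>{C. (+) a ` A \<subseteq> (\<Union>j. C j) \<and> (\<forall>j. bounded (C j) \<and> diameter (C j) \<le> \<delta>)}.
       \<Sum>j. if C j = {} then 0 else ennreal (unit_ball_vol (real k) * (diameter (C j) / 2) ^ k))
    \<le> (\<Sum>j. if C j = {} then 0 else ennreal (unit_ball_vol (real k) * (diameter (C j) / 2) ^ k))"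
    by (rule INF_lower2) (simp add: d cong: if_cong)
qed

lemma hausdorff_outer_translate:
  fixes A :: "'a::real_normed_vector set"
  shows "hausdorff_outer k ((+) a ` A) = hausdorff_outer k A"
proof -
  have "hausdorff_pre k \<delta> A \<le> hausdorff_pre k \<delta> ((+) a ` A)" for \<delta>
    using hausdorff_pre_translate_le[of k \<delta> "- a" "(+) a ` A"] by (simp add: image_comp o_def)
  then show ?thesis
    unfolding hausdorff_outer_def using hausdorff_pre_translate_le
    by (intro SUP_cong antisym) auto
qed

lemma sets_hausdorff_measure [simp, measurable_cong]:
  "sets (hausdorff_measure k :: 'a::metric_space measure) = sets borel"
  unfolding hausdorff_measure_def using sets.sets_measure_of_eq[of "borel :: 'a measure"] by simp

lemma space_hausdorff_measure [simp]: "space (hausdorff_measure k) = UNIV"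
  unfolding hausdorff_measure_def by (simp add: space_measure_of_conv)

text \<open>Where countable additivity fails, \<^const>\<open>measure_of\<close> is the null measure. What follows holds in
  either case, so additivity on Borel sets is never shown.\<close>

lemma emeasure_hausdorff_measure:
  fixes A :: "'a::metric_space set"
  assumes "A \<in> sets borel"
  shows "emeasure (hausdorff_measure k) A =
    (if measure_space UNIV (sets (borel :: 'a measure)) (hausdorff_outer k) then hausdorff_outer k A else 0)"
  using assms sets.sigma_sets_eq[of "borel :: 'a measure"]
  by (simp add: hausdorff_measure_def emeasure_measure_of_conv)

lemma emeasure_hausdorff_measure_le:
  "emeasure (hausdorff_measure k) A \<le> hausdorff_outer k A"
  by (cases "A \<in> sets borel") (auto simp: emeasure_hausdorff_measure emeasure_notin_sets)

lemma translation_borel: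
  fixes A :: "'a::euclidean_space set"
  assumes "A \<in> sets borel" shows "(+) a ` A \<in> sets borel" "(\<lambda>x. x + a) -` A \<in> sets borel"
proof -
  have *: "(\<lambda>x. x + a) -` A \<in> sets borel" if "A \<in> sets borel" for A and a :: 'a
    using measurable_sets[of "\<lambda>x. x + a" borel borel A] that by simp
  show "(\<lambda>x. x + a) -` A \<in> sets borel" using * assms .
  have "(+) a ` A = (\<lambda>x. x + - a) -` A"
    by (force simp: image_iff)
  then show "(+) a ` A \<in> sets borel" using *[OF assms, of "- a"] by simp
qed

lemma emeasure_hausdorff_measure_translate:
  fixes A :: "'a::euclidean_space set"
  assumes "A \<in> sets borel"
  shows "emeasure (hausdorff_measure k) ((\<lambda>x. x + a) -` A) = emeasure (hausdorff_measure k) A"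
proof -
  have "(\<lambda>x. x + a) -` A = (+) (- a) ` A"
    by (force simp: image_iff)
  then have "hausdorff_outer k ((\<lambda>x. x + a) -` A) = hausdorff_outer k A"
    by (simp only: hausdorff_outer_translate)
  then show ?thesis
    by (simp only: emeasure_hausdorff_measure[OF translation_borel(2)[OF assms]] emeasure_hausdorff_measure[OF assms])
qed

section \<open>The boundary plane and a grid that covers its squares\<close>

definition wall :: "(real^3) set" where "wall = {x. x $ 1 = 0}"

lemma frontier_half_space: "frontier half_space = wall"
proof -
  have "half_space = {x. axis 1 1 \<bullet> x > 0}" "wall = {x. axis 1 1 \<bullet> x = 0}"
    by (auto simp: half_space_def wall_def inner_axis')
  then show ?thesis using frontier_halfspace_gt[of "axis 1 1 :: real^3" 0] by (simp add: axis_eq_0_iff)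
qed

lemma half_space_borel: "half_space \<in> sets borel"
  unfolding half_space_def by measurable

lemma wall_borel: "wall \<in> sets borel"
  unfolding wall_def by measurable

definition wall_square :: "nat \<Rightarrow> (real^3) set" where
  "wall_square n = {x. x $ 1 = 0 \<and> \<bar>x $ 2\<bar> \<le> real n \<and> \<bar>x $ (3::3)\<bar> \<le> real n}"

text \<open>A grid of squares of side \<open>1/m\<close> gives a bound that is uniform in \<open>m\<close>; its value is irrelevant.\<close>

lemma hausdorff_outer_wall_finite:
  "hausdorff_outer 2 (wall_square n) \<le> ennreal (pi * (2 * real n + 1)\<^sup>2)"
  unfolding hausdorff_outer_def
proof (rule SUP_least)
  fix \<delta> :: real assume "\<delta> \<in> {0<..}"
  then have \<delta>: "0 < \<delta>" by simp
  obtain m :: nat where m: "2 / \<delta> < real m" using reals_Archimedean2 by blast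
  then have m0: "0 < real m" using \<delta> by (meson divide_pos_pos less_trans zero_less_numeral)
  have m1: "1 \<le> real m" using m0 by (simp add: Suc_leI)
  define N where "N = 2 * n * m + 1"
  define C :: "nat \<Rightarrow> (real^3) set" where "C j = (if j < N * N then
      {x. x $ 1 = 0 \<and> real (j div N) / m \<le> x $ 2 + n \<and> x $ 2 + n \<le> (real (j div N) + 1) / m
        \<and> real (j mod N) / m \<le> x $ 3 + n \<and> x $ 3 + n \<le> (real (j mod N) + 1) / m} else {})" for j
  have N0: "0 < N" by (simp add: N_def)
  have dist: "norm (x - y) \<le> 2 / m" if "x \<in> C j" "y \<in> C j" for x y j
  proof -
    have "norm (x - y) \<le> (\<Sum>i\<in>UNIV. \<bar>(x - y) $ i\<bar>)" by (rule norm_le_l1_cart)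
    also have "\<dots> = \<bar>x $ 1 - y $ 1\<bar> + \<bar>x $ 2 - y $ 2\<bar> + \<bar>x $ 3 - y $ 3\<bar>" by (simp add: sum_3)
    also have "\<dots> \<le> 0 + 1 / m + 1 / m"
      using that by (intro add_mono) (auto simp: C_def add_divide_distrib split: if_splits)
    finally show ?thesis by simp
  qed
  have bd: "bounded (C j)" for j
  proof (cases "C j = {}")
    case False
    then obtain y where "y \<in> C j" by auto
    then show ?thesis using dist
      by (intro bounded_subset[OF bounded_cball[of y "2 / m"]]) (auto simp: dist_norm norm_minus_commute)
  qed simp
  have diam: "diameter (C j) \<le> 2 / m" for j
    using dist m0 by (intro diameter_le) auto
  have "2 / m \<le> \<delta>" using m \<delta> m0 by (simp add: field_simps)
  then have diam': "diameter (C j) \<le> \<delta>" for j using diam[of j] by linarith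
  have cover: "(wall_square n) \<subseteq> (\<Union>j. C j)"
  proof
    fix x :: "real^3" assume "x \<in> wall_square n"
    then have x: "x $ 1 = 0" "\<bar>x $ 2\<bar> \<le> real n" "\<bar>x $ 3\<bar> \<le> real n" by (auto simp: wall_square_def)
    have ex: "\<exists>p<N. real p / m \<le> y + n \<and> y + n \<le> (real p + 1) / m" if "\<bar>y\<bar> \<le> real n" for y
    proof (intro exI[of _ "nat \<lfloor>(y + n) * m\<rfloor>"] conjI)
      have 0: "0 \<le> (y + n) * m" using that m0 by (intro mult_nonneg_nonneg) auto
      have 1: "(y + n) * m \<le> (2 * real n) * real m" using that m0 by (intro mult_right_mono) auto
      have f: "real (nat \<lfloor>(y + n) * m\<rfloor>) = of_int \<lfloor>(y + n) * m\<rfloor>" using 0 by simp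
      have "of_int \<lfloor>(y + n) * m\<rfloor> \<le> real (2 * n * m)" using 1 of_int_floor_le[of "(y + n) * m"]
        unfolding of_nat_mult of_nat_numeral by (rule order_trans[rotated])
      then show "nat \<lfloor>(y + n) * m\<rfloor> < N" unfolding N_def using f by linarith
      show "real (nat \<lfloor>(y + n) * m\<rfloor>) / m \<le> y + n" unfolding f using m0 by (simp add: pos_divide_le_eq)
      show "y + n \<le> (real (nat \<lfloor>(y + n) * m\<rfloor>) + 1) / m" unfolding f using m0
        by (simp add: pos_le_divide_eq)
    qed
    obtain p q where pq: "p < N" "real p / m \<le> x $ 2 + n" "x $ 2 + n \<le> (real p + 1) / m"
      "q < N" "real q / m \<le> x $ 3 + n" "x $ 3 + n \<le> (real q + 1) / m"
      using ex[OF x(2)] ex[OF x(3)] by blast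
    have "p * N + q < N * N"
    proof -
      have "p * N + q < p * N + N" using pq by simp
      also have "\<dots> = Suc p * N" by simp
      also have "\<dots> \<le> N * N" using pq by (intro mult_le_mono1) auto
      finally show ?thesis .
    qed
    then have "x \<in> C (p * N + q)" unfolding C_def using pq x N0 by simp
    then show "x \<in> (\<Union>j. C j)" by blast
  qed
  have "hausdorff_pre 2 \<delta> (wall_square n) \<le>
     (\<Sum>j. if C j = {} then 0 else ennreal (unit_ball_vol (real 2) * (diameter (C j) / 2) ^ 2))"
    unfolding hausdorff_pre_def by (rule INF_lower) (use cover bd diam' in auto)
  also have "\<dots> \<le> (\<Sum>j. if j < N * N then ennreal (pi * (1 / m)\<^sup>2) else 0)"
  proof (rule suminf_le)
    fix j
    have "diameter (C j) / 2 \<le> 1 / m" using diam[of j] by simp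
    then have "(diameter (C j) / 2)\<^sup>2 \<le> (1 / m)\<^sup>2"
      using diameter_ge_0[OF bd] by (intro power_mono) auto
    then show "(if C j = {} then 0 else ennreal (unit_ball_vol (real 2) * (diameter (C j) / 2)\<^sup>2)) \<le>
      (if j < N * N then ennreal (pi * (1 / m)\<^sup>2) else 0)"
      by (auto simp: C_def[of j] unit_ball_vol_2 intro!: ennreal_leI mult_left_mono)
  qed auto
  also have "\<dots> = (\<Sum>j<N * N. ennreal (pi * (1 / m)\<^sup>2))"
    by (subst suminf_finite[of "{..<N * N}"]) auto
  also have "\<dots> = ennreal (real (N * N) * (pi * (1 / m)\<^sup>2))"
    by (simp add: ennreal_mult' ennreal_of_nat_eq_real_of_nat)
  also have "\<dots> \<le> ennreal (pi * (2 * real n + 1)\<^sup>2)"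
  proof (rule ennreal_leI)
    have "real N / m \<le> 2 * real n + 1" using m1 by (simp add: N_def field_simps)
    then have "(real N / m)\<^sup>2 \<le> (2 * real n + 1)\<^sup>2" by (intro power_mono) auto
    from mult_left_mono[OF this, of pi]
    show "real (N * N) * (pi * (1 / m)\<^sup>2) \<le> pi * (2 * real n + 1)\<^sup>2"
      by (simp add: power2_eq_square ac_simps)
  qed
  finally show "hausdorff_pre 2 \<delta> (wall_square n)
     \<le> ennreal (pi * (2 * real n + 1)\<^sup>2)" .
qed

text \<open>For the unit cube B, integrate 1_A(x + y) 1_B(y) over x and y. Integrating x against
  \<mu> first gives \<mu>(A), by invariance and since B has volume 1. Substituting z = x + y for y
  and then integrating x first gives \<mu>(-B) times the volume of A.\<close>

lemma translation_invariant_measure_unique: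
  fixes \<mu> :: "'a::euclidean_space measure"
  assumes sets: "sets \<mu> = sets borel" and sf: "sigma_finite_measure \<mu>"
    and inv: "\<And>a A. A \<in> sets borel \<Longrightarrow> emeasure \<mu> ((\<lambda>x. x + a) -` A) = emeasure \<mu> A"
    and A: "A \<in> sets borel"
  shows "emeasure \<mu> A = emeasure \<mu> (uminus -` cbox 0 One) * emeasure lborel A"
proof -
  interpret \<mu>: sigma_finite_measure \<mu> by fact
  interpret P: pair_sigma_finite \<mu> lborel ..
  note [measurable_cong] = sets
  note [measurable] = A
  let ?B = "cbox 0 One :: 'a set"
  have uB: "uminus -` ?B \<in> sets borel" using measurable_sets[of uminus borel borel ?B] by simp
  have "emeasure lborel ?B = 1" by (simp add: emeasure_lborel_cbox_eq inner_sum_left inner_Basis if_distrib cong: if_cong)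
  then have "emeasure \<mu> A = (\<integral>\<^sup>+y. emeasure \<mu> A * indicator ?B y \<partial>lborel)"
    by (simp add: nn_integral_cmult)
  also have "\<dots> = (\<integral>\<^sup>+y. (\<integral>\<^sup>+x. indicator A (x + y) * indicator ?B y \<partial>\<mu>) \<partial>lborel)"
  proof (rule nn_integral_cong)
    fix y :: 'a
    have "(\<integral>\<^sup>+x. indicator A (x + y) \<partial>\<mu>) = (\<integral>\<^sup>+x. indicator ((\<lambda>x. x + y) -` A) x \<partial>\<mu>)"
      by (intro nn_integral_cong) (auto split: split_indicator)
    also have "\<dots> = emeasure \<mu> A" using translation_borel(2)[OF A, of y] by (simp add: inv A sets)
    finally show "emeasure \<mu> A * indicator ?B y = (\<integral>\<^sup>+x. indicator A (x + y) * indicator ?B y \<partial>\<mu>)"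
      by (simp add: nn_integral_multc)
  qed
  also have "\<dots> = (\<integral>\<^sup>+x. (\<integral>\<^sup>+y. indicator A (x + y) * indicator ?B y \<partial>lborel) \<partial>\<mu>)"
    by (rule P.Fubini') measurable
  also have "\<dots> = (\<integral>\<^sup>+x. (\<integral>\<^sup>+z. indicator A z * indicator ?B (z - x) \<partial>lborel) \<partial>\<mu>)"
  proof (rule nn_integral_cong)
    fix x
    have "(\<integral>\<^sup>+z. indicator A z * indicator ?B (z - x) \<partial>lborel) =
       (\<integral>\<^sup>+z. indicator A z * indicator ?B (z - x) \<partial>distr lborel borel ((+) x))"
      by (simp add: lborel_distr_plus)
    also have "\<dots> = (\<integral>\<^sup>+y. indicator A (x + y) * indicator ?B y \<partial>lborel)"
      by (subst nn_integral_distr) auto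
    finally show "(\<integral>\<^sup>+y. indicator A (x + y) * indicator ?B y \<partial>lborel) = (\<integral>\<^sup>+z. indicator A z * indicator ?B (z - x) \<partial>lborel)" ..
  qed
  also have "\<dots> = (\<integral>\<^sup>+z. (\<integral>\<^sup>+x. indicator A z * indicator ?B (z - x) \<partial>\<mu>) \<partial>lborel)"
    by (rule P.Fubini'[symmetric]) measurable
  also have "\<dots> = (\<integral>\<^sup>+z. emeasure \<mu> (uminus -` ?B) * indicator A z \<partial>lborel)"
  proof (rule nn_integral_cong)
    fix z :: 'a
    have "(\<integral>\<^sup>+x. indicator ?B (z - x) \<partial>\<mu>) = (\<integral>\<^sup>+x. indicator ((\<lambda>x. x + - z) -` (uminus -` ?B)) x \<partial>\<mu>)"
      by (intro nn_integral_cong) (auto split: split_indicator)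
    also have "\<dots> = emeasure \<mu> (uminus -` ?B)"
      using translation_borel(2)[OF uB, of "- z"] inv[OF uB, of "- z"] by (simp add: sets del: add_uminus_conv_diff)
    finally show "(\<integral>\<^sup>+x. indicator A z * indicator ?B (z - x) \<partial>\<mu>) = emeasure \<mu> (uminus -` ?B) * indicator A z"
      by (simp add: nn_integral_cmult mult.commute)
  qed
  also have "\<dots> = emeasure \<mu> (uminus -` ?B) * emeasure lborel A" by (simp add: nn_integral_cmult)
  finally show ?thesis .
qed

section \<open>The surface measure compared with Lebesgue measure\<close>

abbreviation wall_measure :: "(real^3) measure" where
  "wall_measure \<equiv> restrict_space (hausdorff_measure 2) wall"

abbreviation line_wall :: "(spacetime) measure" where
  "line_wall \<equiv> lborel \<Otimes>\<^sub>M wall_measure"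

abbreviation time_wall :: "(spacetime) measure" where
  "time_wall \<equiv> lebesgue_on {0<..<1} \<Otimes>\<^sub>M wall_measure"

lemma space_wall_measure [simp]: "space wall_measure = wall"
  by (simp add: space_restrict_space)

lemma wall_measurable_id: "(\<lambda>x. x) \<in> wall_measure \<rightarrow>\<^sub>M borel"
  by (intro measurable_restrict_space1 measurable_ident_sets) simp

lemma emeasure_wall_measure:
  assumes "A \<in> sets borel"
  shows "emeasure wall_measure (wall \<inter> A) = emeasure (hausdorff_measure 2) (wall \<inter> A)"
  using wall_borel by (intro emeasure_restrict_space) auto

lemma wall_square_borel: "wall_square n \<in> sets borel"
  unfolding wall_square_def by measurable

lemma wall_square_sets: "wall_square n \<in> sets wall_measure"
  using wall_square_borel[of n] wall_borel
  by (auto simp: sets_restrict_space wall_square_def wall_def image_iff intro!: bexI[of _ "wall_square n"])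

lemma wall_square_finite: "emeasure wall_measure (wall_square n) < \<infinity>"
proof -
  have "emeasure wall_measure (wall_square n) = emeasure (hausdorff_measure 2) (wall_square n)"
    using emeasure_wall_measure[OF wall_square_borel[of n]]
    by (simp add: Int_absorb1 wall_square_def wall_def Collect_mono_iff)
  also have "\<dots> \<le> ennreal (pi * (2 * real n + 1)\<^sup>2)"
    using emeasure_hausdorff_measure_le hausdorff_outer_wall_finite[of n]
    by (rule order_trans)
  finally show ?thesis by (rule le_less_trans) simp
qed

lemma wall_square_covers: "x \<in> wall \<Longrightarrow> norm x \<le> real n \<Longrightarrow> x \<in> wall_square n"
  using component_le_norm_cart[of x 2] component_le_norm_cart[of x 3]
  by (auto simp: wall_def wall_square_def)

interpretation wall: sigma_finite_measure wall_measure
proof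
  show "\<exists>A. countable A \<and> A \<subseteq> sets wall_measure \<and> \<Union> A = space wall_measure \<and> (\<forall>a\<in>A. emeasure wall_measure a \<noteq> \<infinity>)"
  proof (intro exI[of _ "range wall_square"] conjI)
    show "\<Union> (range wall_square) = space wall_measure"
    proof
      show "\<Union> (range wall_square) \<subseteq> space wall_measure" by (auto simp: wall_square_def wall_def)
      show "space wall_measure \<subseteq> \<Union> (range wall_square)"
      proof
        fix x assume "x \<in> space wall_measure"
        then show "x \<in> \<Union> (range wall_square)"
          using wall_square_covers[of x] real_arch_simple[of "norm x"] by auto
      qed
    qed
  qed (use wall_square_sets wall_square_finite[THEN less_imp_neq] in auto)
qed

interpretation lborel_wall: pair_sigma_finite "lborel :: real measure" wall_measure ..

lemma emeasure_wall_translate: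
  assumes A: "A \<in> sets borel" and a: "a $ 1 = 0"
  shows "emeasure wall_measure (wall \<inter> (\<lambda>x. x + a) -` A) = emeasure wall_measure (wall \<inter> A)"
proof -
  have e: "wall \<inter> (\<lambda>x. x + a) -` A = (\<lambda>x. x + a) -` (wall \<inter> A)" using a by (auto simp: wall_def)
  have "emeasure wall_measure (wall \<inter> (\<lambda>x. x + a) -` A) = emeasure (hausdorff_measure 2) ((\<lambda>x. x + a) -` (wall \<inter> A))"
    unfolding emeasure_wall_measure[OF translation_borel(2)[OF A]] by (simp only: e)
  also have "\<dots> = emeasure (hausdorff_measure 2) (wall \<inter> A)"
    using A wall_borel by (intro emeasure_hausdorff_measure_translate) auto
  finally show ?thesis unfolding emeasure_wall_measure[OF A] .
qed

definition swept :: "(real^3) measure" where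
  "swept = distr line_wall borel (\<lambda>(s, x). x + s *\<^sub>R axis 1 1)"

lemma sweep_measurable[measurable]:
  "(\<lambda>(s, x). x + s *\<^sub>R axis 1 1) \<in> line_wall \<rightarrow>\<^sub>M borel"
proof -
  note [measurable] = measurable_compose[OF measurable_snd wall_measurable_id]
  show ?thesis by measurable
qed

text \<open>Sweeping the wall along its normal yields a translation invariant measure on space. This
  compares \<open>\<H>\<^sup>2\<close> on the wall with Lebesgue measure up to an unknown constant \<open>c\<close>,
  which the field below absorbs.\<close>

lemma swept_eq:
  "\<exists>c\<ge>0. swept = density lborel (\<lambda>_. ennreal c)"
proof -
  have sets: "sets swept = sets borel" by (simp add: swept_def)
  have em: "emeasure swept A = (\<integral>\<^sup>+s. emeasure wall_measure (wall \<inter> (\<lambda>x. x + s *\<^sub>R axis 1 1) -` A) \<partial>lborel)"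
    if [measurable]: "A \<in> sets borel" for A
  proof -
    have "emeasure swept A = emeasure line_wall ((\<lambda>(s, x). x + s *\<^sub>R axis 1 1) -` A \<inter> space line_wall)"
      unfolding swept_def by (rule emeasure_distr) measurable
    also have "\<dots> = (\<integral>\<^sup>+s. emeasure wall_measure (Pair s -` ((\<lambda>(s, x). x + s *\<^sub>R axis 1 1) -` A \<inter> space line_wall)) \<partial>lborel)"
      by (rule wall.emeasure_pair_measure_alt) measurable
    also have "\<dots> = (\<integral>\<^sup>+s. emeasure wall_measure (wall \<inter> (\<lambda>x. x + s *\<^sub>R axis 1 1) -` A) \<partial>lborel)"
      by (intro nn_integral_cong arg_cong[where f = "emeasure wall_measure"]) (auto simp: space_pair_measure)
    finally show ?thesis .
  qed
  \<comment> \<open>Cubes have finite swept measure: the slice belonging to s lies in a wall square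
    and is empty for |s| > n. This yields sigma-finiteness and, later, that the constant is
    finite.\<close>
  let ?Q = "\<lambda>n. cbox (\<chi> i. - real n) (\<chi> i. real n) :: (real^3) set"
  have mem: "x \<in> ?Q n \<longleftrightarrow> (\<forall>i. \<bar>x $ i\<bar> \<le> real n)" for x n
    by (auto simp: mem_box_cart abs_le_iff) (metis minus_le_iff)+
  have ball: "x \<in> ?Q n" if "norm x \<le> real n" for x n
    unfolding mem using order_trans[OF component_le_norm_cart that] by blast
  have finQ: "emeasure swept (?Q n) < \<infinity>" for n
  proof -
    have "emeasure swept (?Q n) \<le> (\<integral>\<^sup>+s. emeasure wall_measure (wall_square n) * indicator {- real n..real n} s \<partial>lborel)"
      unfolding em[OF borel_closed[OF closed_cbox]]
    proof (rule nn_integral_mono)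
      fix s :: real
      show "emeasure wall_measure (wall \<inter> (\<lambda>x. x + s *\<^sub>R axis 1 1) -` ?Q n) \<le> emeasure wall_measure (wall_square n) * indicator {- real n..real n} s"
      proof (cases "\<bar>s\<bar> \<le> real n")
        case True
        have "wall \<inter> (\<lambda>x. x + s *\<^sub>R axis 1 1) -` ?Q n \<subseteq> wall_square n"
          unfolding mem vimage_def wall_square_def wall_def by (auto simp: forall_3 axis_def)
        then have "emeasure wall_measure (wall \<inter> (\<lambda>x. x + s *\<^sub>R axis 1 1) -` ?Q n) \<le> emeasure wall_measure (wall_square n)"
          by (rule emeasure_mono[OF _ wall_square_sets])
        then show ?thesis using True by (auto simp: abs_le_iff)
      next
        case False
        then have "wall \<inter> (\<lambda>x. x + s *\<^sub>R axis 1 1) -` ?Q n = {}"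
          unfolding mem vimage_def wall_def by (auto simp: forall_3 axis_def)
        then show ?thesis by simp
      qed
    qed
    also have "\<dots> < \<infinity>"
      using wall_square_finite[of n] by (simp add: nn_integral_cmult ennreal_mult_less_top)
    finally show ?thesis .
  qed
  have sf: "sigma_finite_measure swept"
  proof
    have "(\<Union>n. ?Q n) = UNIV"
    proof (intro UNIV_eq_I[symmetric])
      fix x :: "real^3"
      obtain n where "norm x \<le> real n" using real_arch_simple by blast
      from ball[OF this] show "x \<in> (\<Union>n. ?Q n)" by blast
    qed
    then show "\<exists>A. countable A \<and> A \<subseteq> sets swept \<and> \<Union> A = space swept \<and> (\<forall>a\<in>A. emeasure swept a \<noteq> \<infinity>)"
      using finQ by (intro exI[of _ "range ?Q"]) (auto simp: sets sets_eq_imp_space_eq[OF sets] less_top[symmetric])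
  qed
  have inv: "emeasure swept ((\<lambda>x. x + a) -` A) = emeasure swept A" if A[measurable]: "A \<in> sets borel" for a A
  proof -
    \<comment> \<open>The tangential part of a translation preserves the surface measure, and its
      normal part is a shift of s, which preserves Lebesgue measure on the line.\<close>
    define a' where "a' = a - (a $ 1) *\<^sub>R axis 1 1"
    have a': "a' $ 1 = 0" "a = a' + (a $ 1) *\<^sub>R axis 1 1" by (auto simp: a'_def)
    define F where "F s = emeasure wall_measure (wall \<inter> (\<lambda>x. x + s *\<^sub>R axis 1 1) -` A)" for s :: real
    have "(\<lambda>s. emeasure wall_measure (Pair s -` ((\<lambda>(s, x). x + s *\<^sub>R axis 1 1) -` A \<inter> space line_wall))) \<in> borel_measurable lborel"
      by (rule wall.measurable_emeasure_Pair) measurable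
    also have "(\<lambda>s. emeasure wall_measure (Pair s -` ((\<lambda>(s, x). x + s *\<^sub>R axis 1 1) -` A \<inter> space line_wall))) = F"
      unfolding F_def by (intro ext arg_cong[where f = "emeasure wall_measure"]) (auto simp: space_pair_measure)
    finally have [measurable]: "F \<in> borel_measurable borel" by simp
    have "emeasure swept ((\<lambda>x. x + a) -` A) = (\<integral>\<^sup>+s. F (a $ 1 + s) \<partial>lborel)"
      unfolding em[OF translation_borel(2)[OF A]]
    proof (rule nn_integral_cong)
      fix s :: real
      have "wall \<inter> (\<lambda>x. x + s *\<^sub>R axis 1 1) -` (\<lambda>x. x + a) -` A = wall \<inter> (\<lambda>x. x + a') -` ((\<lambda>x. x + (a $ 1 + s) *\<^sub>R axis 1 1) -` A)"
        by (simp add: a'_def vimage_def algebra_simps)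
      then show "emeasure wall_measure (wall \<inter> (\<lambda>x. x + s *\<^sub>R axis 1 1) -` (\<lambda>x. x + a) -` A) = F (a $ 1 + s)"
        using emeasure_wall_translate[OF translation_borel(2)[OF A] a'(1)] by (simp add: F_def)
    qed
    also have "\<dots> = (\<integral>\<^sup>+s. F s \<partial>distr lborel borel ((+) (a $ 1)))"
      by (subst nn_integral_distr) auto
    also have "\<dots> = emeasure swept A" unfolding lborel_distr_plus em[OF A] F_def ..
    finally show ?thesis .
  qed
  let ?B = "uminus -` cbox 0 One :: (real^3) set"
  have uniq: "emeasure swept A = emeasure swept ?B * emeasure lborel A" if "A \<in> sets borel" for A
    by (rule translation_invariant_measure_unique[OF sets sf inv that])
  obtain r where r: "\<And>x. x \<in> cbox 0 One \<Longrightarrow> norm (x :: real^3) \<le> r" using bounded_cbox[of 0 "One :: real^3"] unfolding bounded_iff by blast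
  obtain n where n: "r \<le> real n" using real_arch_simple by blast
  have "?B \<subseteq> ?Q n"
  proof
    fix x assume "x \<in> ?B"
    then have "norm x \<le> r" using r[of "- x"] by simp
    then show "x \<in> ?Q n" using n by (intro ball) simp
  qed
  then have "emeasure swept ?B \<le> emeasure swept (?Q n)" by (rule emeasure_mono) (simp add: sets)
  then have fin: "emeasure swept ?B < \<infinity>" using finQ[of n] by (rule le_less_trans)
  show ?thesis
  proof (intro exI conjI)
    show "0 \<le> enn2real (emeasure swept ?B)" by simp
    show "swept = density lborel (\<lambda>_. ennreal (enn2real (emeasure swept ?B)))"
    proof (rule measure_eqI)
      fix A assume "A \<in> sets swept"
      then have A: "A \<in> sets borel" using sets by simp
      show "emeasure swept A = emeasure (density lborel (\<lambda>_. ennreal (enn2real (emeasure swept ?B)))) A"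
        using uniq[OF A] fin A by (simp add: emeasure_density_const)
    qed (simp add: sets)
  qed
qed

section \<open>Boundary and initial terms as volume integrals\<close>

lemma FTC_half_line:
  fixes F :: "real \<Rightarrow> real"
  assumes "\<And>t. (F has_real_derivative f t) (at t)" "continuous_on UNIV f"
    and "\<And>t. R < t \<Longrightarrow> f t = 0" "F R = 0" "0 \<le> R"
  shows "(LINT t|lborel. indicator {0<..} t * f t) = - F 0"
proof -
  have "(LINT t|lborel. f t * indicator {0..R} t) = F R - F 0"
    using assms by (intro integral_FTC_Icc_real) (auto simp: continuous_on_eq_continuous_at)
  moreover have "(LINT t|lborel. indicator {0<..} t * f t) = (LINT t|lborel. f t * indicator {0..R} t)"
  proof (rule integral_cong_AE)
    have [measurable]: "f \<in> borel_measurable borel" using assms(2) by (rule borel_measurable_continuous_onI)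
    show "(\<lambda>t. indicator {0<..} t * f t) \<in> borel_measurable lborel" "(\<lambda>t. f t * indicator {0..R} t) \<in> borel_measurable lborel"
      by measurable
    show "AE t in lborel. indicator {0<..} t * f t = f t * indicator {0..R} t"
      using AE_lborel_singleton[of 0] by eventually_elim (use assms(3) in \<open>auto split: split_indicator\<close>)
  qed
  ultimately show ?thesis using assms by simp
qed

lemma lateral_measure_eq: "lateral_measure half_space = time_wall"
  by (simp add: lateral_measure_def frontier_half_space)

interpretation time: finite_measure "lebesgue_on {0<..<1::real}"
  by (rule finite_measureI) (simp add: emeasure_restrict_space)

interpretation time_wall_pair: pair_sigma_finite "lebesgue_on {0<..<1::real}" wall_measure ..

lemma time_wall_measurable:
  "f \<in> borel_measurable borel \<Longrightarrow> f \<in> borel_measurable time_wall"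
proof -
  have 1: "(\<lambda>z. fst z) \<in> time_wall \<rightarrow>\<^sub>M borel"
    by (rule measurable_compose[OF measurable_fst]) (auto intro!: measurable_restrict_space1 measurable_completion)
  have 2: "(\<lambda>z. snd z) \<in> time_wall \<rightarrow>\<^sub>M borel"
    by (rule measurable_compose[OF measurable_snd wall_measurable_id])
  have "(\<lambda>z. (fst z, snd z)) \<in> time_wall \<rightarrow>\<^sub>M borel \<Otimes>\<^sub>M borel"
    using 1 2 by (rule measurable_Pair)
  then show "f \<in> borel_measurable borel \<Longrightarrow> ?thesis"
    unfolding borel_prod by (simp add: measurable_compose)
qed

context C1_compact begin

lemma cont_D_line: "e \<in> Basis \<Longrightarrow> continuous_on UNIV (\<lambda>h. D e (x + h *\<^sub>R v))"
  by (rule continuous_on_compose2[OF contD]) (auto intro!: continuous_intros)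

end

text \<open>On each line normal to the wall, the boundary value of \<phi> is minus the integral of
  its normal derivative over the half line. Integration over the wall then produces the swept
  measure, which is \<open>c\<close> times Lebesgue measure. A surface integral thus becomes a
  volume integral that can be compared with the flux of the field.\<close>

lemma wall_trace:
  obtains c :: real where "0 \<le> c"
    "\<And>\<phi>. C1_compact \<phi> \<Longrightarrow> (LINT z|lateral_measure half_space. \<phi> z) =
       - c * (LINT z|lborel. in_cyl z * frechet_derivative \<phi> (at z) (dir 1))"
proof -
  obtain c where c: "0 \<le> c" "swept = density lborel (\<lambda>_. ennreal c)" using swept_eq by blast
  have "(LINT z|lateral_measure half_space. \<phi> z) =
       - c * (LINT z|lborel. in_cyl z * frechet_derivative \<phi> (at z) (dir 1))" if "C1_compact \<phi>" for \<phi> :: "spacetime \<Rightarrow> real"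
  proof -
    interpret C1_compact \<phi> by fact
    obtain R where R: "\<And>x. R < norm x \<Longrightarrow> \<phi> x = 0" "\<And>x e. R < norm x \<Longrightarrow> D e x = 0" "0 < R" using vanish by metis
    obtain N where N: "\<And>x. \<bar>\<phi> x\<bar> \<le> N" "\<And>e x. e \<in> Basis \<Longrightarrow> \<bar>D e x\<bar> \<le> N" "0 < N" using bounds by metis
    note [measurable] = measD[OF dir_Basis] half_space_borel
    define f where "f t y = indicator half_space y * D (dir 1) (t, y)" for t y
    have f[measurable]: "f t \<in> borel_measurable borel" for t
    proof -
      have "(\<lambda>y. (t, y)) \<in> borel \<rightarrow>\<^sub>M (borel :: (spacetime) measure)"
        by (intro borel_measurable_continuous_onI continuous_intros)
      from measurable_compose[OF this measD[OF dir_Basis]]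
      show ?thesis unfolding f_def by measurable
    qed
    have f_int: "integrable lborel (f t)" for t
    proof (rule integrable_bounded_support[OF f])
      show "\<bar>f t y\<bar> \<le> N" for y using N by (auto simp: f_def dir_Basis split: split_indicator)
      show "f t y = 0" if "R < norm y" for y
        using that norm_snd_le[of y t] by (simp add: f_def R)
    qed
    have line: "(LINT s|lborel. f t (x + s *\<^sub>R axis 1 1)) = - \<phi> (t, x)" if "x \<in> wall" for t x
    proof -
      have "indicator half_space (x + s *\<^sub>R axis 1 1) = (indicator {0<..} s :: real)" for s :: real
        using that by (auto simp: half_space_def wall_def split: split_indicator)
      then have "(LINT s|lborel. f t (x + s *\<^sub>R axis 1 1)) = (LINT s|lborel. indicator {0<..} s * D (dir 1) ((t, x) + s *\<^sub>R dir 1))"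
        by (simp add: f_def dir_def)
      also have "\<dots> = - \<phi> ((t, x) + 0 *\<^sub>R dir 1)"
      proof (rule FTC_half_line[where R = "R + norm x + 1"])
        have big: "R < norm ((t, x) + s *\<^sub>R dir 1)" if "R + norm x + 1 \<le> s" for s
        proof -
          have "0 \<le> s" using that R(3) norm_ge_zero[of x] by linarith
          then have "norm (s *\<^sub>R axis 1 1 :: real^3) = s" by simp
          then have "s - norm x \<le> norm (x + s *\<^sub>R axis 1 1)"
            using norm_diff_ineq[of "s *\<^sub>R axis 1 1" x] by (simp add: add.commute)
          also have "\<dots> \<le> norm ((t, x) + s *\<^sub>R dir 1)"
              by (simp add: dir_def norm_snd_le)
          finally show ?thesis using that by linarith
        qed
        show "((\<lambda>s. \<phi> ((t, x) + s *\<^sub>R dir 1)) has_real_derivative D (dir 1) ((t, x) + s *\<^sub>R dir 1)) (at s)" for s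
          by (rule has_real_derivative_line)
        show "continuous_on UNIV (\<lambda>s. D (dir 1) ((t, x) + s *\<^sub>R dir 1))"
          by (rule cont_D_line[OF dir_Basis])
        show "D (dir 1) ((t, x) + s *\<^sub>R dir 1) = 0" if "R + norm x + 1 < s" for s
          using big[of s] that by (intro R(2)) auto
        show "\<phi> ((t, x) + (R + norm x + 1) *\<^sub>R dir 1) = 0" by (intro R(1) big) auto
        show "0 \<le> R + norm x + 1" using R(3) norm_ge_zero[of x] by linarith
      qed
      finally show ?thesis by simp
    qed
    have slice: "c * (LINT y|lborel. f t y) = - (LINT x|wall_measure. \<phi> (t, x))" for t
    proof -
      have "c * (LINT y|lborel. f t y) = (LINT y|swept. f t y)"
        unfolding c(2) using c(1) by (subst integral_real_density) auto
      also have "\<dots> = (LINT p|line_wall. f t ((\<lambda>(s, x). x + s *\<^sub>R axis 1 1) p))"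
        unfolding swept_def by (rule integral_distr) measurable
      also have "\<dots> = (LINT p|line_wall. (\<lambda>(s, x). f t (x + s *\<^sub>R axis 1 1)) p)"
        by (simp add: case_prod_beta)
      also have "\<dots> = (LINT x|wall_measure. (LINT s|lborel. f t (x + s *\<^sub>R axis 1 1)))"
      proof (rule lborel_wall.integral_snd[symmetric])
        have "integrable swept (f t)" unfolding c(2) using f_int c(1) by (subst integrable_real_density) auto
        then have "integrable line_wall (\<lambda>p. f t ((\<lambda>(s, x). x + s *\<^sub>R axis 1 1) p))"
          unfolding swept_def by (subst (asm) integrable_distr_eq) auto
        then show "integrable line_wall (\<lambda>(s, x). f t (x + s *\<^sub>R axis 1 1))"
          by (simp add: case_prod_beta')
      qed
      also have "\<dots> = (LINT x|wall_measure. - \<phi> (t, x))"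
        by (intro Bochner_Integration.integral_cong refl line) simp
      finally show ?thesis by simp
    qed
    obtain n where n: "R \<le> real n" using real_arch_simple by blast
    have I: "{0<..<1} \<in> sets (lebesgue_on {0<..<1::real})"
      using sets.top[of "lebesgue_on {0<..<1::real}"] by simp
    have "integrable time_wall \<phi>"
    proof (rule Bochner_Integration.integrable_bound)
      let ?S = "{0<..<1::real} \<times> wall_square n"
      have S: "?S \<in> sets time_wall"
        by (rule pair_measureI[OF I wall_square_sets])
      have "emeasure time_wall ?S = emeasure (lebesgue_on {0<..<1::real}) {0<..<1} * emeasure wall_measure (wall_square n)"
        by (rule wall.emeasure_pair_measure_Times[OF I wall_square_sets])
      also have "\<dots> < \<infinity>" using wall_square_finite[of n]
        by (simp add: ennreal_mult_less_top emeasure_restrict_space)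
      finally show "integrable time_wall (\<lambda>z. N * indicator ?S z :: real)"
        using S by (simp add: integrable_real_mult_indicator)
      show "\<phi> \<in> borel_measurable time_wall"
        by (rule time_wall_measurable[OF meas])
      show "AE z in time_wall. norm (\<phi> z) \<le> norm (N * indicator ?S z)"
      proof (rule AE_I2)
        fix z assume "z \<in> space time_wall"
        then have z: "fst z \<in> {0<..<1}" "snd z \<in> wall" by (auto simp: space_pair_measure)
        show "norm (\<phi> z) \<le> norm (N * indicator ?S z)"
        proof (cases "norm z \<le> R")
          case True
          then have "norm (snd z) \<le> real n" using norm_snd_le[of "snd z" "fst z"] n by simp
          then have "z \<in> ?S" using z wall_square_covers[of "snd z" n] by (cases z) auto
          then show ?thesis using N(1)[of z] by simp
        qed (simp add: R)
      qed
    qed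
    then have "(LINT z|lateral_measure half_space. \<phi> z) = (LINT t|lebesgue_on {0<..<1}. (LINT x|wall_measure. \<phi> (t, x)))"
      unfolding lateral_measure_eq by (rule time_wall_pair.integral_fst'[symmetric])
    also have "\<dots> = (LINT t|lebesgue_on {0<..<1}. - c * (LINT y|lborel. f t y))"
      using slice by simp
    also have "\<dots> = - c * (LINT t|lebesgue_on {0<..<1}. (LINT y|lborel. f t y))" by simp
    also have "(LINT t|lebesgue_on {0<..<1}. (LINT y|lborel. f t y)) = (LINT t|lborel. indicator {0<..<1} t * (LINT y|lborel. f t y))"
    proof -
      have "(\<lambda>p. indicator half_space (snd p) * D (dir 1) p) \<in> borel_measurable (lborel \<Otimes>\<^sub>M lborel)"
      proof (rule borel_measurable_times)
        show "(\<lambda>p. indicator half_space (snd p)) \<in> borel_measurable ((lborel :: real measure) \<Otimes>\<^sub>M lborel)" by measurable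
        show "D (dir 1) \<in> borel_measurable (lborel \<Otimes>\<^sub>M lborel)" unfolding lborel_prod using measD[OF dir_Basis] by simp
      qed
      then have "(\<lambda>p. f (fst p) (snd p)) \<in> borel_measurable (lborel \<Otimes>\<^sub>M lborel)"
        by (simp add: f_def)
      then have [measurable]: "(\<lambda>t. LINT y|lborel. f t y) \<in> borel_measurable borel"
        using lborel.borel_measurable_lebesgue_integral[of "\<lambda>t y. f t y" lborel] by (simp add: case_prod_beta')
      show ?thesis
        by (subst integral_restrict_space) (auto simp: integral_completion)
    qed
    also have "\<dots> = (LINT t|lborel. (LINT y|lborel. indicator {0<..<1} t * f t y))" by simp
    also have "\<dots> = (LINT z|(lborel \<Otimes>\<^sub>M lborel). in_cyl z * D (dir 1) z)"
    proof -
      have e: "indicator {0<..<1} t * f t y = in_cyl (t, y) * D (dir 1) (t, y)" for t y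
        by (auto simp: f_def in_cyl_def half_space_def split: split_indicator)
      have "integrable lborel (\<lambda>z. in_cyl z * D (dir 1) z)"
        by (rule integrable_mult_D[OF measurable_in_cyl _ dir_Basis, of 1]) (simp add: in_cyl_def)
      then show ?thesis unfolding e by (intro lborel_pair.integral_fst') (simp add: lborel_prod)
    qed
    finally show ?thesis by (simp add: lborel_prod)
  qed
  then show thesis using that c(1) by blast
qed

lemma initial_trace:
  assumes "C1_compact \<phi>" and van: "\<And>t x. 1 \<le> t \<Longrightarrow> \<phi> (t, x) = 0" "\<And>t x e. 1 \<le> t \<Longrightarrow> frechet_derivative \<phi> (at (t, x)) e = 0"
  shows "(LINT z|lborel. in_cyl z * frechet_derivative \<phi> (at z) (1, 0)) = - (LINT x|lborel. indicator half_space x * \<phi> (0, x))"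
proof -
  interpret C1_compact \<phi> by fact
  have B: "(1::real, 0::real^3) \<in> Basis" by (simp add: Basis_prod_def)
  have int: "integrable lborel (\<lambda>z. in_cyl z * D (1, 0) z)"
    by (rule integrable_mult_D[OF measurable_in_cyl _ B, of 1]) (simp add: in_cyl_def)
  have "(LINT z|lborel. in_cyl z * D (1, 0) z) = (LINT z|(lborel \<Otimes>\<^sub>M lborel). (\<lambda>(t, x). in_cyl (t, x) * D (1, 0) (t, x)) z)"
    by (simp add: lborel_prod)
  also have "\<dots> = (LINT x|lborel. (LINT t|lborel. in_cyl (t, x) * D (1, 0) (t, x)))"
    by (rule lborel_pair.integral_snd[symmetric]) (use int in \<open>simp add: lborel_prod case_prod_beta'\<close>)
  also have "\<dots> = (LINT x|lborel. indicator half_space x * - \<phi> (0, x))"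
  proof (rule Bochner_Integration.integral_cong[OF refl])
    fix x
    have "(LINT t|lborel. in_cyl (t, x) * D (1, 0) (t, x)) = (LINT t|lborel. indicator half_space x * (indicator {0<..} t * D (1, 0) (t, x)))"
      by (intro Bochner_Integration.integral_cong refl)
        (auto simp: in_cyl_def half_space_def van not_less split: split_indicator)
    also have "\<dots> = indicator half_space x * (LINT t|lborel. indicator {0<..} t * D (1, 0) ((0, x) + t *\<^sub>R (1, 0)))" by simp
    also have "(LINT t|lborel. indicator {0<..} t * D (1, 0) ((0, x) + t *\<^sub>R (1, 0))) = - \<phi> ((0, x) + 0 *\<^sub>R (1, 0))"
      by (rule FTC_half_line[where R = 1, OF has_real_derivative_line cont_D_line[OF B]]) (auto simp: van)
    finally show "(LINT t|lborel. in_cyl (t, x) * D (1, 0) (t, x)) = indicator half_space x * - \<phi> (0, x)" by simp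
  qed
  finally show ?thesis by simp
qed

section \<open>The field and the solutions\<close>

text \<open>From the second power on, the positive part is of class C^1, so one formula covers the
  point 0 as well. This is the reason for the square in the solution.\<close>

lemma DERIV_pos_power:
  "((\<lambda>r::real. max 0 r ^ Suc (Suc n)) has_real_derivative real (Suc (Suc n)) * max 0 r ^ Suc n) (at r)"
proof -
  consider "r < 0" | "r = 0" | "r > 0" by linarith
  then show ?thesis
  proof cases
    case 1
    have "((\<lambda>r::real. 0) has_real_derivative real (Suc (Suc n)) * max 0 r ^ Suc n) (at r)" using 1 by simp
    then show ?thesis
      by (rule has_field_derivative_transform_within_open[of _ _ _ "{..<0}"]) (use 1 in auto)
  next
    case 2
    have "((\<lambda>h::real. max 0 h ^ Suc (Suc n) / h) \<longlongrightarrow> 0) (at 0)"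
    proof (rule Lim_null_comparison)
      show "\<forall>\<^sub>F h in at 0. norm (max 0 h ^ Suc (Suc n) / h) \<le> \<bar>h\<bar> ^ Suc n"
      proof (intro always_eventually allI)
        fix h :: real
        show "norm (max 0 h ^ Suc (Suc n) / h) \<le> \<bar>h\<bar> ^ Suc n"
        proof (cases "0 < h")
          case False
          then have "norm (max 0 h ^ Suc (Suc n) / h) = 0" by simp
          also have "0 \<le> \<bar>h\<bar> ^ Suc n" by (intro zero_le_power abs_ge_zero)
          finally show ?thesis .
        qed (simp add: max_def)
      qed
      show "((\<lambda>h::real. \<bar>h\<bar> ^ Suc n) \<longlongrightarrow> 0) (at 0)"
        by (rule tendsto_eq_intros refl | simp)+
    qed
    then show ?thesis using 2 by (simp add: has_field_derivative_iff)
  next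
    case 3
    have "((\<lambda>r::real. r ^ Suc (Suc n)) has_real_derivative real (Suc (Suc n)) * max 0 r ^ Suc n) (at r)"
      using DERIV_pow[of "Suc (Suc n)" r] 3 by (simp add: max_def del: power_Suc)
    then show ?thesis
      by (rule has_field_derivative_transform_within_open[of _ _ _ "{0<..}"]) (use 3 in auto)
  qed
qed

lemma DERIV_pos_power_chain:
  assumes "(X has_real_derivative X') (at x within S)"
  shows "((\<lambda>h. max 0 (X h) ^ Suc (Suc n)) has_real_derivative real (Suc (Suc n)) * max 0 (X x) ^ Suc n * X') (at x within S)"
  using DERIV_chain2[OF DERIV_pos_power assms] .

section \<open>Elementary estimates and the cosine profile\<close>

lemma abs_mult_le: "\<bar>a::real\<bar> \<le> x \<Longrightarrow> \<bar>b\<bar> \<le> y \<Longrightarrow> \<bar>a * b\<bar> \<le> x * y"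
  by (simp add: abs_mult mult_mono')

lemma abs_add_le: "\<bar>a::real\<bar> \<le> x \<Longrightarrow> \<bar>b\<bar> \<le> y \<Longrightarrow> \<bar>a + b\<bar> \<le> x + y"
  by linarith

lemma DERIV_bound_lipschitz:
  fixes F :: "real \<Rightarrow> real"
  assumes "\<And>x. x \<in> S \<Longrightarrow> (F has_real_derivative F' x) (at x)" "\<And>x. x \<in> S \<Longrightarrow> \<bar>F' x\<bar> \<le> L"
    "convex S" "x \<in> S" "y \<in> S"
  shows "\<bar>F x - F y\<bar> \<le> L * \<bar>x - y\<bar>"
  using field_differentiable_bound[of S F F' L x y] assms
  by (auto intro: has_field_derivative_at_within)

lemma cos_2pi_periodic: "cos (2 * pi * (p + of_int m)) = cos (2 * pi * p)"
  and sin_2pi_periodic: "sin (2 * pi * (p + of_int m)) = sin (2 * pi * p)"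
  by (simp_all add: distrib_left cos_add sin_add cos_int_2pin sin_int_2pin)

lemma DERIV_cos_2pi: "((\<lambda>h. cos (2 * pi * (p + a * h))) has_real_derivative a * (- (2 * pi * sin (2 * pi * (p + a * x))))) (at x within S)"
  and DERIV_sin_2pi: "((\<lambda>h. sin (2 * pi * (p + a * h))) has_real_derivative a * (2 * pi * cos (2 * pi * (p + a * x)))) (at x within S)"
  by (auto intro!: derivative_eq_intros)

lemma cos_2pi_lipschitz: "\<bar>cos (2 * pi * p) - cos (2 * pi * q)\<bar> \<le> 2 * pi * \<bar>p - q\<bar>"
  and sin_2pi_lipschitz: "\<bar>sin (2 * pi * p) - sin (2 * pi * q)\<bar> \<le> 2 * pi * \<bar>p - q\<bar>"
proof -
  show "\<bar>cos (2 * pi * p) - cos (2 * pi * q)\<bar> \<le> 2 * pi * \<bar>p - q\<bar>"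
    by (rule DERIV_bound_lipschitz[of UNIV _ "\<lambda>x. - (2 * pi * sin (2 * pi * x))"])
      (auto intro!: derivative_eq_intros simp: abs_mult)
  show "\<bar>sin (2 * pi * p) - sin (2 * pi * q)\<bar> \<le> 2 * pi * \<bar>p - q\<bar>"
    by (rule DERIV_bound_lipschitz[of UNIV _ "\<lambda>x. 2 * pi * cos (2 * pi * x)"])
      (auto intro!: derivative_eq_intros simp: abs_mult)
qed

text \<open>A profile independent of t and s. For it, \<open>transport\<close> states that
  cos(2\<pi>p) (1, vel) is divergence free and has no flux through the wall, even against test
  functions that do not vanish there.\<close>

interpretation cosine: profile "\<lambda>t s p. cos (2 * pi * p)" "\<lambda>t s p. 0" "\<lambda>t s p. - (2 * pi * sin (2 * pi * p))"
  "\<lambda>t s p. sin (2 * pi * p) / (2 * pi)" 1 "2 * pi"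
proof
  show "(\<lambda>(t::real, s::real, p). cos (2 * pi * p)) \<in> borel_measurable borel"
    "(\<lambda>(t::real, s::real, p). sin (2 * pi * p) / (2 * pi)) \<in> borel_measurable borel"
    by (auto intro!: borel_measurable_continuous_onI continuous_intros simp: case_prod_beta')
  have pi: "1 \<le> 2 * pi" using pi_ge_two by linarith
  show "\<bar>sin (2 * pi * p) / (2 * pi)\<bar> \<le> 1" for p
    using pi order_trans[OF abs_sin_le_one pi, of "2 * pi * p"] by (simp add: abs_divide divide_le_eq)
  show "\<bar>sin (2 * pi * p) / (2 * pi) - sin (2 * pi * p') / (2 * pi)\<bar> \<le> 2 * pi * \<bar>p - p'\<bar>" for p p'
  proof -
    have "\<bar>sin (2 * pi * p) / (2 * pi) - sin (2 * pi * p') / (2 * pi)\<bar> = \<bar>sin (2 * pi * p) - sin (2 * pi * p')\<bar> / (2 * pi)"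
      by (simp add: diff_divide_distrib[symmetric] abs_divide)
    also have "\<dots> \<le> \<bar>p - p'\<bar>" using sin_2pi_lipschitz[of p p'] by (simp add: pos_divide_le_eq ac_simps)
    also have "\<dots> \<le> 2 * pi * \<bar>p - p'\<bar>" using mult_right_mono[OF pi, of "\<bar>p - p'\<bar>"] by simp
    finally show ?thesis .
  qed
  show "\<bar>cos (2 * pi * p) - cos (2 * pi * p')\<bar> \<le> 2 * pi * (\<bar>s - s'\<bar> + \<bar>p - p'\<bar>)" for p p' s s' :: real
  proof -
    have "2 * pi * \<bar>p - p'\<bar> \<le> 2 * pi * (\<bar>s - s'\<bar> + \<bar>p - p'\<bar>)" by (intro mult_left_mono) auto
    then show ?thesis using cos_2pi_lipschitz[of p p'] by linarith
  qed
  show "((\<lambda>h. cos (2 * pi * (p + a * h))) has_real_derivative 0 + a * - (2 * pi * sin (2 * pi * p))) (at_right 0)" for p a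
    using DERIV_cos_2pi[of p a 0] by simp
  show "((\<lambda>h. cos (2 * pi * (p + a * h))) has_real_derivative a * - (2 * pi * sin (2 * pi * p))) (at_right 0)" for p a
    using DERIV_cos_2pi[of p a 0] by simp
  show "((\<lambda>h. sin (2 * pi * (p + a * h)) / (2 * pi)) has_real_derivative a * cos (2 * pi * p)) (at_right 0)" for p a
    using DERIV_cdivide[OF DERIV_sin_2pi[of p a 0 "{0<..}"], of "2 * pi"] by simp
qed (auto simp: cos_2pi_periodic sin_2pi_periodic)

text \<open>The mean over a period is -c, which turns into the outward flux. The amplitude 2 (c + 1)
  exceeds c, so that inflow occurs, and it makes the height equal to 1 at p = 1/6 for every
  c.\<close>

definition height :: "real \<Rightarrow> real \<Rightarrow> real" where
  "height c p = 2 * (c + 1) * cos (2 * pi * p) - c"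

lemma height_periodic: "height c (p + of_int m) = height c p"
  by (simp add: height_def cos_2pi_periodic)

lemma height_bound: "0 \<le> c \<Longrightarrow> \<bar>height c p\<bar> \<le> 3 * c + 2"
proof -
  assume c: "0 \<le> c"
  have "\<bar>2 * (c + 1) * cos (2 * pi * p)\<bar> \<le> 2 * (c + 1) * 1"
    unfolding abs_mult using c by (intro mult_mono) auto
  then show ?thesis using c by (simp add: height_def)
qed

lemma DERIV_height: "((\<lambda>h. height c (p + a * h)) has_real_derivative a * (- (4 * pi * (c + 1) * sin (2 * pi * (p + a * x))))) (at x within S)"
  unfolding height_def by (auto intro!: derivative_eq_intros)

lemma continuous_height [continuous_intros]:
  fixes f :: "'a::t2_space \<Rightarrow> real"
  shows "continuous_on S f \<Longrightarrow> continuous_on S (\<lambda>x. height c (f x))"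
  unfolding height_def by (intro continuous_intros)

text \<open>At time t, a particle of phase p that left the wall at time 0 with positive speed
  \<open>height c p\<close> is at depth \<open>height c p * t\<close>. The excess is its lead over
  depth s.\<close>

definition excess :: "real \<Rightarrow> real \<Rightarrow> real \<Rightarrow> real \<Rightarrow> real" where
  "excess c t s p = max 0 (height c p * t - s)"

lemma excess_bounds:
  assumes "0 \<le> c" "0 \<le> t" "t \<le> 1" "0 \<le> s"
  shows "0 \<le> excess c t s p" "excess c t s p \<le> (3 * c + 2) * t" "excess c t s p \<le> 3 * c + 2"
proof -
  show "0 \<le> excess c t s p" by (simp add: excess_def)
  have "height c p * t \<le> (3 * c + 2) * t" using height_bound[OF assms(1), of p] assms by (intro mult_right_mono) auto
  then show 1: "excess c t s p \<le> (3 * c + 2) * t" using assms by (simp add: excess_def)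
  have "(3 * c + 2) * t \<le> (3 * c + 2) * 1" using assms by (intro mult_left_mono) auto
  from order_trans[OF 1 this] show "excess c t s p \<le> 3 * c + 2" by simp
qed

text \<open>With \<open>h\<close> the height, \<open>K = sin (2\<pi>p) (h t - s)\<^sub>+\<^sup>2\<close> solves \<open>\<partial>\<^sub>t K + h \<partial>\<^sub>s K = 0\<close>. Since \<open>h K\<close> is
  \<open>h'\<close> times a function of \<open>h\<close>, it has a periodic antiderivative, the last function below: this
  is why the flux of \<open>b u\<close> through the wall vanishes.\<close>

definition flux_profile :: "real \<Rightarrow> real \<Rightarrow> real \<Rightarrow> real \<Rightarrow> real" where
  "flux_profile c t s p = height c p * sin (2 * pi * p) * excess c t s p ^ 2"

definition flux_profile_s :: "real \<Rightarrow> real \<Rightarrow> real \<Rightarrow> real \<Rightarrow> real" where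
  "flux_profile_s c t s p = - (height c p * sin (2 * pi * p) * (2 * excess c t s p))"

definition flux_profile_p :: "real \<Rightarrow> real \<Rightarrow> real \<Rightarrow> real \<Rightarrow> real" where
  "flux_profile_p c t s p = - (4 * pi * (c + 1) * sin (2 * pi * p)) * sin (2 * pi * p) * excess c t s p ^ 2
     + height c p * (2 * pi * cos (2 * pi * p)) * excess c t s p ^ 2
     + height c p * sin (2 * pi * p) * (2 * excess c t s p * (- (4 * pi * (c + 1) * sin (2 * pi * p)) * t))"

definition flux_antiderivative :: "real \<Rightarrow> real \<Rightarrow> real \<Rightarrow> real \<Rightarrow> real" where
  "flux_antiderivative c t s p = - (1 / (4 * pi * (c + 1))) *
     (height c p * excess c t s p ^ 3 / (3 * t) - excess c t s p ^ 4 / (12 * t ^ 2))"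

lemma DERIV_excess_power:
  "((\<lambda>h. excess c t (s + d * h) (p + a * h) ^ Suc (Suc n)) has_real_derivative
     real (Suc (Suc n)) * excess c t (s + d * x) (p + a * x) ^ Suc n *
       (a * (- (4 * pi * (c + 1) * sin (2 * pi * (p + a * x)))) * t - d)) (at x within S)"
  unfolding excess_def
  by (rule DERIV_pos_power_chain) (auto intro!: derivative_eq_intros DERIV_height)

lemma DERIV_flux_profile:
  "((\<lambda>h. flux_profile c t (s + d * h) (p + a * h)) has_real_derivative
     d * flux_profile_s c t (s + d * x) (p + a * x) + a * flux_profile_p c t (s + d * x) (p + a * x)) (at x within S)"
proof -
  have 2: "((\<lambda>h. excess c t (s + d * h) (p + a * h) ^ 2) has_real_derivative
     2 * excess c t (s + d * x) (p + a * x) * (a * (- (4 * pi * (c + 1) * sin (2 * pi * (p + a * x)))) * t - d)) (at x within S)"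
    using DERIV_excess_power[of c t s d p a 0 x S] by (simp add: numeral_2_eq_2)
  show ?thesis
    unfolding flux_profile_def
    by (rule DERIV_cong[OF DERIV_mult[OF DERIV_mult[OF DERIV_height DERIV_sin_2pi] 2]])
      (simp add: flux_profile_s_def flux_profile_p_def algebra_simps power2_eq_square)
qed

lemma DERIV_flux_antiderivative:
  assumes "0 < t" "0 \<le> c"
  shows "((\<lambda>h. flux_antiderivative c t s (p + a * h)) has_real_derivative a * flux_profile c t s (p + a * x)) (at x within S)"
proof -
  let ?e = "excess c t s (p + a * x)" and ?h = "height c (p + a * x)"
  let ?h' = "a * (- (4 * pi * (c + 1) * sin (2 * pi * (p + a * x))))"
  have 3: "((\<lambda>h. excess c t s (p + a * h) ^ 3) has_real_derivative 3 * ?e ^ 2 * (?h' * t)) (at x within S)"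
    using DERIV_excess_power[of c t s 0 p a 1 x S] by (simp add: numeral_3_eq_3 numeral_2_eq_2)
  have 4: "((\<lambda>h. excess c t s (p + a * h) ^ 4) has_real_derivative 4 * ?e ^ 3 * (?h' * t)) (at x within S)"
    using DERIV_excess_power[of c t s 0 p a 2 x S] by (simp add: eval_nat_numeral)
  have k: "4 * pi * (c + 1) \<noteq> 0" using assms by simp
  define k where "k = 4 * pi * (c + 1)"
  have "((\<lambda>h. flux_antiderivative c t s (p + a * h)) has_real_derivative
    - (1 / k) * ((?h' * ?e ^ 3 + 3 * ?e ^ 2 * (?h' * t) * ?h) / (3 * t) - 4 * ?e ^ 3 * (?h' * t) / (12 * t ^ 2))) (at x within S)"
    unfolding flux_antiderivative_def k_def
    by (intro DERIV_cmult DERIV_diff DERIV_cdivide DERIV_mult DERIV_height 3 4)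
  also have "- (1 / k) * ((?h' * ?e ^ 3 + 3 * ?e ^ 2 * (?h' * t) * ?h) / (3 * t) - 4 * ?e ^ 3 * (?h' * t) / (12 * t ^ 2)) =
     - (1 / k) * (?h' * ?e ^ 2 * ?h)"
  proof -
    \<comment> \<open>With e = h t - s, this checks the result of integrating h e^2 by parts with
      respect to h. The factor - 1/k comes from the substitution dh = - k sin(2\<pi>p) dp.\<close>
    have "(d * e ^ 3 + 3 * e ^ 2 * (d * t) * h) / (3 * t) - 4 * e ^ 3 * (d * t) / (12 * t ^ 2) = d * e ^ 2 * h" for d e h :: real
      using assms(1) by (simp add: field_simps power2_eq_square power3_eq_cube)
    then show ?thesis by (simp only:)
  qed
  also have "\<dots> = a * flux_profile c t s (p + a * x)"
    using k unfolding k_def[symmetric] flux_profile_def by (simp add: ac_simps)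
  finally show ?thesis .
qed

text \<open>The bounds are left unevaluated, with one factor for each factor of the formula: only
  their existence and their independence of t, s and p matter.\<close>

lemma flux_profile_bounds:
  assumes c: "0 \<le> c" and t: "0 < t" "t < 1" and s: "0 < s"
  defines "B \<equiv> 3 * c + 2"
  shows "\<bar>flux_profile c t s p\<bar> \<le> B * 1 * (B * B)"
    and "\<bar>flux_profile_s c t s p\<bar> \<le> B * 1 * (2 * B)"
    and "\<bar>flux_profile_p c t s p\<bar> \<le> 4 * pi * (c + 1) * 1 * 1 * (B * B) + B * (2 * pi * 1) * (B * B) + B * 1 * (2 * B * (4 * pi * (c + 1) * 1 * 1))"
    and "\<bar>flux_antiderivative c t s p\<bar> \<le> 1 * (B * (B * (B * B)) + B * (B * (B * B)))"
proof -
  let ?e = "excess c t s p" and ?k = "4 * pi * (c + 1)"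
  have e: "\<bar>?e\<bar> \<le> B" "0 \<le> ?e" "?e \<le> B * t" using excess_bounds[of c t s p] assms by auto
  have h: "\<bar>height c p\<bar> \<le> B" unfolding B_def by (rule height_bound[OF c])
  have B0: "0 \<le> B" using c by (simp add: B_def)
  have k: "\<bar>?k\<bar> \<le> ?k" "1 \<le> ?k"
  proof -
    show "\<bar>?k\<bar> \<le> ?k" using c by simp
    have "1 * 1 \<le> (4 * pi) * (c + 1)" using pi_ge_two c by (intro mult_mono) auto
    then show "1 \<le> ?k" by simp
  qed
  have sn: "\<bar>sin (2 * pi * p)\<bar> \<le> 1" "\<bar>cos (2 * pi * p)\<bar> \<le> 1" "\<bar>t\<bar> \<le> 1" "\<bar>2 :: real\<bar> \<le> 2" "\<bar>2 * pi\<bar> \<le> 2 * pi"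
    using t by auto
  have mk: "\<bar>- (?k * sin (2 * pi * p))\<bar> \<le> ?k * 1" unfolding abs_minus_cancel by (intro abs_mult_le k sn)
  show "\<bar>flux_profile c t s p\<bar> \<le> B * 1 * (B * B)"
    unfolding flux_profile_def power2_eq_square by (intro abs_mult_le h sn e)
  show "\<bar>flux_profile_s c t s p\<bar> \<le> B * 1 * (2 * B)"
    unfolding flux_profile_s_def abs_minus_cancel by (intro abs_mult_le h sn e)
  show "\<bar>flux_profile_p c t s p\<bar> \<le> ?k * 1 * 1 * (B * B) + B * (2 * pi * 1) * (B * B) + B * 1 * (2 * B * (?k * 1 * 1))"
    unfolding flux_profile_p_def power2_eq_square by (intro abs_add_le abs_mult_le h sn e mk)
  \<comment> \<open>The denominators t and t^2 of the antiderivative are harmless: entering mass has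
    had only the time t to advance, so the excess is at most B t.\<close>
  have et: "\<bar>?e / t\<bar> \<le> B" using e t by (simp add: abs_divide pos_divide_le_eq)
  have "\<bar>height c p * ?e ^ 3 / (3 * t)\<bar> \<le> B * (B * (B * B))"
  proof -
    have "height c p * ?e ^ 3 / (3 * t) = (height c p * (?e / t * (?e * ?e))) * (1 / 3)" by (simp add: power3_eq_cube)
    also have "\<bar>\<dots>\<bar> \<le> (B * (B * (B * B))) * 1" by (intro abs_mult_le h et e) auto
    finally show ?thesis by simp
  qed
  moreover have "\<bar>- (?e ^ 4 / (12 * t ^ 2))\<bar> \<le> B * (B * (B * B))"
  proof -
    have "?e ^ 4 / (12 * t ^ 2) = (?e / t * (?e / t * (?e * ?e))) * (1 / 12)" by (simp add: eval_nat_numeral)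
    also have "\<bar>\<dots>\<bar> \<le> (B * (B * (B * B))) * 1" by (intro abs_mult_le et e) auto
    finally show ?thesis by simp
  qed
  moreover have "\<bar>- (1 / ?k)\<bar> \<le> 1" using k by (simp add: abs_divide)
  ultimately show "\<bar>flux_antiderivative c t s p\<bar> \<le> 1 * (B * (B * (B * B)) + B * (B * (B * B)))"
    unfolding flux_antiderivative_def diff_conv_add_uminus by (intro abs_mult_le abs_add_le)
qed

lemma flux_profile_profile:
  assumes c: "0 \<le> c"
  shows "\<exists>M L. profile (flux_profile c) (flux_profile_s c) (flux_profile_p c) (flux_antiderivative c) M L"
proof -
  define B where "B = 3 * c + 2"
  define k where "k = 4 * pi * (c + 1)"
  have B0: "0 \<le> B" using c by (simp add: B_def)
  have k0: "0 \<le> k" using c by (simp add: k_def)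
  define M1 where "M1 = B * 1 * (B * B)"
  define M2 where "M2 = B * 1 * (2 * B)"
  define M3 where "M3 = k * 1 * 1 * (B * B) + B * (2 * pi * 1) * (B * B) + B * 1 * (2 * B * (k * 1 * 1))"
  define M4 where "M4 = 1 * (B * (B * (B * B)) + B * (B * (B * B)))"
  have M0: "0 \<le> M1" "0 \<le> M2" "0 \<le> M3" "0 \<le> M4" using B0 k0 by (auto simp: M1_def M2_def M3_def M4_def)
  note bnd = flux_profile_bounds[OF c, folded B_def k_def, folded M1_def M2_def M3_def M4_def]
  \<comment> \<open>The Lipschitz constants are bounds of derivatives: M2 for the flux profile in s,
    M3 for it in p, and M1 for its antiderivative in p.\<close>
  let ?M = "M1 + M2 + M4" and ?L = "M1 + M2 + M3"
  have "profile (flux_profile c) (flux_profile_s c) (flux_profile_p c) (flux_antiderivative c) ?M ?L"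
  proof
    show "(\<lambda>(t, s, p). flux_profile c t s p) \<in> borel_measurable borel"
      "(\<lambda>(t, s, p). flux_profile_s c t s p) \<in> borel_measurable borel"
      unfolding flux_profile_def flux_profile_s_def excess_def
      by (auto intro!: borel_measurable_continuous_onI continuous_intros simp: case_prod_beta')
    show "(\<lambda>(t, s, p). flux_antiderivative c t s p) \<in> borel_measurable borel"
      unfolding flux_antiderivative_def excess_def height_def borel_prod[symmetric] by measurable
    fix t s p s' p' a :: real and m :: int
    show "flux_profile c t s (p + of_int m) = flux_profile c t s p"
      "flux_antiderivative c t s (p + of_int m) = flux_antiderivative c t s p"
      by (simp_all add: flux_profile_def flux_antiderivative_def excess_def height_periodic sin_2pi_periodic)
    assume t: "0 < t" "t < 1" and s: "0 < s"
    show "\<bar>flux_profile c t s p\<bar> \<le> ?M" using bnd(1)[OF t s, of p] M0 by linarith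
    show "\<bar>flux_profile_s c t s p\<bar> \<le> ?M" using bnd(2)[OF t s, of p] M0 by linarith
    show "\<bar>flux_antiderivative c t s p\<bar> \<le> ?M" using bnd(4)[OF t s, of p] M0 by linarith
    show "((\<lambda>h. flux_profile c t (s + h) (p + a * h)) has_real_derivative flux_profile_s c t s p + a * flux_profile_p c t s p) (at_right 0)"
      using DERIV_flux_profile[of c t s 1 p a 0] by simp
    show "((\<lambda>h. flux_profile c t s (p + a * h)) has_real_derivative a * flux_profile_p c t s p) (at_right 0)"
      using DERIV_flux_profile[of c t s 0 p a 0] by simp
    show "((\<lambda>h. flux_antiderivative c t s (p + a * h)) has_real_derivative a * flux_profile c t s p) (at_right 0)"
      using DERIV_flux_antiderivative[OF t(1) c, of s p a 0] by simp
    have "\<bar>flux_antiderivative c t s p - flux_antiderivative c t s p'\<bar> \<le> M1 * \<bar>p - p'\<bar>"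
      using DERIV_flux_antiderivative[OF t(1) c, of s 0 1] bnd(1)[OF t s]
      by (intro DERIV_bound_lipschitz[of UNIV _ "flux_profile c t s"]) auto
    moreover have "M1 * \<bar>p - p'\<bar> \<le> ?L * \<bar>p - p'\<bar>" using M0 by (intro mult_right_mono) auto
    ultimately show "\<bar>flux_antiderivative c t s p - flux_antiderivative c t s p'\<bar> \<le> ?L * \<bar>p - p'\<bar>" by linarith
    assume s': "0 < s'"
    have "\<bar>flux_profile c t s p - flux_profile c t s' p\<bar> \<le> M2 * \<bar>s - s'\<bar>"
      using DERIV_flux_profile[of c t 0 1 p 0] bnd(2)[OF t] s s'
      by (intro DERIV_bound_lipschitz[of "{0<..}" _ "\<lambda>s. flux_profile_s c t s p"]) auto
    moreover have "\<bar>flux_profile c t s' p - flux_profile c t s' p'\<bar> \<le> M3 * \<bar>p - p'\<bar>"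
      using DERIV_flux_profile[of c t s' 0 0 1] bnd(3)[OF t s']
      by (intro DERIV_bound_lipschitz[of UNIV _ "flux_profile_p c t s'"]) auto
    moreover have "M2 * \<bar>s - s'\<bar> \<le> ?L * \<bar>s - s'\<bar>" "M3 * \<bar>p - p'\<bar> \<le> ?L * \<bar>p - p'\<bar>"
      using M0 by (auto intro!: mult_right_mono)
    ultimately show "\<bar>flux_profile c t s p - flux_profile c t s' p'\<bar> \<le> ?L * (\<bar>s - s'\<bar> + \<bar>p - p'\<bar>)"
      unfolding distrib_left by linarith
  qed
  then show ?thesis by blast
qed

definition field :: "real \<Rightarrow> spacetime \<Rightarrow> real^3" where
  "field c z = height c (phase (snd z)) *\<^sub>R (axis 1 1 + vel (snd z))"

text \<open>Clamping the time makes the function bounded and Lipschitz in t on the whole line, as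
  integration by parts over all of space-time requires. For t \<le> 0 it vanishes by itself, and for
  t \<ge> 1 it only meets test functions that are 0.\<close>

definition sol :: "real \<Rightarrow> spacetime \<Rightarrow> real" where
  "sol c z = of_bool (0 < snd z $ 1) * (sin (2 * pi * phase (snd z)) *
     excess c (max 0 (min 1 (fst z))) (snd z $ 1) (phase (snd z)) ^ 2)"

lemma measurable_height [measurable]: "height c \<in> borel_measurable borel"
  unfolding height_def by measurable

lemma measurable_field [measurable]: "field c \<in> borel_measurable borel"
  unfolding field_def borel_prod[symmetric] by measurable

lemma measurable_sol [measurable]: "sol c \<in> borel_measurable borel"
  unfolding sol_def excess_def borel_prod[symmetric] by measurable

lemma sol_bound: assumes c: "0 \<le> c" shows "\<bar>sol c z\<bar> \<le> 1 * ((3 * c + 2) * (3 * c + 2))"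
proof (cases "0 < snd z $ 1")
  case True
  have e: "\<bar>excess c (max 0 (min 1 (fst z))) (snd z $ 1) p\<bar> \<le> 3 * c + 2" for p
    using excess_bounds[OF c, of "max 0 (min 1 (fst z))" "snd z $ 1" p] True by auto
  show ?thesis unfolding sol_def power2_eq_square using True
    by (simp only: of_bool_eq mult_1) (intro abs_mult_le[where x = 1, simplified mult_1] abs_mult_le e; simp)
qed (use c in \<open>simp add: sol_def\<close>)

lemma vel_bound: "\<bar>vel x $ i\<bar> \<le> 1"
proof -
  have "\<bar>saw k x * (axis (along k) 1 $ i)\<bar> \<le> 1 * 1" for k
    by (intro abs_mult_le saw_bounds) (simp add: axis_def)
  then have "\<bar>\<Sum>k<level (x $ 1). layer k (x $ 1) * (saw k x * (axis (along k) 1 $ i))\<bar> \<le> 1"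
    by (intro abs_sum_layer_le) simp
  then show ?thesis by (simp add: vel_def vel_upto_def mult.assoc)
qed

lemma field_bound: assumes "0 \<le> c" shows "norm (field c z) \<le> (3 * c + 2) * 4"
proof -
  have "norm (vel (snd z)) \<le> (\<Sum>i\<in>UNIV. \<bar>vel (snd z) $ i\<bar>)" by (rule norm_le_l1_cart)
  also have "\<dots> \<le> (\<Sum>i\<in>(UNIV :: 3 set). 1)" by (intro sum_mono vel_bound)
  finally have "norm (axis 1 1 + vel (snd z)) \<le> 4"
    using norm_triangle_ineq[of "axis 1 1" "vel (snd z)"] by simp
  then show ?thesis unfolding field_def norm_scaleR
    using height_bound[OF assms, of "phase (snd z)"] by (intro mult_mono) auto
qed

section \<open>Integrals over the cylinder and the derivatives in the weak equations\<close>

lemma cylinder_borel: "cylinder half_space \<in> sets borel"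
  unfolding cylinder_def using half_space_borel borel_open[of "{0<..<1::real}"]
  by (simp add: borel_prod[symmetric] pair_measureI)

lemma integral_cylinder:
  fixes F :: "spacetime \<Rightarrow> real"
  assumes [measurable]: "F \<in> borel_measurable borel"
  shows "(LINT z|lebesgue_on (cylinder half_space). F z) = (LINT z|lborel. in_cyl z * F z)"
proof -
  have "(LINT z|lebesgue_on (cylinder half_space). F z) = (LINT z|lebesgue. indicator (cylinder half_space) z *\<^sub>R F z)"
    using cylinder_borel by (subst integral_restrict_space) auto
  also have "\<dots> = (LINT z|lebesgue. in_cyl z * F z)"
    by (intro Bochner_Integration.integral_cong refl)
      (auto simp: in_cyl_def cylinder_def half_space_def split: split_indicator)
  also have "\<dots> = (LINT z|lborel. in_cyl z * F z)"
    by (intro integral_completion) simp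
  finally show ?thesis .
qed

lemma integral_half_space:
  fixes F :: "real^3 \<Rightarrow> real"
  assumes [measurable]: "F \<in> borel_measurable borel"
  shows "(LINT x|lebesgue_on half_space. F x) = (LINT x|lborel. indicator half_space x * F x)"
proof -
  note [measurable] = half_space_borel
  have "(LINT x|lebesgue_on half_space. F x) = (LINT x|lebesgue. indicator half_space x *\<^sub>R F x)"
    using half_space_borel by (subst integral_restrict_space) auto
  also have "\<dots> = (LINT x|lborel. indicator half_space x * F x)"
    by (subst integral_completion) auto
  finally show ?thesis .
qed

lemma inner_grad_x:
  assumes "C1_compact \<phi>"
  shows "v \<bullet> grad_x \<phi> z = frechet_derivative \<phi> (at z) (0, v)"
proof -
  interpret C1_compact \<phi> by fact
  have "D (0, v) z = D (\<Sum>e\<in>Basis. (v \<bullet> e) *\<^sub>R (0, e)) z"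
    by (rule arg_cong[where f = "\<lambda>e. D e z"]) (simp add: prod_eq_iff fst_sum snd_sum euclidean_representation)
  also have "\<dots> = (\<Sum>e\<in>Basis. (v \<bullet> e) * D (0, e) z)"
    unfolding linear_sum[OF linD] by (simp add: linear_scale[OF linD] del: scaleR_Pair)
  finally show ?thesis by (simp add: grad_x_def inner_sum_right mult.commute)
qed

lemma measurable_grad_x:
  assumes "C1_compact \<phi>" shows "grad_x \<phi> \<in> borel_measurable borel"
proof -
  interpret C1_compact \<phi> by fact
  have "(0, e) \<in> Basis" if "e \<in> Basis" for e :: 'a using that by (simp add: Basis_prod_def)
  then show ?thesis unfolding grad_x_def[abs_def]
    by (intro borel_measurable_sum borel_measurable_scaleR measD) auto
qed

lemma time_Basis: "(1::real, 0::real^3) \<in> Basis" by (simp add: Basis_prod_def)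

lemma initial_test_function:
  assumes "\<phi> \<in> initial_test_functions"
  shows "C1_compact \<phi>" "\<And>t x. 1 \<le> t \<Longrightarrow> \<phi> (t, x) = 0"
    "\<And>t x e. 1 \<le> t \<Longrightarrow> frechet_derivative \<phi> (at (t, x)) e = 0"
proof -
  have \<phi>: "C_k 1 \<phi>" "compact (closure {x. \<phi> x \<noteq> 0})" "closure {x. \<phi> x \<noteq> 0} \<subseteq> {..<1} \<times> UNIV"
    using assms unfolding initial_test_functions_def test_functions_def compact_support_in_def by blast+
  show C: "C1_compact \<phi>" by unfold_locales (rule \<phi>)+
  show "frechet_derivative \<phi> (at (t, x)) e = 0" if "1 \<le> t" for t x e
    using \<phi>(3) that by (intro C1_compact.D_outside[OF C]) auto
  show "\<phi> (t, x) = 0" if "1 \<le> t" for t x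
    using \<phi>(3) that closure_subset[of "{x. \<phi> x \<noteq> 0}"] by fastforce
qed

lemma dt_eq: "dt \<phi> z = frechet_derivative \<phi> (at z) (1, 0)"
  by (simp add: dt_def)

lemma field_derivative:
  assumes "C1_compact \<phi>"
  shows "field c z \<bullet> grad_x \<phi> z = height c (phase (snd z)) * frechet_derivative \<phi> (at z) (0, axis 1 1 + vel (snd z))"
proof -
  interpret C1_compact \<phi> by fact
  have e: "(0, field c z) = height c (phase (snd z)) *\<^sub>R (0, axis 1 1 + vel (snd z))" by (simp add: field_def)
  show ?thesis unfolding inner_grad_x[OF assms] e linear_scale[OF linD] by (rule real_scaleR_def)
qed

lemma integral_dt:
  assumes "\<phi> \<in> initial_test_functions"
  shows "integrable lborel (\<lambda>z. in_cyl z * dt \<phi> z)"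
    and "(LINT z|lborel. in_cyl z * dt \<phi> z) = - (LINT x|lborel. indicator half_space x * \<phi> (0, x))"
proof -
  note \<phi> = initial_test_function[OF assms]
  interpret C1_compact \<phi> by (rule \<phi>)
  show "integrable lborel (\<lambda>z. in_cyl z * dt \<phi> z)"
    unfolding dt_eq by (rule integrable_mult_D[OF measurable_in_cyl _ time_Basis, of 1]) (simp add: in_cyl_def)
  show "(LINT z|lborel. in_cyl z * dt \<phi> z) = - (LINT x|lborel. indicator half_space x * \<phi> (0, x))"
    unfolding dt_eq by (rule initial_trace[OF \<phi>])
qed

text \<open>The field is a multiple of the cosine profile times (1, vel), minus c times (1, vel).
  The first part has no flux by \<open>transport\<close>. In the second, \<open>vel\<close> is
  divergence free and tangential, so only the constant normal field -c contributes.\<close>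

lemma integral_field_derivative:
  assumes "C1_compact \<phi>"
  shows "integrable lborel (\<lambda>z. in_cyl z * (field c z \<bullet> grad_x \<phi> z))"
    and "(LINT z|lborel. in_cyl z * (field c z \<bullet> grad_x \<phi> z)) =
      - c * (LINT z|lborel. in_cyl z * frechet_derivative \<phi> (at z) (dir 1))"
proof -
  interpret C1_compact \<phi> by fact
  let ?f = "\<lambda>z. in_cyl z * (cos (2 * pi * phase (snd z)) * D (0, axis 1 1 + vel (snd z)) z)"
  have f: "integrable lborel ?f" "(LINT z|lborel. ?f z) = 0"
    using cosine.transport[OF assms] by (simp_all add: has_bochner_integral_iff)
  have v: "integrable lborel (\<lambda>z. in_cyl z * D (0, vel (snd z)) z)" "(LINT z|lborel. in_cyl z * D (0, vel (snd z)) z) = 0"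
    using vel_divergence_free[OF assms] by (simp_all add: has_bochner_integral_iff)
  have n: "integrable lborel (\<lambda>z. in_cyl z * D (dir 1) z)"
    by (rule integrable_mult_D[OF measurable_in_cyl _ dir_Basis, of 1]) (simp add: in_cyl_def)
  have "(0, axis 1 1 + vel (snd z)) = dir 1 + (0, vel (snd z))" for z :: "spacetime"
    by (simp add: dir_def)
  then have "D (0, axis 1 1 + vel (snd z)) z = D (dir 1) z + D (0, vel (snd z)) z" for z
    by (simp only: linear_add[OF linD])
  then have e: "in_cyl z * (field c z \<bullet> grad_x \<phi> z) =
     2 * (c + 1) * ?f z - (c * (in_cyl z * D (dir 1) z) + c * (in_cyl z * D (0, vel (snd z)) z))" for z
    unfolding field_derivative[OF assms] height_def by (simp add: algebra_simps)
  show "integrable lborel (\<lambda>z. in_cyl z * (field c z \<bullet> grad_x \<phi> z))"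
    unfolding e using f v n by (intro Bochner_Integration.integrable_diff Bochner_Integration.integrable_add integrable_mult_right)
  have "(LINT z|lborel. in_cyl z * (field c z \<bullet> grad_x \<phi> z)) =
     2 * (c + 1) * (LINT z|lborel. ?f z) - (c * (LINT z|lborel. in_cyl z * D (dir 1) z) + c * (LINT z|lborel. in_cyl z * D (0, vel (snd z)) z))"
    unfolding e
    by (subst Bochner_Integration.integral_diff Bochner_Integration.integral_add,
        intro integrable_mult_right f, intro Bochner_Integration.integrable_add integrable_mult_right n v)
      (subst Bochner_Integration.integral_add, intro integrable_mult_right n, intro integrable_mult_right v, simp)
  then show "(LINT z|lborel. in_cyl z * (field c z \<bullet> grad_x \<phi> z)) = - c * (LINT z|lborel. in_cyl z * D (dir 1) z)"
    by (simp add: f v)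
qed

lemma clamp_affine:
  "\<forall>\<^sub>F h in at_right 0. max 0 (min 1 (t + h)) = max 0 (min 1 t) + h * of_bool (0 \<le> t \<and> t < (1::real))"
proof -
  consider "t < 0" | "0 \<le> t" "t < 1" | "1 \<le> t" by linarith
  then show ?thesis
  proof cases
    case 1
    then show ?thesis unfolding eventually_at_right_field by (intro exI[of _ "- t"]) auto
  next
    case 2
    then show ?thesis unfolding eventually_at_right_field by (intro exI[of _ "1 - t"]) auto
  next
    case 3
    then show ?thesis unfolding eventually_at_right_field by (intro exI[of _ 1]) auto
  qed
qed

text \<open>At fixed depth and phase, the time derivative of the solution is the height times minus
  its depth derivative, which is minus \<open>flux_profile_s\<close>. There is no initial term
  because the clamped function vanishes for t \<le> 0.\<close>

lemma sol_time_derivative: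
  assumes "C1_compact \<phi>" and c: "0 \<le> c"
  shows "(LINT z|lborel. sol c z * frechet_derivative \<phi> (at z) (1, 0)) =
    (LINT z|lborel. in_cyl z * (flux_profile_s c (fst z) (snd z $ 1) (phase (snd z)) * \<phi> z))"
proof -
  interpret C1_compact \<phi> by fact
  let ?t = "\<lambda>z::spacetime. max 0 (min 1 (fst z))"
  let ?B = "3 * c + 2"
  let ?E = "\<lambda>z. excess c (?t z) (snd z $ 1) (phase (snd z))"
  define w' where "w' z = of_bool (0 < snd z $ 1) * (sin (2 * pi * phase (snd z)) *
    (2 * ?E z * (height c (phase (snd z)) * of_bool (0 \<le> fst z \<and> fst z < 1))))" for z
  have B0: "0 \<le> ?B" using c by simp
  have "(LINT z|lborel. w' z * \<phi> z) = - (LINT z|lborel. sol c z * D (1, 0) z)"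
  proof (rule integration_by_parts(2)[OF measurable_sol sol_bound[OF c] _ _ time_Basis])
    fix z :: "spacetime" and h :: real
    assume h: "0 \<le> h" "h \<le> 1"
    let ?z = "z + h *\<^sub>R (1, 0)"
    show "\<bar>sol c ?z - sol c z\<bar> \<le> (?B * (2 * ?B)) * h"
    proof (cases "0 < snd z $ 1")
      case True
      have E: "\<bar>?E ?z\<bar> \<le> ?B" "\<bar>?E z\<bar> \<le> ?B"
        using True excess_bounds[OF c, of _ "snd z $ 1" "phase (snd z)"] by auto
      have "\<bar>?E ?z - ?E z\<bar> \<le> \<bar>height c (phase (snd z)) * (?t ?z - ?t z)\<bar>"
        unfolding excess_def by (auto simp: right_diff_distrib max_def)
      also have "\<dots> \<le> ?B * h"
        by (intro abs_mult_le height_bound[OF c]) (use h in auto)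
      finally have d: "\<bar>?E ?z - ?E z\<bar> \<le> ?B * h" .
      have "sol c ?z - sol c z = sin (2 * pi * phase (snd z)) * ((?E ?z - ?E z) * (?E ?z + ?E z))"
        using True by (simp add: sol_def algebra_simps power2_eq_square)
      also have "\<bar>\<dots>\<bar> \<le> 1 * ((?B * h) * (?B + ?B))"
        by (intro abs_mult_le d abs_add_le E abs_sin_le_one)
      finally show ?thesis by (simp add: algebra_simps)
    next
      case False
      then show ?thesis using mult_nonneg_nonneg[OF mult_nonneg_nonneg[OF B0, of "2 * ?B"] h(1)] B0
        by (simp add: sol_def)
    qed
  next
    fix z :: "spacetime"
    show "rderiv (1, 0) (sol c) z (w' z)"
    proof (cases "0 < snd z $ 1")
      case True
      let ?h = "height c (phase (snd z))" and ?d = "of_bool (0 \<le> fst z \<and> fst z < 1) :: real"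
      let ?q = "\<lambda>h. sin (2 * pi * phase (snd z)) * max 0 (?h * (?t z + h * ?d) - snd z $ 1) ^ 2"
      show ?thesis
      proof (rule rderiv_eventually[where q = ?q])
        show "\<forall>\<^sub>F h in at_right 0. sol c (z + h *\<^sub>R (1, 0)) = ?q h"
          using clamp_affine[of "fst z"] by eventually_elim (use True in \<open>simp add: sol_def excess_def\<close>)
        show "sol c z = ?q 0" using True by (simp add: sol_def excess_def)
        have "((\<lambda>h. ?h * (?t z + h * ?d) - snd z $ 1) has_real_derivative ?h * ?d) (at_right 0)"
          by (auto intro!: derivative_eq_intros)
        from DERIV_cmult[OF DERIV_pos_power_chain[OF this, of 0], of "sin (2 * pi * phase (snd z))"]
        show "(?q has_real_derivative w' z) (at_right 0)"
          using True by (simp add: w'_def excess_def numeral_2_eq_2)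
      qed
    next
      case False
      then show ?thesis using rderiv_const_along[of "sol c" z "(1, 0)"] by (simp add: sol_def w'_def)
    qed
  qed
  \<comment> \<open>The right derivative \<open>w'\<close> includes the time t = 0, which
    \<open>in_cyl\<close> leaves out. There the excess is 0 at every positive depth, so both sides
    agree.\<close>
  moreover have "w' z = - (in_cyl z * flux_profile_s c (fst z) (snd z $ 1) (phase (snd z)))" for z
  proof (cases "fst z = 0")
    case True
    then show ?thesis by (auto simp: w'_def in_cyl_def excess_def)
  next
    case False
    then show ?thesis by (auto simp: w'_def in_cyl_def flux_profile_s_def of_bool_def)
  qed
  ultimately show ?thesis by (simp add: mult.assoc)
qed

section \<open>Verification of the traces, the equation, nontriviality and variation\<close>

lemma cylinder_test_function:
  assumes "\<eta> \<in> test_functions (cylinder half_space)"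
  shows "\<eta> \<in> initial_test_functions" "\<And>x. \<eta> (0, x) = 0" "\<And>z. snd z \<in> wall \<Longrightarrow> \<eta> z = 0"
proof -
  have \<eta>: "\<forall>k. C_k k \<eta>" "compact_support_in (cylinder half_space) \<eta>"
    using assms by (auto simp: test_functions_def)
  have sub: "cylinder half_space \<subseteq> {..<1} \<times> UNIV" by (auto simp: cylinder_def)
  show "\<eta> \<in> initial_test_functions"
    using \<eta> sub by (auto simp: initial_test_functions_def test_functions_def compact_support_in_def)
  have "\<eta> z = 0" if "z \<notin> cylinder half_space" for z
    using \<eta>(2) that closure_subset[of "{x. \<eta> x \<noteq> 0}"] by (auto simp: compact_support_in_def)
  then show "\<And>x. \<eta> (0, x) = 0" "\<And>z. snd z \<in> wall \<Longrightarrow> \<eta> z = 0"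
    by (auto simp: cylinder_def half_space_def wall_def mem_Times_iff)
qed

text \<open>The assumption says that \<open>c\<close> is the constant of \<open>wall_trace\<close>.
  The volume integral to which the flux of the field reduces is then exactly the surface integral of
  \<phi>, so the trace is 1. Test functions supported inside the cylinder vanish on the wall, which
  gives the divergence condition.\<close>

lemma field_normal_trace:
  assumes c: "\<And>\<phi>. C1_compact \<phi> \<Longrightarrow> (LINT z|lateral_measure half_space. \<phi> z) =
       - c * (LINT z|lborel. in_cyl z * frechet_derivative \<phi> (at z) (dir 1))"
  shows "has_normal_trace half_space (field c) (\<lambda>_. 1)" "divergence_free half_space (field c)"
proof -
  have flux: "(LINT z|lebesgue_on (cylinder half_space). field c z \<bullet> grad_x \<phi> z) = (LINT z|lateral_measure half_space. \<phi> z)"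
    if \<phi>: "C1_compact \<phi>" for \<phi>
  proof -
    note [measurable] = measurable_grad_x[OF \<phi>]
    have "(LINT z|lebesgue_on (cylinder half_space). field c z \<bullet> grad_x \<phi> z) = (LINT z|lborel. in_cyl z * (field c z \<bullet> grad_x \<phi> z))"
      by (rule integral_cylinder) measurable
    then show ?thesis unfolding integral_field_derivative(2)[OF \<phi>] c[OF \<phi>] .
  qed
  show "has_normal_trace half_space (field c) (\<lambda>_. 1)"
    unfolding has_normal_trace_def
  proof (intro conjI ballI)
    show "Linfty (lateral_measure half_space) (\<lambda>_. 1 :: real)"
      unfolding Linfty_def by (intro conjI exI[of _ 1]) auto
    fix \<phi> :: "spacetime \<Rightarrow> real" assume \<phi>i: "\<phi> \<in> initial_test_functions"
    note \<phi> = initial_test_function[OF \<phi>i]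
    interpret C1_compact \<phi> by (rule \<phi>)
    note [measurable] = measurable_grad_x[OF \<phi>(1)] measD[OF time_Basis]
    have [measurable]: "dt \<phi> \<in> borel_measurable borel" unfolding dt_eq[abs_def] by measurable
    have [measurable]: "(\<lambda>x. \<phi> (0, x)) \<in> borel_measurable borel"
      by (intro borel_measurable_continuous_onI continuous_on_compose2[OF cont] continuous_intros) auto
    have "(LINT z|lebesgue_on (cylinder half_space). dt \<phi> z + field c z \<bullet> grad_x \<phi> z) =
       (LINT z|lborel. in_cyl z * dt \<phi> z + in_cyl z * (field c z \<bullet> grad_x \<phi> z))"
      by (subst integral_cylinder) (simp_all add: distrib_left)
    also have "\<dots> = - (LINT x|lborel. indicator half_space x * \<phi> (0, x)) + (LINT z|lateral_measure half_space. \<phi> z)"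
      unfolding Bochner_Integration.integral_add[OF integral_dt(1)[OF \<phi>i] integral_field_derivative(1)[OF \<phi>(1)]]
        integral_dt(2)[OF \<phi>i] integral_field_derivative(2)[OF \<phi>(1)] c[OF \<phi>(1)] ..
    finally show "(LINT z|lateral_measure half_space. 1 * \<phi> z) - (LINT x|lebesgue_on half_space. \<phi> (0, x)) =
        (LINT z|lebesgue_on (cylinder half_space). dt \<phi> z + field c z \<bullet> grad_x \<phi> z)"
      by (simp add: integral_half_space)
  qed
  show "divergence_free half_space (field c)"
    unfolding divergence_free_def
  proof
    fix \<eta> assume "\<eta> \<in> test_functions (cylinder half_space)"
    note \<eta> = cylinder_test_function[OF this]
    have "(LINT z|lateral_measure half_space. \<eta> z) = (LINT z|lateral_measure half_space. 0)"
      by (intro Bochner_Integration.integral_cong refl \<eta>(3)) (auto simp: lateral_measure_eq space_pair_measure)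
    then show "(LINT z|lebesgue_on (cylinder half_space). field c z \<bullet> grad_x \<eta> z) = 0"
      using flux[OF initial_test_function(1)[OF \<eta>(1)]] by simp
  qed
qed

text \<open>The time derivative yields the integral of \<open>flux_profile_s\<close> times \<phi>,
  and \<open>transport\<close>, applied to the height times the solution, shows that the flux term
  yields its negative. Since \<phi> need not vanish at t = 0 or on the wall, this single identity
  contains the equation, the zero initial datum and the zero trace.\<close>

lemma sol_equation:
  assumes c: "0 \<le> c" and \<phi>i: "\<phi> \<in> initial_test_functions"
  shows "(LINT z|lebesgue_on (cylinder half_space). sol c z * (dt \<phi> z + field c z \<bullet> grad_x \<phi> z)) = 0"
proof -
  note \<phi> = initial_test_function[OF \<phi>i]
  interpret C1_compact \<phi> by (rule \<phi>)
  note [measurable] = measurable_grad_x[OF \<phi>(1)] measD[OF time_Basis]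
  have [measurable]: "dt \<phi> \<in> borel_measurable borel" unfolding dt_eq[abs_def] by measurable
  obtain M L where "profile (flux_profile c) (flux_profile_s c) (flux_profile_p c) (flux_antiderivative c) M L"
    using flux_profile_profile[OF c] by blast
  then interpret profile "flux_profile c" "flux_profile_s c" "flux_profile_p c" "flux_antiderivative c" M L .
  let ?gs = "\<lambda>z. flux_profile_s c (fst z) (snd z $ 1) (phase (snd z))"
  let ?S = "\<lambda>z. in_cyl z * (?gs z * \<phi> z)"
  let ?T = "\<lambda>z. in_cyl z * (?gs z * \<phi> z + flux_profile c (fst z) (snd z $ 1) (phase (snd z)) * D (0, axis 1 1 + vel (snd z)) z)"
  have T: "integrable lborel ?T" "(LINT z|lborel. ?T z) = 0" using transport[OF \<phi>(1)] by (simp_all only: has_bochner_integral_iff)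
  have d: "integrable lborel (\<lambda>z. sol c z * D (1, 0) z)"
    by (rule integrable_mult_D[OF measurable_sol sol_bound[OF c] time_Basis])
  have [measurable]: "?gs \<in> borel_measurable borel"
    unfolding flux_profile_s_def excess_def borel_prod[symmetric] by measurable
  have S: "integrable lborel ?S"
  proof -
    have "\<bar>in_cyl z * ?gs z\<bar> \<le> M" for z
      using bounded(2)[of "fst z" "snd z $ 1" "phase (snd z)"] M0 by (auto simp: in_cyl_def)
    then have "integrable lborel (\<lambda>z. in_cyl z * ?gs z * \<phi> z)" by (intro integrable_mult) measurable
    then show ?thesis by (simp add: mult.assoc)
  qed
  have e: "in_cyl z * (sol c z * (dt \<phi> z + field c z \<bullet> grad_x \<phi> z)) = sol c z * D (1, 0) z + (?T z - ?S z)" for z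
  proof (cases "in_cyl z = 0")
    case True
    have "sol c z * D (1, 0) z = 0"
    proof -
      consider "fst z \<le> 0" | "1 \<le> fst z" | "snd z $ 1 \<le> 0" using True by (force simp: in_cyl_def)
      then show ?thesis
      proof cases
        case 2
        then show ?thesis using \<phi>(3)[of "fst z" "snd z"] by simp
      qed (auto simp: sol_def excess_def)
    qed
    then show ?thesis using True by simp
  next
    case False
    then have z: "0 < fst z" "fst z < 1" "0 < snd z $ 1" by (auto simp: in_cyl_def)
    have "sol c z * height c (phase (snd z)) = flux_profile c (fst z) (snd z $ 1) (phase (snd z))"
      using z by (simp add: sol_def flux_profile_def)
    then show ?thesis using z unfolding field_derivative[OF \<phi>(1)] dt_eq
      by (simp add: in_cyl_def distrib_left mult.assoc[symmetric])
  qed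
  have "(LINT z|lebesgue_on (cylinder half_space). sol c z * (dt \<phi> z + field c z \<bullet> grad_x \<phi> z)) =
     (LINT z|lborel. sol c z * D (1, 0) z + (?T z - ?S z))"
    unfolding e[symmetric] by (rule integral_cylinder) measurable
  also have "\<dots> = (LINT z|lborel. sol c z * D (1, 0) z) + ((LINT z|lborel. ?T z) - (LINT z|lborel. ?S z))"
    unfolding Bochner_Integration.integral_add[OF d Bochner_Integration.integrable_diff[OF T(1) S]]
      Bochner_Integration.integral_diff[OF T(1) S] ..
  also have "\<dots> = 0" unfolding T(2) sol_time_derivative[OF \<phi>(1) c] by simp
  finally show ?thesis .
qed

lemma Linfty_restrict:
  assumes "f \<in> borel_measurable borel" and "\<And>z. norm (f z) \<le> C"
  shows "Linfty (lebesgue_on S) f"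
proof -
  have "f \<in> borel_measurable (lebesgue_on S)"
    by (intro measurable_restrict_space1 measurable_completion) (simp add: assms(1))
  then show ?thesis unfolding Linfty_def using assms(2) by blast
qed

lemma sol_solution:
  assumes c: "0 \<le> c"
  shows "zero_initial_solution_with_trace half_space (field c) (\<lambda>_. 0) (\<lambda>z. real n * sol c z)"
proof -
  have eq: "(LINT z|lebesgue_on (cylinder half_space). real n * sol c z * (dt \<phi> z + field c z \<bullet> grad_x \<phi> z)) = 0"
    if "\<phi> \<in> initial_test_functions" for \<phi>
    using sol_equation[OF c that] by (simp add: mult.assoc)
  have "Linfty (lebesgue_on (cylinder half_space)) (\<lambda>z. real n * sol c z)"
  proof (rule Linfty_restrict)
    show "norm (real n * sol c z) \<le> real n * (1 * ((3 * c + 2) * (3 * c + 2)))" for z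
      unfolding real_norm_def by (intro abs_mult_le sol_bound[OF c]) auto
  qed measurable
  moreover have "continuity_eq half_space (field c) (\<lambda>z. real n * sol c z)"
    unfolding continuity_eq_def using eq cylinder_test_function(1) by blast
  moreover have "has_flux_traces half_space (field c) (\<lambda>z. real n * sol c z) (\<lambda>_. 0) (\<lambda>_. 0)"
    unfolding has_flux_traces_def using eq by (auto simp: Linfty_def intro!: exI[of _ 0])
  ultimately show ?thesis unfolding zero_initial_solution_with_trace_def by blast
qed

lemma sol_nonzero:
  assumes c: "0 \<le> c"
  shows "\<not> (AE z in lebesgue_on (cylinder half_space). sol c z = 0)"
proof
  assume "AE z in lebesgue_on (cylinder half_space). sol c z = 0"
  then have ae: "AE z in lebesgue. z \<in> cylinder half_space \<longrightarrow> sol c z = 0"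
    using cylinder_borel by (subst (asm) AE_restrict_space_iff) auto
  \<comment> \<open>On W only layer 0 is active, and neither its ramp nor its sawtooth has a kink or
    jump, so the phase is the polynomial \<open>p\<close>.\<close>
  define W :: "(spacetime) set" where
    "W = {z. 0 < fst z \<and> fst z < 1 \<and> 1 / 2 < snd z $ 1 \<and> snd z $ 1 < 1 \<and> 0 < snd z $ 3 \<and> snd z $ 3 < 1 / 3}"
  define p where "p x = 2 * x $ 2 + x $ 3 + 2 * (1 - x $ 1) * (3 * x $ 3)" for x :: "real^3"
  define v where "v z = sin (2 * pi * p (snd z)) * max 0 (height c (p (snd z)) * fst z - snd z $ 1) ^ 2" for z :: "spacetime"
  have sol_v: "sol c z = v z" if z: "z \<in> W" for z
  proof -
    have "phase (snd z) = phase_upto 1 (snd z)" using z by (intro phase_eq) (auto simp: W_def)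
    also have "\<dots> = p (snd z)"
      using z frac_eq[of "3 * snd z $ 3"]
      by (auto simp: phase_upto_def p_def ramp_def saw_def across_def W_def)
    finally show ?thesis using z by (simp add: sol_def v_def excess_def W_def)
  qed
  have "open (W \<inter> v -` (- {0}))"
  proof (rule open_Int)
    show W: "open W" unfolding W_def
      by (intro open_Collect_conj open_Collect_less continuous_intros)
    show "open (v -` (- {0}))"
      unfolding v_def p_def by (intro open_vimage continuous_intros)
  qed
  moreover have "W \<inter> v -` (- {0}) \<noteq> {}"
  proof -
    \<comment> \<open>The point satisfies p x = - 4/10 + 1/6 + 4/10 = 1/6, where the height is 1 for
      every c. At time 9/10 the excess is then 9/10 - 6/10, and the sine is not 0.\<close>
    define x :: "real^3" where "x = vector [6 / 10, - (2 / 10), 1 / 6]"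
    have x: "x $ 1 = 6 / 10" "x $ 2 = - (2 / 10)" "x $ 3 = 1 / 6" by (simp_all add: x_def)
    have p: "p x = 1 / 6" by (simp add: p_def x)
    have "height c (p x) = 1" unfolding p height_def by (simp add: cos_60 field_simps)
    moreover have "sin (2 * pi * p x) \<noteq> 0" unfolding p by (simp add: sin_60)
    ultimately have "(9 / 10, x) \<in> W \<inter> v -` (- {0})" by (auto simp: W_def v_def x)
    then show ?thesis by blast
  qed
  moreover have "negligible (W \<inter> v -` (- {0}))"
  proof -
    have "W \<inter> v -` (- {0}) \<subseteq> {z. \<not> (z \<in> cylinder half_space \<longrightarrow> sol c z = 0)}"
      using sol_v by (auto simp: W_def cylinder_def half_space_def mem_Times_iff)
    moreover have "negligible {z. \<not> (z \<in> cylinder half_space \<longrightarrow> sol c z = 0)}"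
      using ae unfolding eventually_ae_filter negligible_iff_null_sets
      by (auto intro: null_sets_completion_subset)
    ultimately show ?thesis by (rule negligible_subset[rotated])
  qed
  ultimately show False using open_not_negligible by blast
qed

text \<open>The problem is linear and homogeneous, so one nontrivial solution yields a sequence of
  them. Two different multiples differ wherever \<open>u\<close> is not 0, which is not a null
  set.\<close>

lemma infinitely_many_multiples:
  assumes "\<And>n. P (\<lambda>z. real n * u z)" and nz: "\<not> (AE z in M. u z = 0)"
  shows "infinitely_many_ae M P"
  unfolding infinitely_many_ae_def
proof (intro exI conjI)
  let ?f = "\<lambda>n z. real n * u z"
  have neq: "\<not> (AE z in M. ?f m z = ?f n z)" if "m \<noteq> n" for m n
    using nz that by simp
  have "inj ?f"
  proof (rule injI)
    fix m n assume "?f m = ?f n"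
    then have "?f m z = ?f n z" for z by (rule fun_cong)
    then have "AE z in M. ?f m z = ?f n z" by (intro AE_I2)
    then show "m = n" using neq by blast
  qed
  then show "infinite (range ?f)" by (simp add: range_inj_infinite)
  show "\<forall>u\<in>range ?f. P u" using assms(1) by auto
  show "pairwise (\<lambda>u v. \<not> (AE z in M. u z = v z)) (range ?f)"
    using neq by (auto simp: pairwise_def)
qed

text \<open>The closure of U is compact inside the half space, so x_1 has a positive minimum on it
  and finitely many layers meet U. The variation is then finite, and as the field is stationary its
  norm is constant in time.\<close>

lemma field_L1_BV:
  assumes c: "0 \<le> c" and U: "open U" "bounded U" "closure U \<subseteq> half_space"
  shows "L1_BV {0..<1} U (\<lambda>t x. field c (t, x))"
proof -
  define f where "f x = field c (0, x)" for x
  have ft: "field c (t, x) = f x" for t x by (simp add: f_def field_def)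
  have f_eq: "f = (\<lambda>x. height c (phase x) *\<^sub>R (axis 1 1 + vel x))" by (simp add: f_def field_def fun_eq_iff)
  have fm: "f \<in> borel_measurable borel" unfolding f_eq by measurable
  then have fmU: "f \<in> borel_measurable (lebesgue_on U)"
    by (intro measurable_restrict_space1 measurable_completion) simp
  obtain n where n: "\<And>x. x \<in> U \<Longrightarrow> 0 < x $ 1 \<and> 1 \<le> 2 ^ n * x $ 1"
  proof (cases "closure U = {}")
    case True
    then show thesis using that[of 0] by auto
  next
    case False
    have "compact (closure U)" using U(2) by (simp add: compact_closure)
    moreover have "continuous_on (closure U) (\<lambda>x. x $ 1)" by (intro continuous_intros)
    ultimately obtain x0 where x0: "x0 \<in> closure U" "\<And>y. y \<in> closure U \<Longrightarrow> x0 $ 1 \<le> y $ 1"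
      using continuous_attains_inf[OF _ False, of "\<lambda>x. x $ 1"] by blast
    then have pos: "0 < x0 $ 1" using U(3) by (auto simp: half_space_def)
    obtain n where n: "1 < 2 ^ n * x0 $ 1" using eventually_scaling[OF pos] by (auto simp: eventually_sequentially)
    show thesis
    proof (rule that[of n])
      fix x assume "x \<in> U"
      then have x: "x0 $ 1 \<le> x $ 1" using x0(2) closure_subset by blast
      then have "2 ^ n * x0 $ 1 \<le> 2 ^ n * x $ 1" by (intro mult_left_mono) auto
      then show "0 < x $ 1 \<and> 1 \<le> 2 ^ n * x $ 1" using n pos x by linarith
    qed
  qed
  obtain R where R: "0 < R" "\<And>x. x \<in> U \<Longrightarrow> norm x \<le> R" using U(2) by (auto simp: bounded_pos)
  define F where "F x = height c (phase_upto n x) *\<^sub>R (axis 1 1 + vel_upto n x)" for x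
  have hl: "\<bar>height c p - height c q\<bar> \<le> (2 * (c + 1) * (2 * pi)) * \<bar>p - q\<bar>" for p q
  proof -
    have "height c p - height c q = 2 * (c + 1) * (cos (2 * pi * p) - cos (2 * pi * q))"
      by (simp add: height_def right_diff_distrib)
    also have "\<bar>\<dots>\<bar> \<le> 2 * (c + 1) * (2 * pi * \<bar>p - q\<bar>)"
      by (intro abs_mult_le cos_2pi_lipschitz) (use c in auto)
    finally show ?thesis by (simp add: mult.assoc)
  qed
  have "L1_lip R (\<lambda>x. F x $ i)" for i
  proof -
    have "L1_lip R (\<lambda>x. height c (phase_upto n x) * (axis 1 1 $ i + vel_upto n x $ i))"
      using R(1) by (intro L1_lip_mult L1_lip_add L1_lip_const L1_lip_vel_upto
          L1_lip_compose[OF L1_lip_phase_upto hl]) auto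
    then show ?thesis by (simp add: F_def)
  qed
  moreover have "f x = F x" if "x \<in> U" for x
    using phase_eq[of x n] n[OF that] by (simp add: f_def field_def F_def)
  ultimately have var: "variation U f < \<infinity>"
    using U(1) R(2) by (intro variation_finite[of U R F f]) auto
  have "emeasure lebesgue U < \<infinity>"
    using emeasure_bounded_finite[OF U(2)] U(1) by (simp add: emeasure_completion)
  then interpret fin: finite_measure "lebesgue_on U"
    using U(1) by (intro finite_measureI) (simp add: emeasure_restrict_space)
  have int: "integrable (lebesgue_on U) f"
    by (rule fin.integrable_const_bound[of _ "(3 * c + 2) * 4", OF AE_I2 fmU])
      (simp only: f_def field_bound[OF c])
  have "BV U f" using int var by (simp add: BV_def)
  moreover have "BV_norm U f < \<infinity>"
    using int var by (simp add: BV_norm_def integrable_iff_bounded)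
  moreover have "emeasure (lebesgue_on {0..<1::real}) (space (lebesgue_on {0..<1})) = 1"
    by (simp add: emeasure_restrict_space)
  ultimately show ?thesis
    unfolding L1_BV_def ft by simp
qed

theorem corollary1p4:
  shows "\<exists>b :: real \<times> (real^3) \<Rightarrow> real^3.
    Linfty (lebesgue_on (cylinder half_space)) b \<and>
    divergence_free half_space b \<and>
    (\<forall>U. open U \<and> bounded U \<and> closure U \<subseteq> half_space \<longrightarrow>
       L1_BV {0..<1} U (\<lambda>t x. b (t, x))) \<and>
    has_normal_trace half_space b (\<lambda>_. 1) \<and>
    infinitely_many_ae (lebesgue_on (cylinder half_space))
      (zero_initial_solution half_space b) \<and>
    infinitely_many_ae (lebesgue_on (cylinder half_space))
      (zero_initial_solution_with_trace half_space b (\<lambda>_. 0))"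
proof -
  obtain c where c: "0 \<le> c" and trace: "\<And>\<phi>. C1_compact \<phi> \<Longrightarrow> (LINT z|lateral_measure half_space. \<phi> z) =
       - c * (LINT z|lborel. in_cyl z * frechet_derivative \<phi> (at z) (dir 1))"
    by (rule wall_trace) blast
  have "infinitely_many_ae (lebesgue_on (cylinder half_space)) (zero_initial_solution_with_trace half_space (field c) (\<lambda>_. 0))"
    by (rule infinitely_many_multiples[of _ "sol c"]) (rule sol_solution[OF c], rule sol_nonzero[OF c])
  moreover have "infinitely_many_ae (lebesgue_on (cylinder half_space)) (zero_initial_solution half_space (field c))"
    by (rule infinitely_many_multiples[of _ "sol c"])
      (use sol_solution[OF c] sol_nonzero[OF c] in \<open>auto simp: zero_initial_solution_def\<close>)
  ultimately show ?thesis
    using Linfty_restrict[OF measurable_field field_bound[OF c]] field_L1_BV[OF c] field_normal_trace[OF trace]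
    by (intro exI[of _ "field c"]) blast
qed

end
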